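(* Let $(\mathbf X_i,\varepsilon_i)$, $1\le i\le n$, be i.i.d. pairs satisfying assumptions (Q) and (N) of the context (with constants $C_X$ and $\sigma$), and let $Y_i=\mathbf X_i^\top\boldsymbol\theta^\circ+\varepsilon_i$ with $\boldsymbol\theta^\circ\in\mathbb R^d\setminus\{0\}$. Let $\sigma_1\ge\dots\ge\sigma_d$ be the eigenvalues of $\Sigma$. Let $\delta\in(0,1)$, $\mu>0$, $\lambda>0$ be such that all of the following hold: (a) $\|\boldsymbol\theta^\circ\|\le\mu/420$ and $\|\boldsymbol\theta^\circ\|\,\|\Sigma\|\le\mu\sqrt\lambda/168$; (b) $4\,\mathtt r(\Sigma)^2+\log(4/\delta)\le n$ and $2^{12}(1+C_X)^2(\mathtt r(\Sigma)+\log(2/\delta))\le n$; (c) $\mu\ge112\|\boldsymbol\theta^\circ\|$, $\ \|\Sigma\|\,\|\boldsymbol\theta^\circ\|\le\dfrac{\mu\sqrt\lambda}{8\cdot18\cdot56}$, $\ 5\sigma\|\Sigma\|^{1/2}\sqrt{\dfrac{\mathtt r(\Sigma)+\log(4/\delta)}n}\le\|\boldsymbol\theta^\circ\|\min\{\sqrt\lambda,\|\Sigma\|\}$; (d) $17(1+C_X)\|\Sigma\|\sqrt{\dfrac{4\,\mathtt r(\Sigma)+\log(2/\delta)}n}\le\sqrt\lambda$; (e) $\mu\sqrt\lambda\ge395\cdot8\,\sigma\|\Sigma\|\sqrt{\dfrac{\mathtt r(\Sigma)+\log(4/\delta)}n}$ and $\sqrt\lambda\ge395\cdot8\,C_X\|\Sigma\|\sqrt{\dfrac{\mathtt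 r(\Sigma)+\log(4/\delta)}n}$; (f) with $k^*=\max\{k:\sigma_k^2\ge2\lambda\}$ (the set being nonempty), $$\left(1+\frac{2\lambda}{\|\Sigma\|^2}\right)^2\big(k^*+r_4(k^* )\big)+\log(4/\delta)\le n\quad\text{and}\quad k^*+r_2(k^* )+0.25\log(4/\delta)\le n .$$ Let $\widehat{\boldsymbol\theta}$ be the $\boldsymbol\theta$-component of a minimizer of the empirical objective $\mathtt L$ defined in the context. Then, with probability at least $1-8\delta$, $$\|\Sigma^{1/2}(\widehat{\boldsymbol\theta}-\boldsymbol\theta^\circ)\|\le\|\Sigma^{1/2}\mathbf b_\lambda\|+4\big(2\sigma+C_X\|\Sigma^{1/2}\mathbf b_\lambda\|\big)\sqrt{\frac{k^*+r_4(k^* )+\log(4/\delta)}n}+\frac{2C_X\|\Sigma^{3/2}\mathbf b_\lambda\|}{\sqrt{2\lambda}}\sqrt{\frac{4k^*+4r_2(k^* )+\log(4/\delta)}n}+\diamondsuit,$$ where $\mathbf b_\lambda=-\lambda(\Sigma^2/2+\lambda I_d)^{-1}\boldsymbol\theta^\circ$ and $$\diamondsuit=210\left(\frac{\|\boldsymbol\theta^\circ\|}\mu+\frac{\|\Sigma\|\,\|\mathbf b_\lambda\|}{\mu\sqrt\lambda}\right)\|\Sigma\|^{1/2}\|\mathbf b_\lambda\|+\frac{\|\boldsymbol\theta^\circ\|}{\lambda^{1/4}}\left(\Big(\frac{17\|\boldsymbol\theta^\circ\|}\mu\Big)^2+\frac{\|\mathbf b_\lambda\|}{160\mu}\right)\sqrt{\Psi(n,\delta)}+\frac{19\|\boldsymbol\theta^\circ\|}{\sqrt3\,\lambda^{3/4}}\left(1+\sqrt{\frac{\Psi(n,\delta)}\lambda}\right)\Psi(n,\delta),$$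 $$\Psi(n,\delta)=196\left(\frac{\sigma\|\Sigma\|^{1/2}}{\|\boldsymbol\theta^\circ\|}+2C_X\|\Sigma\|\right)^2\cdot\frac{\mathtt r(\Sigma)^2+\log(4/\delta)}n .$$
   Context: Notation: $\|\cdot\|$ is the Euclidean norm of vectors and the operator norm of matrices, $\|\cdot\|_{\rm F}$ the Frobenius norm. For a nonzero symmetric positive semidefinite $B$, the effective rank is $\mathtt r(B)=\mathrm{Tr}(B)/\|B\|$. For a random variable $\xi$, $\|\xi\|_{\psi_1}=\inf\{t>0:\mathbb E e^{|\xi|/t}\le2\}$; for a random vector $\boldsymbol\nu$, $\|\boldsymbol\nu\|_{\psi_1}=\sup_{\|\mathbf u\|=1}\|\mathbf u^\top\boldsymbol\nu\|_{\psi_1}$. For $q>0$ and $k\in\{1,\dots,d\}$, $r_q(k)=\sum_{j>k}(\sigma_j/\sigma_{k+1})^q$ (sum over $k<j\le d$; equal to $0$ if $k=d$). The vectors $\mathbf X,\mathbf X_1,\dots,\mathbf X_n\in\mathbb R^d$ are i.i.d. with $\mathbb E\|\mathbf X\|^2<\infty$, and $\Sigma=\mathbb E\mathbf X\mathbf X^\top$ is invertible. (Q) There is a constant $C_X>0$ such that for every nonzero $M\in\mathbb R^{d\times d}$ and every real $s$ with $C_X|s|\le1/\|M\|_{\rm F}$, $$\log\mathbb E\exp\{s(\Sigma^{-1/2}\mathbf X)^\top M(\Sigma^{-1/2}\mathbf X)\}\le s\,\mathrm{Tr}(M)+C_X^2s^2\|M\|_{\rm F}^2 .$$ (N) The i.i.d.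 pairs $(\mathbf X_i,\varepsilon_i)\in\mathbb R^d\times\mathbb R$ satisfy $\mathbb E(\varepsilon_1\mid\mathbf X_1)=0$, $\mathbb E\mathbf X_1\mathbf X_1^\top=\Sigma$ and $\|\Sigma^{-1/2}\mathbf X_1\varepsilon_1\|_{\psi_1}=\sigma<\infty$. Put $\widehat\Sigma=\frac1n\sum_{i=1}^n\mathbf X_i\mathbf X_i^\top$ and $\mathbf Z=\frac1n\sum_{i=1}^n\mathbf X_iY_i$. For $(\boldsymbol\theta,\boldsymbol\eta,A)\in\mathbb R^d\times\mathbb R^d\times\mathbb R^{d\times d}$ the empirical objective is $$\mathtt L(\boldsymbol\theta,\boldsymbol\eta,A)=\tfrac12\|\mathbf Z-\boldsymbol\eta\|^2+\tfrac12\|\boldsymbol\eta-A\boldsymbol\theta\|^2+\tfrac{\mu^2}2\|\widehat\Sigma-A\|_{\rm F}^2+\tfrac\lambda2\|\boldsymbol\theta\|^2 .$$ *)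

theory Defs
  imports "HOL-Probability.Probability"
begin

text \<open>On matrices the library \<^const>\<open>norm\<close> is the Frobenius norm, not the operator norm;
  to keep the two apart, \<^const>\<open>norm\<close> is used for vectors only.\<close>

abbreviation op_norm :: "real^'d^'d \<Rightarrow> real" where
  "op_norm A \<equiv> onorm (\<lambda>x. A *v x)"

definition frob_norm :: "real^'d^'d \<Rightarrow> real" where
  "frob_norm A = sqrt (\<Sum>i\<in>UNIV. \<Sum>j\<in>UNIV. (A $ i $ j)\<^sup>2)"

definition psd :: "real^'d^'d \<Rightarrow> bool" where
  "psd A \<longleftrightarrow> transpose A = A \<and> (\<forall>x. 0 \<le> x \<bullet> (A *v x))"

text \<open>The square root is only meaningful for a symmetric positive semidefinite argument,
  which has exactly one symmetric positive semidefinite square root.\<close>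

definition mat_sqrt :: "real^'d^'d \<Rightarrow> real^'d^'d" where
  "mat_sqrt A = (THE B. psd B \<and> B ** B = A)"

definition eff_rank :: "real^'d^'d \<Rightarrow> real" where
  "eff_rank B = trace B / op_norm B"

text \<open>\<open>eigenvalues_desc A eig\<close>: \<open>eig 1 \<ge> \<dots> \<ge> eig d\<close> are all eigenvalues of \<open>A\<close>, repeated
  according to multiplicity (roots of the characteristic polynomial). Values of \<open>eig\<close> outside
  \<open>{1..d}\<close> are irrelevant.\<close>

definition eigenvalues_desc :: "real^'d^'d \<Rightarrow> (nat \<Rightarrow> real) \<Rightarrow> bool" where
  "eigenvalues_desc A eig \<longleftrightarrow>
     (\<forall>i j. 1 \<le> i \<longrightarrow> i \<le> j \<longrightarrow> j \<le> CARD('d) \<longrightarrow> eig j \<le> eig i) \<and>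
     (\<forall>t. det (mat t - A) = (\<Prod>j=1..CARD('d). t - eig j))"

definition tail_rank :: "nat \<Rightarrow> (nat \<Rightarrow> real) \<Rightarrow> real \<Rightarrow> nat \<Rightarrow> real" where
  "tail_rank d eig q k = (\<Sum>j\<in>{k<..d}. (eig j / eig (k + 1)) powr q)"

definition outer :: "real^'d \<Rightarrow> real^'d^'d" where
  "outer x = (\<chi> i j. x $ i * x $ j)"

text \<open>Extended-real valued, with the nonnegative integral: the norm is \<open>\<infinity>\<close> if no \<open>t\<close> is
  admissible, and a non-integrable exponential does not count as having expectation 0.\<close>

definition psi1_norm :: "'w measure \<Rightarrow> ('w \<Rightarrow> real) \<Rightarrow> ennreal" where
  "psi1_norm P \<xi> = Inf {ennreal t |t. 0 < t \<and> (\<integral>\<^sup>+\<omega>. ennreal (exp (\<bar>\<xi> \<omega>\<bar> / t)) \<partial>P) \<le> 2}"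

definition psi1_norm_vec :: "'w measure \<Rightarrow> ('w \<Rightarrow> real^'d) \<Rightarrow> ennreal" where
  "psi1_norm_vec P \<nu> = (SUP u\<in>{u. norm u = 1}. psi1_norm P (\<lambda>\<omega>. u \<bullet> \<nu> \<omega>))"

definition second_moment :: "'w measure \<Rightarrow> ('w \<Rightarrow> real^'d) \<Rightarrow> real^'d^'d" where
  "second_moment P X = (\<integral>\<omega>. outer (X \<omega>) \<partial>P)"

definition iid_pairs ::
  "'w measure \<Rightarrow> nat \<Rightarrow> (nat \<Rightarrow> 'w \<Rightarrow> real^'d) \<Rightarrow> (nat \<Rightarrow> 'w \<Rightarrow> real) \<Rightarrow> bool" where
  "iid_pairs P n X \<epsilon> \<longleftrightarrow>
     prob_space.indep_vars P (\<lambda>_. borel) (\<lambda>i \<omega>. (X i \<omega>, \<epsilon> i \<omega>)) {1..n} \<and>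
     (\<forall>i\<in>{1..n}. distr P borel (\<lambda>\<omega>. (X i \<omega>, \<epsilon> i \<omega>)) = distr P borel (\<lambda>\<omega>. (X 1 \<omega>, \<epsilon> 1 \<omega>)))"

text \<open>The integrability clause says that the expectation inside the logarithm is finite, as the
  inequality requires; the Bochner integral of a non-integrable function would be 0.\<close>

definition assumption_Q :: "'w measure \<Rightarrow> ('w \<Rightarrow> real^'d) \<Rightarrow> real^'d^'d \<Rightarrow> real \<Rightarrow> bool" where
  "assumption_Q P X \<Sigma> C \<longleftrightarrow> 0 < C \<and>
     (\<forall>M s. M \<noteq> 0 \<longrightarrow> C * \<bar>s\<bar> \<le> 1 / frob_norm M \<longrightarrow>
        (let W = (\<lambda>\<omega>. matrix_inv (mat_sqrt \<Sigma>) *v X \<omega>);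
             E = (\<lambda>\<omega>. exp (s * (W \<omega> \<bullet> (M *v W \<omega>))))
         in integrable P E \<and>
            ln (\<integral>\<omega>. E \<omega> \<partial>P) \<le> s * trace M + C\<^sup>2 * s\<^sup>2 * (frob_norm M)\<^sup>2))"

definition assumption_N ::
  "'w measure \<Rightarrow> ('w \<Rightarrow> real^'d) \<Rightarrow> ('w \<Rightarrow> real) \<Rightarrow> real^'d^'d \<Rightarrow> real \<Rightarrow> bool" where
  "assumption_N P X \<epsilon> \<Sigma> \<sigma> \<longleftrightarrow>
     integrable P \<epsilon> \<and>
     (AE \<omega> in P. real_cond_exp P (vimage_algebra (space P) X borel) \<epsilon> \<omega> = 0) \<and>
     second_moment P X = \<Sigma> \<and>
     0 \<le> \<sigma> \<and>
     psi1_norm_vec P (\<lambda>\<omega>. \<epsilon> \<omega> *\<^sub>R (matrix_inv (mat_sqrt \<Sigma>) *v X \<omega>)) = ennreal \<sigma>"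

definition Sigma_hat :: "nat \<Rightarrow> (nat \<Rightarrow> real^'d) \<Rightarrow> real^'d^'d" where
  "Sigma_hat n x = (1 / real n) *\<^sub>R (\<Sum>i=1..n. outer (x i))"

definition Z_vec :: "nat \<Rightarrow> (nat \<Rightarrow> real^'d) \<Rightarrow> (nat \<Rightarrow> real) \<Rightarrow> real^'d" where
  "Z_vec n x y = (1 / real n) *\<^sub>R (\<Sum>i=1..n. y i *\<^sub>R x i)"

definition objective ::
  "nat \<Rightarrow> (nat \<Rightarrow> real^'d) \<Rightarrow> (nat \<Rightarrow> real) \<Rightarrow> real \<Rightarrow> real \<Rightarrow>
   (real^'d) \<times> (real^'d) \<times> (real^'d^'d) \<Rightarrow> real" where
  "objective n x y \<mu> lam = (\<lambda>(\<theta>, \<eta>, A).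
     1/2 * (norm (Z_vec n x y - \<eta>))\<^sup>2 + 1/2 * (norm (\<eta> - A *v \<theta>))\<^sup>2
     + \<mu>\<^sup>2 / 2 * (frob_norm (Sigma_hat n x - A))\<^sup>2 + lam / 2 * (norm \<theta>)\<^sup>2)"

definition is_theta_minimizer ::
  "nat \<Rightarrow> (nat \<Rightarrow> real^'d) \<Rightarrow> (nat \<Rightarrow> real) \<Rightarrow> real \<Rightarrow> real \<Rightarrow> real^'d \<Rightarrow> bool" where
  "is_theta_minimizer n x y \<mu> lam \<theta> \<longleftrightarrow>
     (\<exists>\<eta> A. \<forall>p. objective n x y \<mu> lam (\<theta>, \<eta>, A) \<le> objective n x y \<mu> lam p)"

definition k_star :: "nat \<Rightarrow> (nat \<Rightarrow> real) \<Rightarrow> real \<Rightarrow> nat" where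
  "k_star d eig lam = Max {k\<in>{1..d}. (eig k)\<^sup>2 \<ge> 2 * lam}"

definition bias_vec :: "real^'d^'d \<Rightarrow> real \<Rightarrow> real^'d \<Rightarrow> real^'d" where
  "bias_vec \<Sigma> lam \<theta>\<^sub>0 =
     - (lam *\<^sub>R (matrix_inv ((1/2) *\<^sub>R (\<Sigma> ** \<Sigma>) + mat lam) *v \<theta>\<^sub>0))"

definition Psi_term :: "real^'d^'d \<Rightarrow> real^'d \<Rightarrow> real \<Rightarrow> real \<Rightarrow> nat \<Rightarrow> real \<Rightarrow> real" where
  "Psi_term \<Sigma> \<theta>\<^sub>0 \<sigma> C n \<delta> =
     196 * (\<sigma> * sqrt (op_norm \<Sigma>) / norm \<theta>\<^sub>0 + 2 * C * op_norm \<Sigma>)\<^sup>2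
     * (((eff_rank \<Sigma>)\<^sup>2 + ln (4 / \<delta>)) / real n)"

definition remainder_term ::
  "real^'d^'d \<Rightarrow> real^'d \<Rightarrow> real \<Rightarrow> real \<Rightarrow> real \<Rightarrow> real \<Rightarrow> nat \<Rightarrow> real \<Rightarrow> real" where
  "remainder_term \<Sigma> \<theta>\<^sub>0 \<sigma> C \<mu> lam n \<delta> =
     (let b = bias_vec \<Sigma> lam \<theta>\<^sub>0; \<Psi> = Psi_term \<Sigma> \<theta>\<^sub>0 \<sigma> C n \<delta>
      in 210 * (norm \<theta>\<^sub>0 / \<mu> + op_norm \<Sigma> * norm b / (\<mu> * sqrt lam))
           * sqrt (op_norm \<Sigma>) * norm b
         + norm \<theta>\<^sub>0 / lam powr (1/4)
           * ((17 * norm \<theta>\<^sub>0 / \<mu>)\<^sup>2 + norm b / (160 * \<mu>)) * sqrt \<Psi>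
         + 19 * norm \<theta>\<^sub>0 / (sqrt 3 * lam powr (3/4)) * (1 + sqrt (\<Psi> / lam)) * \<Psi>)"

end

theory Submission
  imports Defs "HOL-Computational_Algebra.Polynomial"
begin

text \<open>
Put \<open>g = \<eta> - A \<theta>\<close> at a minimiser. Stationarity in \<open>\<eta>\<close> and \<open>A\<close> eliminates these two variables, and what is left
is the equation \<open>Sigma_hat (Z - Sigma_hat \<theta>) = 2 (1 + \<rho>) lam \<theta>\<close>
(\<open>minimizer_stationarity\<close>). The relative error \<open>\<rho>\<close> is random but at most \<open>(|\<theta>\<^sub>0| / \<mu>)\<^sup>2\<close>, by comparison of the
objective with its value at \<open>\<theta>\<^sub>0\<close> (\<open>effective_regularisation\<close>). Since \<open>Z = Sigma_hat \<theta>\<^sub>0 + \<xi>\<close> with the averaged noise \<open>\<xi>\<close>,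
the error \<open>\<Delta> = \<theta> - \<theta>\<^sub>0\<close> solves a linear equation with the operator \<open>Sigma_hat\<^sup>2 + 2 (1 + \<rho>) lam\<close>, while the bias \<open>b\<close> solves its
population version with \<open>\<Sigma>\<^sup>2 + 2 lam\<close>.

Let \<open>E = Sigma_hat - \<Sigma>\<close>, \<open>D = \<Delta> - b\<close> and \<open>R = (\<Sigma>\<^sup>2 + 2 lam)\<inverse>\<close>. Subtracting the two equations isolates the linear part
\<open>R (\<Sigma> (\<xi> - E b) - E \<Sigma> b)\<close> of \<open>D\<close>. All other terms are quadratic in the small quantities \<open>\<xi>\<close>, \<open>E\<close>, \<open>\<rho>\<close>, \<open>D\<close>, or are a
multiple \<open>\<rho>\<close> of the bias. They are absorbed by the remainder term, because \<open>D\<close> itself has a first-order bound that comes from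
the resolvent of \<open>Sigma_hat\<close>, for which the same estimates hold as for that of \<open>\<Sigma>\<close>
(\<open>sym_matrix_resolvent_bounds\<close>, \<open>perturbation_bound\<close>).

Randomness enters through five norms only: the three linear terms, \<open>|\<xi>|\<close>, and the Frobenius norm of \<open>E\<close>. In an eigenbasis
of \<open>\<Sigma>\<close> each of them is, up to a constant factor, the length of a vector with entries \<open>w i * \<nu> i\<close>, where the weights \<open>w i\<close> are at most 1 and
\<open>\<nu>\<close> is a whitened linear statistic whose Laplace transform satisfies \<open>E exp (u \<bullet> \<nu>) \<le> exp (\<tau>\<^sup>2 |u|\<^sup>2 / n)\<close> as long as
\<open>\<tau> |u| \<le> n\<close>. Both moment hypotheses of the theorem imply this, for the covariance error (\<open>whitened_error_mgf\<close>) and for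
the noise (\<open>whitened_noise_mgf\<close>). For such vectors the length exceeds
\<open>4 \<tau> sqrt (((\<Sum>i. (w i)\<^sup>2) + ln (2 / \<delta>)) / n)\<close> with probability at most \<open>\<delta>\<close> (\<open>diag_map_deviation\<close>). The proof
integrates the Laplace transform against a Gaussian vector truncated to the admissible region, and bounds the result from below by
shifting the Gaussian towards the observed vector.

The sums of squared weights are bounded by the effective dimensions of the statement: \<open>k + r\<^sub>4(k)\<close> for the weights \<open>l\<^sup>2 / (l\<^sup>2 + 2 lam)\<close>,
\<open>4 (k + r\<^sub>2(k))\<close> for \<open>2 sqrt (2 lam) l / (l\<^sup>2 + 2 lam)\<close>, the effective rank for \<open>|\<xi>|\<close>, and its square for the Frobenius norm of
\<open>E\<close> (\<open>sum_by_effective_rank\<close>, \<open>error_matrix_deviation\<close>).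
\<close>

section \<open>Vectors and matrices\<close>

text \<open>A differentiable function with a minimum at 0 has derivative 0 there; quadratics are all that the
variational arguments below need.\<close>

lemma linear_coeff_zero_of_nonneg_quadratic:
  fixes b c :: real
  assumes "\<And>t. 0 \<le> b * t + c * t\<^sup>2"
  shows "b = 0"
proof (rule ccontr)
  assume "b \<noteq> 0"
  define M where "M = \<bar>c\<bar> + 1"
  have M: "M > 0" "c < M" unfolding M_def by auto
  have "b * (- b / (2*M)) + c * (- b / (2*M))\<^sup>2 = b\<^sup>2 / (4*M\<^sup>2) * (c - 2*M)"
    using M by (simp add: power2_eq_square field_simps)
  also have "\<dots> < 0"
    using M \<open>b \<noteq> 0\<close> by (intro mult_pos_neg) auto
  finally show False using assms[of "- b / (2*M)"] by simp
qed

lemma inner_self_add: "(a + t *\<^sub>R h) \<bullet> (a + t *\<^sub>R h) = a \<bullet> a + 2 * t * (a \<bullet> h) + t\<^sup>2 * (h \<bullet> h)"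
  by (simp add: inner_add_left inner_add_right inner_commute[of h a] power2_eq_square algebra_simps)

lemma norm_vec_sq: "(norm (u :: real^'i))\<^sup>2 = (\<Sum>i\<in>UNIV. (u $ i)\<^sup>2)"
  by (simp add: norm_vec_def L2_set_def sum_nonneg)

lemma matrix_vector_mult_sum:
  fixes A :: "real^'n^'m"
  shows "A *v (\<Sum>i\<in>I. f i) = (\<Sum>i\<in>I. A *v f i)"
  by (rule linear_sum[OF matrix_vector_mul_linear])

lemma sum_matrix_vector_mult:
  fixes F :: "'i \<Rightarrow> real^'n^'m"
  shows "(\<Sum>i\<in>I. F i) *v x = (\<Sum>i\<in>I. F i *v x)"
  by (induction I rule: infinite_finite_induct) (simp_all add: matrix_vector_mult_add_rdistrib)

lemma matrix_vector_mult_minus_right: "(A :: real^'n^'m) *v (- x) = - (A *v x)"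
  by (rule linear_neg[OF matrix_vector_mul_linear])

lemma mat_mult_vec: "mat t *v x = t *\<^sub>R (x :: real^'n)"
  by (simp add: mat_def matrix_vector_mult_def vec_eq_iff if_distrib[of "\<lambda>x. x * _"] cong: if_cong)

lemma symmetric_inner_mult:
  fixes A :: "real^'n^'n"
  assumes "transpose A = A"
  shows "x \<bullet> (A *v y) = (A *v x) \<bullet> y"
  using dot_lmul_matrix[of x A y] assms by (metis transpose_matrix_vector)

lemma frob_norm_eq_norm: "frob_norm M = norm M"
  by (simp add: frob_norm_def norm_vec_def L2_set_def sum_nonneg)

lemma inner_mat_1: "M \<bullet> mat 1 = trace M"
  by (simp add: inner_vec_def mat_def trace_def if_distrib[of "\<lambda>x. _ * x"] cong: if_cong)

text \<open>The matrix of \<open>x \<mapsto> (v \<bullet> x) u\<close>: pairing with it in the Frobenius inner product reads off the bilinear form \<open>u \<bullet> M v\<close>.\<close>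

definition tensor :: "real^'n \<Rightarrow> real^'m \<Rightarrow> real^'m^'n" where
  "tensor u v = (\<chi> i j. u $ i * v $ j)"

lemma inner_tensor: "M \<bullet> tensor u v = u \<bullet> (M *v v)"
  by (simp add: inner_vec_def tensor_def matrix_vector_mult_def sum_distrib_left ac_simps)

lemma tensor_mult_vec: "tensor u v *v x = (v \<bullet> x) *\<^sub>R u"
  by (simp add: vec_eq_iff inner_vec_def tensor_def matrix_vector_mult_def sum_distrib_left sum_distrib_right ac_simps)

lemma norm_tensor: "norm (tensor u v) = norm u * norm v"
proof -
  have "tensor u v \<bullet> tensor u v = (norm u * norm v)\<^sup>2"
    by (simp only: inner_tensor tensor_mult_vec inner_scaleR_right power_mult_distrib power2_norm_eq_inner)
       (simp add: mult.commute)
  thus ?thesis by (metis norm_eq_sqrt_inner real_sqrt_unique mult_nonneg_nonneg norm_ge_zero)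
qed

text \<open>Frobenius norms dominate operator norms, and a bound with the Frobenius norm of the covariance error is
all that the second-order terms require.\<close>

lemma matrix_vector_norm_le: "norm (M *v x) \<le> norm (M :: real^'n^'m) * norm x"
proof -
  have "(norm (M *v x))\<^sup>2 = M \<bullet> tensor (M *v x) x" by (simp add: inner_tensor power2_norm_eq_inner)
  also have "\<dots> \<le> norm M * (norm (M *v x) * norm x)"
    using norm_cauchy_schwarz[of M "tensor (M *v x) x"] by (simp add: norm_tensor)
  finally have "norm (M *v x) * norm (M *v x) \<le> norm (M *v x) * (norm M * norm x)"
    by (simp add: power2_eq_square ac_simps)
  thus ?thesis by (cases "norm (M *v x) = 0") (auto simp: mult_le_cancel_left_pos)
qed

lemma outer_eq_tensor: "outer x = tensor x x"
  by (simp add: outer_def tensor_def)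

lemma outer_mult_vec: "outer x *v y = (x \<bullet> y) *\<^sub>R x"
  by (simp add: outer_eq_tensor tensor_mult_vec)

lemma inner_outer: "M \<bullet> outer x = x \<bullet> (M *v x)"
  by (simp add: outer_eq_tensor inner_tensor)

section \<open>Spectral decomposition of symmetric matrices\<close>

text \<open>All operators of the proof are functions of one symmetric matrix, up to the random error; they are handled through coordinates
in an orthonormal eigenbasis indexed by the same type as the coordinates themselves.\<close>

locale orthonormal_eigenbasis =
  fixes A :: "real^'n^'n" and e :: "'n \<Rightarrow> real^'n" and l :: "'n \<Rightarrow> real"
  assumes orthonormal: "e i \<bullet> e j = (if i = j then 1 else 0)"
    and eigen: "A *v e i = l i *\<^sub>R e i"

text \<open>A maximiser of the quadratic form on the unit sphere of \<open>V\<close> is an eigenvector.\<close>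

lemma exists_eigenvector_in_invariant_subspace:
  fixes A :: "real^'n^'n"
  assumes sym: "transpose A = A" and V: "subspace V" and inv: "\<And>x. x \<in> V \<Longrightarrow> A *v x \<in> V"
    and ne: "z \<in> V" "z \<noteq> 0"
  shows "\<exists>v l. v \<in> V \<and> norm v = 1 \<and> A *v v = l *\<^sub>R v"
proof -
  let ?S = "V \<inter> sphere 0 1"
  have "compact ?S"
    using closed_subspace[OF V] compact_sphere by blast
  moreover have "(1 / norm z) *\<^sub>R z \<in> ?S"
    using ne V by (auto simp: subspace_scale)
  moreover have "continuous_on ?S (\<lambda>x. x \<bullet> (A *v x))"
    by (intro continuous_intros linear_continuous_on) (auto simp: linear_conv_bounded_linear[symmetric])
  ultimately obtain v where v: "v \<in> ?S" and max: "\<And>y. y \<in> ?S \<Longrightarrow> y \<bullet> (A *v y) \<le> v \<bullet> (A *v v)"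
    using continuous_attains_sup[of ?S "\<lambda>x. x \<bullet> (A *v x)"] by blast
  define l where "l = v \<bullet> (A *v v)"
  have vV: "v \<in> V" and nv: "norm v = 1" using v by auto
  have Q: "y \<bullet> (A *v y) \<le> l * (y \<bullet> y)" if "y \<in> V" for y
  proof (cases "y = 0")
    case False
    have "(1 / norm y) *\<^sub>R y \<in> ?S" using that V False by (auto simp: subspace_scale)
    from max[OF this] have "(y \<bullet> (A *v y)) / (norm y)\<^sup>2 \<le> l"
      by (simp add: l_def matrix_vector_mult_scaleR power2_eq_square)
    thus ?thesis using False by (simp add: field_simps power2_norm_eq_inner)
  qed simp
  let ?w = "l *\<^sub>R v - A *v v"
  have wV: "?w \<in> V" using vV inv V by (simp add: subspace_diff subspace_scale)
  \<comment> \<open>\<open>?w\<close> is the gradient of \<open>l |y|\<^sup>2 - y \<bullet> A y \<ge> 0\<close> at its zero \<open>v\<close>.\<close>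
  have "2 * (?w \<bullet> ?w) = 0"
  proof (rule linear_coeff_zero_of_nonneg_quadratic)
    fix t :: real
    have "v + t *\<^sub>R ?w \<in> V" using vV wV V by (simp add: subspace_add subspace_scale)
    from Q[OF this] have "0 \<le> l * ((v + t *\<^sub>R ?w) \<bullet> (v + t *\<^sub>R ?w)) - (v + t *\<^sub>R ?w) \<bullet> (A *v (v + t *\<^sub>R ?w))"
      by simp
    also have "\<dots> = l * (v \<bullet> v) - v \<bullet> (A *v v) + t * (2 * (l * (v \<bullet> ?w)) - v \<bullet> (A *v ?w) - ?w \<bullet> (A *v v))
        + t\<^sup>2 * (l * (?w \<bullet> ?w) - ?w \<bullet> (A *v ?w))"
      by (simp only: matrix_vector_right_distrib matrix_vector_mult_scaleR inner_add_left inner_add_right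
          inner_scaleR_left inner_scaleR_right inner_commute[of ?w v])
         (simp add: algebra_simps power2_eq_square)
    also have "l * (v \<bullet> v) - v \<bullet> (A *v v) = 0"
      using nv by (simp add: l_def norm_eq_1)
    also have "v \<bullet> (A *v ?w) = ?w \<bullet> (A *v v)"
      using symmetric_inner_mult[OF sym, of v ?w] by (simp only: inner_commute)
    also have "2 * (l * (v \<bullet> ?w)) - ?w \<bullet> (A *v v) - ?w \<bullet> (A *v v) = 2 * (?w \<bullet> ?w)"
      by (simp add: inner_diff_left inner_diff_right inner_commute algebra_simps)
    finally show "0 \<le> 2 * (?w \<bullet> ?w) * t + (l * (?w \<bullet> ?w) - ?w \<bullet> (A *v ?w)) * t\<^sup>2"
      by (simp add: algebra_simps)
  qed
  hence "A *v v = l *\<^sub>R v" by simp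
  thus ?thesis using vV nv by blast
qed

text \<open>The spectral theorem: as long as fewer than \<open>n\<close> orthonormal eigenvectors have been found, their
orthogonal complement is a nonzero invariant subspace and contains a further one.\<close>

lemma symmetric_has_orthonormal_eigenbasis:
  fixes A :: "real^'n^'n"
  assumes sym: "transpose A = A"
  obtains e l where "orthonormal_eigenbasis A e l"
proof -
  define good where "good B \<longleftrightarrow> finite B \<and> pairwise orthogonal B \<and> (\<forall>b\<in>B. norm b = 1 \<and> (\<exists>l. A *v b = l *\<^sub>R b))"
    for B :: "(real^'n) set"
  have ex: "m \<le> CARD('n) \<Longrightarrow> \<exists>B. good B \<and> card B = m" for m
  proof (induction m)
    case 0
    show ?case by (rule exI[of _ "{}"]) (simp add: good_def)
  next
    case (Suc m)
    then obtain B where B: "good B" "card B = m" by auto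
    let ?V = "{x. \<forall>b\<in>B. b \<bullet> x = 0}"
    have "dim (span B) \<le> m" using B dim_le_card'[of B] by (simp add: good_def)
    hence "span B \<noteq> UNIV" using Suc.prems by (metis DIM_cart DIM_real Suc_n_not_le_n dim_UNIV le_trans mult.right_neutral)
    then obtain z where z: "z \<noteq> 0" "\<And>x. x \<in> span B \<Longrightarrow> z \<bullet> x = 0"
      using span_not_UNIV_orthogonal by blast
    have "\<exists>v l. v \<in> ?V \<and> norm v = 1 \<and> A *v v = l *\<^sub>R v"
    proof (rule exists_eigenvector_in_invariant_subspace[OF sym])
      show "subspace ?V" by (auto simp: subspace_def inner_right_distrib)
      show "z \<in> ?V" using z by (auto simp: span_base inner_commute)
      fix x assume "x \<in> ?V"
      thus "A *v x \<in> ?V"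
        using B by (fastforce simp: good_def symmetric_inner_mult[OF sym])
    qed (fact z)
    then obtain v l where v: "v \<in> ?V" "norm v = 1" "A *v v = l *\<^sub>R v" by blast
    have "v \<notin> B" using v by force
    hence "good (insert v B)" "card (insert v B) = Suc m"
      using B v by (auto simp: good_def pairwise_insert orthogonal_def inner_commute)
    thus ?case by blast
  qed
  from ex[of "CARD('n)"] obtain B where B: "good B" "card B = CARD('n)" by auto
  then obtain e :: "'n \<Rightarrow> real^'n" where e: "bij_betw e UNIV B"
    using finite_same_card_bij[of "UNIV::'n set" B] by (auto simp: good_def)
  have eB: "e i \<in> B" for i using e by (auto simp: bij_betw_def)
  have "e i \<bullet> e j = (if i = j then 1 else 0)" for i j
  proof (cases "i = j")
    case True thus ?thesis using B eB[of i] by (auto simp: good_def norm_eq_1)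
  next
    case False
    hence "e i \<noteq> e j" using e by (auto simp: bij_betw_def inj_on_def)
    thus ?thesis using B eB[of i] eB[of j] False by (auto simp: good_def pairwise_def orthogonal_def)
  qed
  moreover have "\<forall>i. \<exists>l. A *v e i = l *\<^sub>R e i" using B eB by (auto simp: good_def)
  then obtain l where "\<And>i. A *v e i = l i *\<^sub>R e i" by metis
  ultimately have "orthonormal_eigenbasis A e l" by unfold_locales
  thus ?thesis by (rule that)
qed

context orthonormal_eigenbasis
begin

lemma expand: "x = (\<Sum>i\<in>UNIV. (x \<bullet> e i) *\<^sub>R e i)"
proof -
  have inj: "inj e" by (rule injI) (metis orthonormal zero_neq_one)
  have po: "pairwise orthogonal (range e)"
    by (auto simp: pairwise_def orthogonal_def orthonormal)
  have ne: "e i \<noteq> 0" for i using orthonormal[of i i] by auto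
  hence "0 \<notin> range e" by (metis rangeE)
  hence ind: "independent (range e)" using pairwise_orthogonal_independent[OF po] by simp
  have "card (range e) = CARD('n)" using inj by (simp add: card_image)
  hence "span (range e) = UNIV"
    using card_ge_dim_independent[OF subset_UNIV ind] by auto
  hence "(\<Sum>b\<in>range e. (x \<bullet> b) *\<^sub>R b) = x"
    by (intro orthonormal_basis_expand po) (auto simp: norm_eq_1 orthonormal)
  thus ?thesis using inj by (simp add: sum.reindex)
qed

lemma inner_expand: "x \<bullet> y = (\<Sum>i\<in>UNIV. (x \<bullet> e i) * (y \<bullet> e i))"
  by (subst expand[of x]) (simp add: inner_sum_left inner_commute[of "e _" y])

lemma norm_expand: "(norm x)\<^sup>2 = (\<Sum>i\<in>UNIV. (x \<bullet> e i)\<^sup>2)"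
  unfolding power2_norm_eq_inner by (subst inner_expand) (simp add: power2_eq_square)

lemma norm_coords: "norm x = sqrt (\<Sum>i\<in>UNIV. (x \<bullet> e i)\<^sup>2)"
  using norm_expand[of x] by (metis norm_ge_zero real_sqrt_unique)

lemma norm_combination: "norm (\<Sum>i\<in>UNIV. a i *\<^sub>R e i) = sqrt (\<Sum>i\<in>UNIV. (a i)\<^sup>2)"
proof -
  have c: "(\<Sum>i\<in>UNIV. a i *\<^sub>R e i) \<bullet> e j = a j" for j
    by (simp add: inner_sum_left orthonormal if_distrib[of "\<lambda>x. _ * x"] cong: if_cong)
  have "(norm (\<Sum>i\<in>UNIV. a i *\<^sub>R e i))\<^sup>2 = (\<Sum>i\<in>UNIV. (a i)\<^sup>2)"
    unfolding norm_expand c ..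
  thus ?thesis by (metis norm_ge_zero real_sqrt_unique)
qed

lemma matrix_norm_sq: "(norm (M :: real^'n^'n))\<^sup>2 = (\<Sum>p\<in>UNIV. (e (fst p) \<bullet> (M *v e (snd p)))\<^sup>2)"
proof -
  have comp: "(M *v x) $ r = M $ r \<bullet> x" for x r
    by (simp add: matrix_vector_mult_def inner_vec_def)
  have "(norm M)\<^sup>2 = (\<Sum>r\<in>UNIV. (norm (M $ r))\<^sup>2)"
    unfolding power2_norm_eq_inner by (subst inner_vec_def) simp
  also have "\<dots> = (\<Sum>r\<in>UNIV. \<Sum>j\<in>UNIV. ((M *v e j) $ r)\<^sup>2)" unfolding norm_expand comp ..
  also have "\<dots> = (\<Sum>j\<in>UNIV. \<Sum>r\<in>UNIV. ((M *v e j) $ r)\<^sup>2)" by (rule sum.swap)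
  also have "\<dots> = (\<Sum>j\<in>UNIV. \<Sum>i\<in>UNIV. ((M *v e j) \<bullet> e i)\<^sup>2)"
    unfolding norm_vec_sq[symmetric] norm_expand ..
  also have "\<dots> = (\<Sum>i\<in>UNIV. \<Sum>j\<in>UNIV. (e i \<bullet> (M *v e j))\<^sup>2)"
    by (subst sum.swap) (simp only: inner_commute)
  also have "\<dots> = (\<Sum>p\<in>UNIV. (e (fst p) \<bullet> (M *v e (snd p)))\<^sup>2)"
    by (simp add: sum.cartesian_product case_prod_beta UNIV_Times_UNIV[symmetric] del: UNIV_Times_UNIV)
  finally show ?thesis .
qed

lemma matrix_eqI: "(\<And>i. B *v e i = C *v e i) \<Longrightarrow> B = C"
  unfolding matrix_eq
proof
  fix x assume "\<And>i. B *v e i = C *v e i"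
  hence "B *v (\<Sum>i\<in>UNIV. (x \<bullet> e i) *\<^sub>R e i) = C *v (\<Sum>i\<in>UNIV. (x \<bullet> e i) *\<^sub>R e i)"
    by (simp add: matrix_vector_mult_sum matrix_vector_mult_scaleR)
  thus "B *v x = C *v x" by (simp only: expand[symmetric])
qed

definition evecs :: "real^'n^'n" where "evecs = (\<chi> i j. e j $ i)"

lemma evecs_axis: "evecs *v axis i 1 = e i"
  by (simp add: evecs_def matrix_vector_mult_basis column_def vec_eq_iff)

lemma transpose_evecs_evecs: "transpose evecs ** evecs = mat 1"
  unfolding evecs_def by (simp add: vec_eq_iff matrix_matrix_mult_def transpose_def mat_def
      orthonormal[unfolded inner_vec_def inner_real_def])

lemma evecs_transpose_evecs: "evecs ** transpose evecs = mat 1"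
  using transpose_evecs_evecs matrix_left_right_inverse by blast

lemma diagonalise: "transpose evecs ** B ** evecs = (\<chi> i j. e i \<bullet> (B *v e j))"
proof -
  have "(transpose evecs ** B ** evecs) $ i $ j = e i \<bullet> (B *v e j)" for i j
  proof -
    have "(transpose evecs ** B ** evecs) $ i $ j = axis i 1 \<bullet> ((transpose evecs ** B ** evecs) *v axis j 1)"
      by (simp add: inner_axis' matrix_vector_mult_basis column_def)
    also have "\<dots> = axis i 1 \<bullet> (transpose evecs *v (B *v e j))"
      by (simp add: matrix_vector_mul_assoc[symmetric] evecs_axis)
    also have "\<dots> = e i \<bullet> (B *v e j)"
      by (metis dot_lmul_matrix evecs_axis transpose_matrix_vector transpose_transpose)
    finally show ?thesis .
  qed
  thus ?thesis by (simp add: vec_eq_iff)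
qed

lemma det_char: "det (mat t - A) = (\<Prod>i\<in>UNIV. t - l i)"
proof -
  have "det (mat t - A) = det (transpose evecs ** (mat t - A) ** evecs)"
  proof -
    have "det (transpose evecs) * det evecs = 1"
      by (metis det_I det_mul transpose_evecs_evecs)
    thus ?thesis by (simp add: det_mul mult.commute mult.assoc[symmetric])
  qed
  also have "\<dots> = det ((\<chi> i j. if i = j then t - l i else 0) :: real^'n^'n)"
    unfolding diagonalise
    by (rule arg_cong[of _ _ det])
       (auto simp: vec_eq_iff matrix_vector_mult_diff_rdistrib eigen inner_diff_right orthonormal
          mat_mult_vec)
  also have "\<dots> = (\<Prod>i\<in>UNIV. t - l i)" by (subst det_diagonal) auto
  finally show ?thesis .
qed

lemma trace_eigen: "trace A = (\<Sum>i\<in>UNIV. l i)"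
proof -
  have "trace A = trace ((evecs ** transpose evecs) ** A)" by (simp add: evecs_transpose_evecs)
  also have "\<dots> = trace (transpose evecs ** A ** evecs)"
    by (metis matrix_mul_assoc trace_mul_sym)
  also have "\<dots> = (\<Sum>i\<in>UNIV. l i)" unfolding diagonalise by (simp add: trace_def eigen orthonormal)
  finally show ?thesis .
qed

lemma op_norm_eigen:
  assumes "\<And>i. 0 \<le> l i"
  shows "op_norm A = Max (range l)"
proof (rule antisym)
  show "op_norm A \<le> Max (range l)"
  proof (rule onorm_le)
    fix x
    have sym: "(A *v x) \<bullet> e i = l i * (x \<bullet> e i)" for i
      by (subst expand[of x]) (simp add: matrix_vector_mult_sum matrix_vector_mult_scaleR eigen
          inner_sum_left orthonormal if_distrib[of "\<lambda>x. _ * x"] cong: if_cong)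
    have M: "0 \<le> Max (range l)" "l i \<le> Max (range l)" for i
      using assms by (auto simp: Max_ge_iff)
    have "(norm (A *v x))\<^sup>2 = (\<Sum>i\<in>UNIV. (l i)\<^sup>2 * (x \<bullet> e i)\<^sup>2)"
      by (subst norm_expand) (simp add: sym power_mult_distrib)
    also have "\<dots> \<le> (\<Sum>i\<in>UNIV. (Max (range l))\<^sup>2 * (x \<bullet> e i)\<^sup>2)"
      by (intro sum_mono mult_right_mono power_mono M assms) auto
    also have "\<dots> = (Max (range l) * norm x)\<^sup>2"
      by (simp add: sum_distrib_left[symmetric] norm_expand[symmetric] power_mult_distrib)
    finally show "norm (A *v x) \<le> Max (range l) * norm x"
      using M by (meson mult_nonneg_nonneg norm_ge_zero power2_le_imp_le)
  qed
  have "l i \<le> op_norm A" for i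
  proof -
    have "norm (e i) = 1" using orthonormal[of i i] by (simp add: norm_eq_1)
    thus "l i \<le> op_norm A"
      using onorm[OF matrix_vector_mul_bounded_linear[of A], of "e i"] by (simp add: eigen)
  qed
  thus "Max (range l) \<le> op_norm A" by (intro Max.boundedI) auto
qed

text \<open>This is the link between the eigenbasis and the ordered list of eigenvalues: only symmetric functions of the
eigenvalues occur, and these agree because the two characteristic polynomials do.\<close>

lemma sum_eigenvalues_desc:
  assumes "eigenvalues_desc A eig"
  shows "(\<Sum>i\<in>UNIV. f (l i)) = (\<Sum>j=1..CARD('n). f (eig j))"
proof -
  let ?p = "\<Prod>i\<in>UNIV. [:- l i, 1:]" and ?q = "\<Prod>j=1..CARD('n). [:- eig j, 1:]"
  have "poly ?p = poly ?q"
  proof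
    fix t
    have "(\<Prod>i\<in>UNIV. t - l i) = (\<Prod>j=1..CARD('n). t - eig j)"
      using assms unfolding eigenvalues_desc_def det_char by blast
    thus "poly ?p t = poly ?q t" by (simp add: poly_prod)
  qed
  hence pq: "?p = ?q" by (simp add: poly_eq_poly_eq_iff)
  \<comment> \<open>The two characteristic polynomials agree as functions, hence have the same multiset of roots.\<close>
  have roots: "proots (\<Prod>i\<in>I. [:- h i, 1:]) = image_mset h (mset_set I)"
    if "finite I" for I :: "'c set" and h :: "'c \<Rightarrow> real"
  proof -
    have "proots (\<Prod>i\<in>I. [:- h i, 1:]) = (\<Sum>i\<in>I. {#h i#})"
      by (subst proots_prod) auto
    also have "\<dots> = image_mset h (mset_set I)" using that by (induction rule: finite_induct) auto
    finally show ?thesis .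
  qed
  have "image_mset l (mset_set UNIV) = image_mset eig (mset_set {1..CARD('n)})"
    using roots[of UNIV l] roots[of "{1..CARD('n)}" eig] pq by (metis finite finite_atLeastAtMost)
  hence "image_mset f (image_mset l (mset_set UNIV)) = image_mset f (image_mset eig (mset_set {1..CARD('n)}))"
    by (rule arg_cong)
  thus ?thesis unfolding sum_unfold_sum_mset multiset.map_comp comp_def by (rule arg_cong)
qed

text \<open>A filter function that is at most \<open>\<kappa>\<close> everywhere and decays like a power below the threshold \<open>sqrt (2 lam)\<close> sums to an effective dimension: the
\<open>k\<close> eigenvalues above the threshold count fully, the others through their tail rank, because the first of them is below the threshold.\<close>

lemma sum_by_effective_rank:
  assumes ed: "eigenvalues_desc A eig" and pos: "\<And>i. 0 < l i" and lam: "0 < lam"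
    and ne: "{k\<in>{1..CARD('n)}. (eig k)\<^sup>2 \<ge> 2 * lam} \<noteq> {}" and k: "k = k_star CARD('n) eig lam"
    and g: "\<And>x. 0 < x \<Longrightarrow> g x \<le> \<kappa>" "\<And>x. 0 < x \<Longrightarrow> g x \<le> \<kappa> * (x\<^sup>2 / (2 * lam)) ^ h" and \<kappa>: "0 \<le> \<kappa>"
  shows "(\<Sum>i\<in>UNIV. g (l i)) \<le> \<kappa> * (real k + tail_rank CARD('n) eig (2 * real h) k)" "1 \<le> k"
proof -
  let ?d = "CARD('n)"
  let ?K = "{k\<in>{1..?d}. (eig k)\<^sup>2 \<ge> 2 * lam}"
  have kK: "k \<in> ?K" unfolding k k_star_def by (rule Max_in) (use ne in auto)
  have kmax: "j \<le> k" if "j \<in> ?K" for j unfolding k k_star_def by (rule Max_ge) (use that in auto)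
  show "1 \<le> k" using kK by simp
  have eigpos: "0 < eig j" if "j \<in> {1..?d}" for j
  proof -
    \<comment> \<open>Counting the nonpositive eigenvalues in both enumerations.\<close>
    let ?I = "\<lambda>x::real. if x \<le> 0 then 1 else 0 :: real"
    have "(\<Sum>j=1..?d. ?I (eig j)) = (\<Sum>i\<in>UNIV. ?I (l i))" by (rule sum_eigenvalues_desc[OF ed, symmetric])
    also have "\<dots> = 0" using pos by (intro sum.neutral) (auto simp: not_le)
    finally have "\<forall>j\<in>{1..?d}. ?I (eig j) = 0" by (subst (asm) sum_nonneg_eq_0_iff) auto
    from bspec[OF this that] show ?thesis by (simp split: if_splits)
  qed
  have dec: "eig j \<le> eig i" if "1 \<le> i" "i \<le> j" "j \<le> ?d" for i j
    using ed that unfolding eigenvalues_desc_def by blast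
  have split: "{1..?d} = {1..k} \<union> {k<..?d}" using kK by auto
  have "(\<Sum>i\<in>UNIV. g (l i)) = (\<Sum>j=1..?d. g (eig j))" by (rule sum_eigenvalues_desc[OF ed])
  also have "\<dots> = (\<Sum>j=1..k. g (eig j)) + (\<Sum>j\<in>{k<..?d}. g (eig j))"
    unfolding split by (rule sum.union_disjoint) auto
  also have "(\<Sum>j=1..k. g (eig j)) \<le> (\<Sum>j=1..k. \<kappa>)"
    using kK by (intro sum_mono g(1) eigpos) auto
  also have "(\<Sum>j=1..k. \<kappa>) = \<kappa> * real k" by simp
  also have "(\<Sum>j\<in>{k<..?d}. g (eig j)) \<le> (\<Sum>j\<in>{k<..?d}. \<kappa> * (eig j / eig (k + 1)) powr (2 * real h))"
  proof (rule sum_mono)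
    fix j assume j: "j \<in> {k<..?d}"
    have 1: "0 < eig j" "0 < eig (k + 1)" using j by (auto intro: eigpos)
    have "k + 1 \<notin> ?K" using kmax[of "k + 1"] by auto
    hence 2: "(eig (k + 1))\<^sup>2 < 2 * lam" using j by auto
    have "(eig j)\<^sup>2 / (2 * lam) \<le> (eig j)\<^sup>2 / (eig (k + 1))\<^sup>2"
      using 1 2 lam by (intro divide_left_mono) auto
    also have "\<dots> = (eig j / eig (k + 1))\<^sup>2" by (simp add: power_divide)
    finally have "((eig j)\<^sup>2 / (2 * lam)) ^ h \<le> ((eig j / eig (k + 1))\<^sup>2) ^ h"
      using lam by (intro power_mono) auto
    also have "\<dots> = (eig j / eig (k + 1)) powr (2 * real h)"
      using 1 powr_realpow[of "eig j / eig (k + 1)" "2 * h"] by (simp add: power_mult)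
    finally have "\<kappa> * ((eig j)\<^sup>2 / (2 * lam)) ^ h \<le> \<kappa> * (eig j / eig (k + 1)) powr (2 * real h)"
      using \<kappa> by (rule mult_left_mono)
    with g(2)[OF 1(1)] show "g (eig j) \<le> \<kappa> * (eig j / eig (k + 1)) powr (2 * real h)" by linarith
  qed
  finally have "(\<Sum>i\<in>UNIV. g (l i)) \<le> \<kappa> * real k + (\<Sum>j\<in>{k<..?d}. \<kappa> * (eig j / eig (k + 1)) powr (2 * real h))"
    by simp
  thus "(\<Sum>i\<in>UNIV. g (l i)) \<le> \<kappa> * (real k + tail_rank ?d eig (2 * real h) k)"
    unfolding tail_rank_def sum_distrib_left distrib_left .
qed

lemma large_eigenvalue:
  assumes ed: "eigenvalues_desc A eig" and pos: "\<And>i. 0 < l i" and lam: "0 < lam"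
    and ne: "{k\<in>{1..CARD('n)}. (eig k)\<^sup>2 \<ge> 2 * lam} \<noteq> {}"
  shows "2 * lam \<le> (op_norm A)\<^sup>2"
proof (rule ccontr)
  assume *: "\<not> 2 * lam \<le> (op_norm A)\<^sup>2"
  let ?I = "\<lambda>x::real. if 2 * lam \<le> x\<^sup>2 then 1 else 0 :: real"
  have L: "op_norm A = Max (range l)" by (rule op_norm_eigen) (rule less_imp_le[OF pos])
  have "(l i)\<^sup>2 \<le> (op_norm A)\<^sup>2" for i unfolding L using pos[of i] by (intro power_mono) auto
  hence "(\<Sum>i\<in>UNIV. ?I (l i)) = 0" using * by (intro sum.neutral) (auto simp: not_le intro: order_le_less_trans)
  hence "(\<Sum>j=1..CARD('n). ?I (eig j)) = 0" using sum_eigenvalues_desc[OF ed, of ?I] by simp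
  hence "\<forall>j\<in>{1..CARD('n)}. ?I (eig j) = 0" by (subst (asm) sum_nonneg_eq_0_iff) auto
  moreover obtain j where "j \<in> {1..CARD('n)}" "2 * lam \<le> (eig j)\<^sup>2" using ne by auto
  ultimately show False by (metis zero_neq_one)
qed

text \<open>Existence and uniqueness of the positive semidefinite square root, without which
\<^const>\<open>mat_sqrt\<close> would be an unspecified matrix.\<close>

lemma mat_sqrt_eigen:
  assumes "\<And>i. 0 \<le> l i"
  shows "psd (mat_sqrt A)" "mat_sqrt A ** mat_sqrt A = A" "mat_sqrt A *v e i = sqrt (l i) *\<^sub>R e i"
proof -
  define S where "S = evecs ** (\<chi> i j. if i = j then sqrt (l i) else 0) ** transpose evecs"
  have tax: "transpose evecs *v e i = axis i 1" for i
    by (metis evecs_axis matrix_vector_mul_assoc matrix_vector_mul_lid transpose_evecs_evecs)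
  have dax: "((\<chi> i j. if i = j then sqrt (l i) else 0) :: real^'n^'n) *v axis i 1 = sqrt (l i) *\<^sub>R axis i 1" for i
    by (auto simp: matrix_vector_mult_basis column_def vec_eq_iff) (auto simp: axis_def)
  have Se: "S *v e i = sqrt (l i) *\<^sub>R e i" for i
    unfolding S_def by (simp only: matrix_vector_mul_assoc[symmetric] tax dax matrix_vector_mult_scaleR evecs_axis)
  have Ssym: "transpose S = S"
    unfolding S_def by (simp add: matrix_transpose_mul matrix_mul_assoc)
      (rule arg_cong[where f="\<lambda>x. evecs ** x ** transpose evecs"], auto simp: vec_eq_iff transpose_def)
  have Sx: "(S *v x) \<bullet> e i = sqrt (l i) * (x \<bullet> e i)" for x i
    using symmetric_inner_mult[OF Ssym, of x "e i"] by (simp add: Se)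
  have S2: "S ** S = A"
  proof (rule matrix_eqI)
    fix i
    have "sqrt (l i) * sqrt (l i) = l i" using assms[of i] by simp
    thus "(S ** S) *v e i = A *v e i"
      by (simp only: matrix_vector_mul_assoc[symmetric] Se matrix_vector_mult_scaleR eigen scaleR_scaleR)
  qed
  have Spsd: "psd S"
    unfolding psd_def
  proof (intro conjI allI Ssym)
    fix x
    have "x \<bullet> (S *v x) = (\<Sum>i\<in>UNIV. sqrt (l i) * (x \<bullet> e i)\<^sup>2)"
      by (subst inner_expand) (simp add: Sx power2_eq_square mult.left_commute)
    also have "\<dots> \<ge> 0" by (intro sum_nonneg mult_nonneg_nonneg) (auto simp: assms)
    finally show "0 \<le> x \<bullet> (S *v x)" .
  qed
  \<comment> \<open>On an eigenvector, \<open>y = B e - sqrt l e\<close> satisfies \<open>B y = - sqrt l y\<close>, which contradicts positivity unless \<open>y = 0\<close>.\<close>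
  have uniq: "B = S" if "psd B \<and> B ** B = A" for B
  proof (rule matrix_eqI)
    fix i
    have symB: "transpose B = B" and pB: "\<And>x. 0 \<le> x \<bullet> (B *v x)" using that by (auto simp: psd_def)
    have BB: "B *v (B *v e i) = l i *\<^sub>R e i" using that by (simp add: matrix_vector_mul_assoc eigen)
    show "B *v e i = S *v e i"
    proof (cases "l i = 0")
      case True
      have "(B *v e i) \<bullet> (B *v e i) = 0"
        using symmetric_inner_mult[OF symB, of "e i" "B *v e i"] BB True by simp
      thus ?thesis by (simp add: Se True)
    next
      case False
      hence pos: "0 < sqrt (l i)" using assms[of i] by simp
      let ?y = "B *v e i - sqrt (l i) *\<^sub>R e i"
      have "B *v ?y = - sqrt (l i) *\<^sub>R ?y"
        by (simp add: matrix_vector_mult_diff_distrib BB matrix_vector_mult_scaleR scaleR_diff_right abs_of_nonneg[OF assms])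
      hence "0 \<le> - (sqrt (l i) * (?y \<bullet> ?y))" using pB[of ?y] by simp
      hence "?y \<bullet> ?y \<le> 0" using pos by (simp add: mult_le_0_iff)
      hence "(norm ?y)\<^sup>2 \<le> 0" by (simp only: power2_norm_eq_inner)
      hence "?y = 0" by simp
      thus ?thesis by (simp add: Se)
    qed
  qed
  have S: "mat_sqrt A = S" unfolding mat_sqrt_def
    by (rule the_equality, rule conjI[OF Spsd S2], rule uniq)
  show "psd (mat_sqrt A)" "mat_sqrt A ** mat_sqrt A = A" "mat_sqrt A *v e i = sqrt (l i) *\<^sub>R e i"
    unfolding S by (rule Spsd, rule S2, rule Se)
qed

end

section \<open>Resolvents of squared symmetric matrices\<close>

text \<open>Bounds for the resolvent \<open>(T\<^sup>2 + c\<^sup>2)\<inverse>\<close> and its products with \<open>T\<close>, uniform in \<open>T\<close>. They follow from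
\<open>|T\<^sup>2 y + c\<^sup>2 y|\<^sup>2 = |T\<^sup>2 y|\<^sup>2 + 2 c\<^sup>2 |T y|\<^sup>2 + c\<^sup>4 |y|\<^sup>2\<close>; they hold for every symmetric \<open>T\<close>, hence
equally for a population and to an empirical second moment matrix.\<close>

lemma sym_matrix_resolvent_bounds:
  fixes T :: "real^'n^'n"
  assumes sym: "transpose T = T" and c: "0 < c" and eq: "T *v (T *v y) + c\<^sup>2 *\<^sub>R y = z"
  shows "norm y \<le> norm z / c\<^sup>2" "norm (T *v y) \<le> norm z / (2 * c)" "norm (T *v (T *v y)) \<le> norm z"
proof -
  let ?p = "norm (T *v (T *v y))" and ?q = "c\<^sup>2 * norm y" and ?r = "norm (T *v y)"
  have TT: "(T *v (T *v y)) \<bullet> y = ?r\<^sup>2"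
    using symmetric_inner_mult[OF sym, of y "T *v y"] by (simp add: power2_norm_eq_inner inner_commute)
  have z2: "(norm z)\<^sup>2 = ?p\<^sup>2 + 2 * c\<^sup>2 * ?r\<^sup>2 + ?q\<^sup>2"
  proof -
    have "(norm z)\<^sup>2 = (T *v (T *v y) + c\<^sup>2 *\<^sub>R y) \<bullet> (T *v (T *v y) + c\<^sup>2 *\<^sub>R y)"
      by (simp only: eq power2_norm_eq_inner)
    also have "\<dots> = ?p\<^sup>2 + 2 * c\<^sup>2 * ?r\<^sup>2 + ?q\<^sup>2"
      unfolding inner_self_add TT power_mult_distrib by (simp only: power2_norm_eq_inner)
    finally show ?thesis .
  qed
  have "?r\<^sup>2 \<le> ?p * norm y" unfolding TT[symmetric] by (rule norm_cauchy_schwarz)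
  hence "c\<^sup>2 * ?r\<^sup>2 \<le> c\<^sup>2 * (?p * norm y)" by (intro mult_left_mono) auto
  hence r: "c\<^sup>2 * ?r\<^sup>2 \<le> ?p * ?q" by (simp add: ac_simps)
  have "2 * (?p * ?q) \<le> ?p\<^sup>2 + ?q\<^sup>2" using sum_squares_bound[of ?p ?q] by simp
  with r z2 have "(2 * c * ?r)\<^sup>2 \<le> (norm z)\<^sup>2" by (simp add: power_mult_distrib)
  hence "2 * c * ?r \<le> norm z" by (rule power2_le_imp_le) simp
  thus "norm (T *v y) \<le> norm z / (2 * c)" using c by (simp add: field_simps)
  have "?q\<^sup>2 \<le> (norm z)\<^sup>2" unfolding z2 by (simp add: add_nonneg_nonneg)
  hence "?q \<le> norm z" by (rule power2_le_imp_le) simp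
  thus "norm y \<le> norm z / c\<^sup>2" using c by (simp add: field_simps)
  have "?p\<^sup>2 \<le> (norm z)\<^sup>2" unfolding z2 by (simp add: add_nonneg_nonneg)
  thus "?p \<le> norm z" by (rule power2_le_imp_le) simp
qed

lemma sym_matrix_resolvent_exists:
  fixes T :: "real^'n^'n"
  assumes sym: "transpose T = T" and c: "0 < c"
  obtains R where "\<And>z. T *v (T *v (R *v z)) + c\<^sup>2 *\<^sub>R (R *v z) = z" "\<And>z. R *v (T *v z) = T *v (R *v z)"
    "R = matrix_inv (T ** T + mat (c\<^sup>2))"
proof -
  let ?G = "T ** T + mat (c\<^sup>2)"
  have G: "?G *v y = T *v (T *v y) + c\<^sup>2 *\<^sub>R y" for y
    by (simp add: matrix_vector_mult_add_rdistrib matrix_vector_mul_assoc mat_mult_vec)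
  have "?G *v y = 0 \<longrightarrow> y = 0" for y
    using sym_matrix_resolvent_bounds(1)[OF sym c, of y 0] by (simp add: G)
  hence inv: "invertible ?G"
    by (simp add: invertible_left_inverse matrix_left_invertible_ker)
  define R where "R = matrix_inv ?G"
  have GR: "?G ** R = mat 1" and RG: "R ** ?G = mat 1"
    using someI_ex[OF inv[unfolded invertible_def]] by (simp_all add: R_def matrix_inv_def)
  have e: "T *v (T *v (R *v z)) + c\<^sup>2 *\<^sub>R (R *v z) = z" for z
    using GR G[of "R *v z"] by (simp add: matrix_vector_mul_assoc)
  have "R *v (T *v z) = T *v (R *v z)" for z
  proof -
    have "?G *v (T *v (R *v z)) = T *v z"
      unfolding G using e[of z] by (metis matrix_vector_right_distrib matrix_vector_mult_scaleR)
    hence "R *v (T *v z) = R *v (?G *v (T *v (R *v z)))" by simp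
    also have "\<dots> = T *v (R *v z)" unfolding matrix_vector_mul_assoc[of R ?G] RG by simp
    finally show ?thesis .
  qed
  thus ?thesis by (rule that[OF e _ R_def])
qed

text \<open>\<open>|S y|\<^sup>2 = y \<bullet> A y\<close>: half powers are estimated without functional calculus.\<close>

lemma psd_sqrt_norm_le:
  fixes S A :: "real^'n^'n"
  assumes "transpose S = S" "S ** S = A"
  shows "(norm (S *v y))\<^sup>2 \<le> norm y * norm (A *v y)"
proof -
  have "(norm (S *v y))\<^sup>2 = y \<bullet> (A *v y)"
    unfolding power2_norm_eq_inner assms(2)[symmetric] matrix_vector_mul_assoc[symmetric]
    using symmetric_inner_mult[OF assms(1), of y "S *v y"] by simp
  thus ?thesis by (simp add: norm_cauchy_schwarz)
qed

text \<open>Doubling the equation that defines the bias gives it the shape \<open>T\<^sup>2 y + c\<^sup>2 y\<close> of the resolvent bounds, with \<open>c\<^sup>2 = 2 lam\<close>.\<close>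

lemma bias_vec_equation:
  fixes \<Sigma> :: "real^'d^'d"
  assumes sym: "transpose \<Sigma> = \<Sigma>" and lam: "0 < lam"
  shows "\<Sigma> *v (\<Sigma> *v bias_vec \<Sigma> lam \<theta>\<^sub>0) + (2 * lam) *\<^sub>R bias_vec \<Sigma> lam \<theta>\<^sub>0 = - ((2 * lam) *\<^sub>R \<theta>\<^sub>0)"
proof -
  define cc where "cc = sqrt (2 * lam)"
  define b where "b = bias_vec \<Sigma> lam \<theta>\<^sub>0"
  have cc: "0 < cc" "cc\<^sup>2 = 2 * lam" using lam by (auto simp: cc_def)
  let ?G = "(1/2) *\<^sub>R (\<Sigma> ** \<Sigma>) + mat lam"
  have G: "2 *\<^sub>R (?G *v y) = \<Sigma> *v (\<Sigma> *v y) + (2 * lam) *\<^sub>R y" for y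
    by (simp add: matrix_vector_mult_add_rdistrib scaleR_matrix_vector_assoc[symmetric] matrix_vector_mul_assoc mat_mult_vec scaleR_right_distrib)
  have "?G *v y = 0 \<Longrightarrow> y = 0" for y
    using sym_matrix_resolvent_bounds(1)[OF sym cc(1), of y 0] G[of y] by (simp add: cc(2))
  hence inv_G: "invertible ?G"
    by (simp add: invertible_left_inverse matrix_left_invertible_ker)
  have "?G ** matrix_inv ?G = mat 1" unfolding matrix_inv_def
    using someI_ex[OF inv_G[unfolded invertible_def]] by blast
  hence "?G *v (matrix_inv ?G *v \<theta>\<^sub>0) = \<theta>\<^sub>0" by (simp only: matrix_vector_mul_assoc matrix_vector_mul_lid)
  hence "?G *v b = - (lam *\<^sub>R \<theta>\<^sub>0)"
    unfolding b_def bias_vec_def by (simp only: matrix_vector_mult_minus_right matrix_vector_mult_scaleR)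
  thus ?thesis unfolding G[symmetric] b_def by simp
qed

section \<open>Minimisers of the empirical objective\<close>

lemma Sigma_hat_symmetric: "transpose (Sigma_hat n x) = Sigma_hat n x"
  by (simp add: Sigma_hat_def transpose_def vec_eq_iff outer_def sum_component mult.commute)

text \<open>Stationarity in \<open>\<eta>\<close> and \<open>A\<close> expresses both through \<open>\<theta>\<close> and the single residual \<open>g = \<eta> - A \<theta> = Z - \<eta>\<close>: the matrix is the
rank-one correction \<open>A = Sigma_hat + g \<theta>\<^sup>T / \<mu>\<^sup>2\<close>. Stationarity in \<open>\<theta>\<close> then gives
\<open>Sigma_hat (Z - Sigma_hat \<theta>) \<propto> \<theta>\<close> with a data-dependent factor. The comparison inequality is minimality against
\<open>(\<theta>', Sigma_hat \<theta>' + r / 2, Sigma_hat)\<close> with \<open>r = Z - Sigma_hat \<theta>'\<close>.\<close>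

lemma minimizer_stationarity:
  fixes \<theta> :: "real^'d"
  assumes min: "is_theta_minimizer n x y \<mu> lam \<theta>" and \<mu>: "0 < \<mu>"
  obtains g where
    "Z_vec n x y - Sigma_hat n x *v \<theta> = (2 + (norm \<theta>)\<^sup>2 / \<mu>\<^sup>2) *\<^sub>R g"
    "Sigma_hat n x *v g = (lam - (norm g)\<^sup>2 / \<mu>\<^sup>2) *\<^sub>R \<theta>"
    "\<And>\<theta>'. (norm g)\<^sup>2 + lam / 2 * (norm \<theta>)\<^sup>2 \<le> (norm (Z_vec n x y - Sigma_hat n x *v \<theta>'))\<^sup>2 / 4 + lam / 2 * (norm \<theta>')\<^sup>2"
proof -
  let ?Z = "Z_vec n x y" and ?S = "Sigma_hat n x"
  obtain \<eta> A where m: "\<And>p. objective n x y \<mu> lam (\<theta>, \<eta>, A) \<le> objective n x y \<mu> lam p"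
    using min by (auto simp: is_theta_minimizer_def)
  define g where "g = \<eta> - A *v \<theta>"
  have obj: "objective n x y \<mu> lam (t, h, B) = 1/2 * ((?Z - h) \<bullet> (?Z - h)) + 1/2 * ((h - B *v t) \<bullet> (h - B *v t))
     + \<mu>\<^sup>2 / 2 * ((?S - B) \<bullet> (?S - B)) + lam / 2 * (t \<bullet> t)" for t h B
    by (simp add: objective_def frob_norm_eq_norm power2_norm_eq_inner)
  have eta: "?Z - \<eta> = g"
  proof -
    let ?h = "g - (?Z - \<eta>)"
    have "?h \<bullet> ?h = 0"
    proof (rule linear_coeff_zero_of_nonneg_quadratic)
      fix t
      have e1: "?Z - (\<eta> + t *\<^sub>R ?h) = (?Z - \<eta>) + (- t) *\<^sub>R ?h"
        and e2: "\<eta> + t *\<^sub>R ?h - A *v \<theta> = g + t *\<^sub>R ?h" by (simp_all add: g_def algebra_simps)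
      have "?h \<bullet> ?h = g \<bullet> ?h - (?Z - \<eta>) \<bullet> ?h" by (rule inner_diff_left)
      thus "0 \<le> (?h \<bullet> ?h) * t + (?h \<bullet> ?h) * t\<^sup>2"
        using m[of "(\<theta>, \<eta> + t *\<^sub>R ?h, A)"] unfolding obj e1 e2 inner_self_add g_def[symmetric]
        by (simp add: algebra_simps)
    qed
    thus ?thesis by simp
  qed
  have th: "transpose A *v g = lam *\<^sub>R \<theta>"
  proof -
    define w where "w = transpose A *v g - lam *\<^sub>R \<theta>"
    have tr: "g \<bullet> (A *v v) = (transpose A *v g) \<bullet> v" for v
      by (metis dot_lmul_matrix transpose_matrix_vector transpose_transpose)
    have "- (w \<bullet> w) = 0"
    proof (rule linear_coeff_zero_of_nonneg_quadratic)
      fix t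
      have e: "\<eta> - A *v (\<theta> + t *\<^sub>R w) = g + (- t) *\<^sub>R (A *v w)"
        by (simp add: g_def matrix_vector_right_distrib matrix_vector_mult_scaleR algebra_simps)
      have gw: "g \<bullet> (A *v w) = w \<bullet> w + lam * (\<theta> \<bullet> w)"
        unfolding tr by (subst (2) w_def) (simp add: inner_diff_left)
      show "0 \<le> - (w \<bullet> w) * t + (1/2 * ((A *v w) \<bullet> (A *v w)) + lam/2 * (w \<bullet> w)) * t\<^sup>2"
        using m[of "(\<theta> + t *\<^sub>R w, \<eta>, A)"] unfolding obj e inner_self_add g_def[symmetric] inner_scaleR_right gw inner_minus_right
        by (simp add: algebra_simps)
    qed
    thus ?thesis by (simp add: w_def)
  qed
  have A: "A = ?S + (1 / \<mu>\<^sup>2) *\<^sub>R tensor g \<theta>"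
  proof -
    define W where "W = tensor g \<theta> - \<mu>\<^sup>2 *\<^sub>R (A - ?S)"
    have "- (W \<bullet> W) = 0"
    proof (rule linear_coeff_zero_of_nonneg_quadratic)
      fix t
      have e1: "\<eta> - (A + t *\<^sub>R W) *v \<theta> = g + (- t) *\<^sub>R (W *v \<theta>)"
        and e2: "?S - (A + t *\<^sub>R W) = (?S - A) + (- t) *\<^sub>R W"
        by (simp_all add: g_def matrix_vector_mult_add_rdistrib scaleR_matrix_vector_assoc[symmetric] algebra_simps)
      have gw: "g \<bullet> (W *v \<theta>) = W \<bullet> W - \<mu>\<^sup>2 * ((?S - A) \<bullet> W)"
      proof -
        have "W \<bullet> W = W \<bullet> (tensor g \<theta> - \<mu>\<^sup>2 *\<^sub>R (A - ?S))" by (simp only: W_def[symmetric])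
        also have "\<dots> = g \<bullet> (W *v \<theta>) + \<mu>\<^sup>2 * ((?S - A) \<bullet> W)"
          unfolding inner_diff_right inner_tensor
          by (simp add: inner_diff_right inner_diff_left inner_commute[of W] algebra_simps)
        finally show ?thesis by simp
      qed
      show "0 \<le> - (W \<bullet> W) * t + (1/2 * ((W *v \<theta>) \<bullet> (W *v \<theta>)) + \<mu>\<^sup>2/2 * (W \<bullet> W)) * t\<^sup>2"
        using m[of "(\<theta>, \<eta>, A + t *\<^sub>R W)"] unfolding obj e1 e2 inner_self_add g_def[symmetric] inner_scaleR_right gw
        by (simp add: algebra_simps)
    qed
    hence "tensor g \<theta> = \<mu>\<^sup>2 *\<^sub>R (A - ?S)" by (simp add: W_def)
    thus ?thesis using \<mu> by simp
  qed
  have AT: "A *v v = ?S *v v + ((\<theta> \<bullet> v) / \<mu>\<^sup>2) *\<^sub>R g" for v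
    by (simp add: A matrix_vector_mult_add_rdistrib scaleR_matrix_vector_assoc[symmetric] tensor_mult_vec)
  have At: "transpose A *v g = ?S *v g + ((norm g)\<^sup>2 / \<mu>\<^sup>2) *\<^sub>R \<theta>"
  proof -
    have "?S $ j $ i = ?S $ i $ j" for i j
      by (simp add: Sigma_hat_def outer_def sum_component mult.commute)
    hence "transpose A = ?S + (1 / \<mu>\<^sup>2) *\<^sub>R tensor \<theta> g"
      unfolding A by (simp add: transpose_def vec_eq_iff tensor_def)
    thus ?thesis
      by (simp add: matrix_vector_mult_add_rdistrib scaleR_matrix_vector_assoc[symmetric] tensor_mult_vec power2_norm_eq_inner)
  qed
  show ?thesis
  proof (rule that)
    have "?Z = g + \<eta>" using eta by (metis diff_add_cancel)
    moreover have "\<eta> = g + A *v \<theta>" by (simp add: g_def)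
    ultimately have "?Z = ?S *v \<theta> + ((2::real) *\<^sub>R g + ((\<theta> \<bullet> \<theta>) / \<mu>\<^sup>2) *\<^sub>R g)"
      unfolding AT[of \<theta>] scaleR_2 by (simp only: ac_simps)
    thus "?Z - ?S *v \<theta> = (2 + (norm \<theta>)\<^sup>2 / \<mu>\<^sup>2) *\<^sub>R g"
      unfolding power2_norm_eq_inner scaleR_left_distrib by (metis add_diff_cancel_left')
    have "?S *v g + ((norm g)\<^sup>2 / \<mu>\<^sup>2) *\<^sub>R \<theta> = lam *\<^sub>R \<theta>" using th At by (rule trans[OF sym, rotated])
    thus "?S *v g = (lam - (norm g)\<^sup>2 / \<mu>\<^sup>2) *\<^sub>R \<theta>"
      unfolding scaleR_left_diff_distrib by (metis add_diff_cancel_right')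
    fix \<theta>'
    let ?r = "?Z - ?S *v \<theta>'"
    have z: "?Z - (?S *v \<theta>' + (1/2) *\<^sub>R ?r) = (1/2) *\<^sub>R ?r"
    proof -
      have "?Z - (?S *v \<theta>' + (1/2) *\<^sub>R ?r) = 1 *\<^sub>R ?r - (1/2) *\<^sub>R ?r" by (simp only: diff_diff_eq scaleR_one)
      thus ?thesis by (simp only: scaleR_left_diff_distrib[symmetric]) simp
    qed
    have "(norm g)\<^sup>2 + lam / 2 * (norm \<theta>)\<^sup>2 \<le> objective n x y \<mu> lam (\<theta>, \<eta>, A)"
      by (simp add: objective_def eta g_def[symmetric])
    also have "\<dots> \<le> objective n x y \<mu> lam (\<theta>', ?S *v \<theta>' + (1/2) *\<^sub>R ?r, ?S)" by (rule m)
    also have "\<dots> = (norm ?r)\<^sup>2 / 4 + lam / 2 * (norm \<theta>')\<^sup>2"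
      unfolding objective_def prod.case z by (simp add: frob_norm_def power_mult_distrib power2_eq_square)
    finally show "(norm g)\<^sup>2 + lam / 2 * (norm \<theta>)\<^sup>2 \<le> (norm ?r)\<^sup>2 / 4 + lam / 2 * (norm \<theta>')\<^sup>2" .
  qed
qed

text \<open>The data-dependent factor differs from \<open>2 lam\<close> by a relative error \<open>\<rho>\<close> of the order of the squared signal-to-\<open>\<mu>\<close> ratio, since minimality bounds
both \<open>|\<theta>|\<^sup>2\<close> and \<open>|g|\<^sup>2 / lam\<close> by a multiple of \<open>|\<theta>\<^sub>0|\<^sup>2\<close>.\<close>

lemma effective_regularisation:
  fixes lam \<mu> N t g v :: real
  assumes pos: "0 < lam" "0 < \<mu>" "0 \<le> g" "0 \<le> t" and N: "N \<le> \<mu> / 420" "0 \<le> N"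
    and v: "0 \<le> v" "v \<le> 4 / 5 * (N * sqrt lam)"
    and le: "g\<^sup>2 + lam / 2 * t\<^sup>2 \<le> v\<^sup>2 / 4 + lam / 2 * N\<^sup>2"
  obtains \<rho> where "(2 + t\<^sup>2 / \<mu>\<^sup>2) * (lam - g\<^sup>2 / \<mu>\<^sup>2) = (1 + \<rho>) * (2 * lam)" "\<bar>\<rho>\<bar> \<le> (N / \<mu>)\<^sup>2" "(N / \<mu>)\<^sup>2 \<le> 1 / 100"
proof -
  define x where "x = (N / \<mu>)\<^sup>2"
  define p where "p = t\<^sup>2 / \<mu>\<^sup>2"
  define r where "r = g\<^sup>2 / \<mu>\<^sup>2 / lam"
  define \<rho> where "\<rho> = (2 + p) * (1 - r) / 2 - 1"
  have v2: "v\<^sup>2 \<le> 16 / 25 * (lam * N\<^sup>2)"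
  proof -
    have "v\<^sup>2 \<le> (4 / 5 * (N * sqrt lam))\<^sup>2" using v by (intro power_mono)
    thus ?thesis using pos by (simp add: power_mult_distrib power2_eq_square[of 5] power_divide ac_simps)
  qed
  have t2: "t\<^sup>2 \<le> 33 / 25 * N\<^sup>2"
  proof -
    have "lam * t\<^sup>2 \<le> 33 / 25 * (lam * N\<^sup>2)"
      using le v2 zero_le_power2[of g] unfolding times_divide_eq_left by linarith
    hence "lam * t\<^sup>2 \<le> lam * (33 / 25 * N\<^sup>2)" by simp
    thus ?thesis using pos by simp
  qed
  have g2: "g\<^sup>2 \<le> 33 / 50 * (lam * N\<^sup>2)"
    using le v2 mult_nonneg_nonneg[OF less_imp_le[OF pos(1)] zero_le_power2[of t]] by simp
  have p: "0 \<le> p" "p \<le> 33 / 25 * x"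
    using divide_right_mono[OF t2, of "\<mu>\<^sup>2"] by (auto simp: p_def x_def power_divide)
  have r: "0 \<le> r" "r \<le> 33 / 50 * x"
  proof -
    have "g\<^sup>2 / \<mu>\<^sup>2 / lam \<le> 33 / 50 * (lam * N\<^sup>2) / \<mu>\<^sup>2 / lam" using pos by (intro divide_right_mono g2) auto
    thus "r \<le> 33 / 50 * x" using pos by (simp add: r_def x_def power_divide)
  qed (use pos in \<open>auto simp: r_def\<close>)
  have "N / \<mu> \<le> 1 / 420" using N pos by (simp add: field_simps)
  hence "x \<le> (1 / 420)\<^sup>2" unfolding x_def using N pos by (intro power_mono) auto
  also have "(1 / 420)\<^sup>2 \<le> (1 / 100 :: real)" by (simp add: power2_eq_square)
  finally have x: "0 \<le> x" "x \<le> 1 / 100" by (simp_all add: x_def)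
  have "r \<le> 1 / 100" using r x by simp
  hence "p * r \<le> (33 / 25 * x) * (1 / 100)" using p r x by (intro mult_mono) auto
  hence pr: "p * r \<le> x / 50" "0 \<le> p * r" using x p r by simp_all
  define s where "s = p * r"
  have \<rho>: "\<rho> = p / 2 - r - s / 2" by (simp add: \<rho>_def s_def field_simps)
  have "\<rho> \<le> x" "- \<rho> \<le> x"
    unfolding \<rho> using p r x pr unfolding s_def[symmetric] by simp_all
  hence "\<bar>\<rho>\<bar> \<le> x" by (rule abs_leI)
  moreover have "(2 + t\<^sup>2 / \<mu>\<^sup>2) * (lam - g\<^sup>2 / \<mu>\<^sup>2) = (1 + \<rho>) * (2 * lam)"
  proof -
    have "lam - g\<^sup>2 / \<mu>\<^sup>2 = lam * (1 - r)" using pos by (simp add: r_def algebra_simps)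
    thus ?thesis by (simp add: \<rho>_def p_def[symmetric])
  qed
  ultimately show ?thesis using that x unfolding x_def by blast
qed

section \<open>Perturbation of the population equation\<close>

text \<open>The deterministic core. Here \<open>A\<close> and \<open>T\<close> are the population and the empirical second moment matrix, \<open>R\<close> is the resolvent of
\<open>A\<close>, \<open>q\<close> is the fourth root of the regularisation parameter, and the hypothesis with \<open>\<psi>\<close> measures noise and covariance error on the scale of the signal. With
\<open>E = T - A\<close> and \<open>D = \<Delta> - b\<close>, subtracting the equations of \<open>\<Delta>\<close> and \<open>b\<close> yields
\<open>D = R (A (\<xi> - E b) - E (A b)) + R (E \<xi> - E (E b)) - R (A (E D) + E (T D)) + \<rho> R (A (A b)) - 2 \<rho> q^4 R D\<close>.
The first bracket is kept. In the rest each summand has a second small factor: \<open>E\<close> or \<open>\<rho>\<close> next to \<open>\<xi>\<close>, \<open>E\<close> or \<open>D\<close>, or \<open>\<rho>\<close> next to the bias.\<close>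

lemma perturbation_bound:
  fixes A T S R :: "real^'n^'n" and \<xi> \<theta>\<^sub>0 \<Delta> b :: "real^'n"
  assumes symA: "transpose A = A" and symT: "transpose T = T"
    and S: "transpose S = S" "S ** S = A"
    and q: "0 < q" and x: "\<bar>\<rho>\<bar> \<le> x" "x \<le> 1 / 100"
    and \<Delta>: "T *v (T *v \<Delta>) + ((1 + \<rho>) * (2 * q^4)) *\<^sub>R \<Delta> = T *v \<xi> - ((1 + \<rho>) * (2 * q^4)) *\<^sub>R \<theta>\<^sub>0"
    and b: "A *v (A *v b) + (2 * q^4) *\<^sub>R b = - ((2 * q^4) *\<^sub>R \<theta>\<^sub>0)"
    and R: "\<And>z. A *v (A *v (R *v z)) + (2 * q^4) *\<^sub>R (R *v z) = z" "\<And>z. R *v (A *v z) = A *v (R *v z)"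
    and L: "\<And>z. norm (A *v z) \<le> L * norm z" "q\<^sup>2 \<le> L"
    and \<psi>: "norm \<xi> + 2 * norm (T - A) * norm \<theta>\<^sub>0 \<le> 2 / 7 * \<psi> * norm \<theta>\<^sub>0" "0 \<le> \<psi>"
  shows "norm (S *v \<Delta>) \<le> norm (S *v b) + norm (S *v (R *v (A *v \<xi>)))
      + norm (S *v (R *v (A *v ((T - A) *v b)))) + norm (S *v (R *v ((T - A) *v (A *v b))))
      + 2 * x * sqrt L * norm b + x * \<psi> * norm \<theta>\<^sub>0 / q + \<psi>\<^sup>2 * norm \<theta>\<^sub>0 / q^3"
proof -
  define c where "c = sqrt 2 * q\<^sup>2"
  define E where "E = T - A"
  define e where "e = norm E"
  define N where "N = norm \<theta>\<^sub>0"
  define v where "v = norm \<xi>"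
  define D where "D = \<Delta> - b"
  define c' where "c' = sqrt (1 + \<rho>) * c"
  note distribs = matrix_vector_right_distrib matrix_vector_mult_diff_distrib matrix_vector_mult_scaleR
  have x0: "0 \<le> x" using x by linarith
  have sqrt2: "(141 / 100) \<le> sqrt 2" "sqrt 2 \<le> (71 / 50)"
    by (rule real_le_rsqrt, simp add: power2_eq_square) (rule real_le_lsqrt, auto simp: power2_eq_square)
  have c: "0 < c" "c\<^sup>2 = 2 * q^4" "(141 / 100) * q\<^sup>2 \<le> c" "c \<le> (71 / 50) * q\<^sup>2"
    using q sqrt2 by (auto simp: c_def power_mult_distrib intro!: mult_right_mono)
  have \<rho>: "-1/100 \<le> \<rho>" "\<rho> \<le> 1/100" using x by auto
  have c'2: "c'\<^sup>2 = (1 + \<rho>) * (2 * q^4)" using \<rho> c by (simp add: c'_def power_mult_distrib)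
  have "(99 / 100) \<le> sqrt (1 + \<rho>)" by (rule real_le_rsqrt) (use \<rho> in \<open>simp add: power2_eq_square\<close>)
  hence c': "(99 / 100) * c \<le> c'" using c by (simp add: c'_def)
  have c'0: "0 < c'" by (rule less_le_trans[OF _ c']) (use c in simp)
  have Ez: "E *v z = T *v z - A *v z" for z by (simp add: E_def matrix_vector_mult_diff_rdistrib)
  have En: "norm (E *v z) \<le> e * norm z" for z unfolding e_def by (rule matrix_vector_norm_le)
  have e0: "0 \<le> e" "0 \<le> N" "0 \<le> v" by (auto simp: e_def N_def v_def)
  have veN: "v + 2 * e * N \<le> 2/7 * \<psi> * N" using \<psi> by (simp add: v_def e_def N_def E_def)
  have vN: "v \<le> 2/7 * \<psi> * N" using veN e0 mult_nonneg_nonneg[of e N] by linarith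
  have eN: "e * N \<le> \<psi> * N / 7" using veN e0 by linarith
  obtain R' where R': "\<And>z. T *v (T *v (R' *v z)) + c'\<^sup>2 *\<^sub>R (R' *v z) = z" "\<And>z. R' *v (T *v z) = T *v (R' *v z)"
    using sym_matrix_resolvent_exists[OF symT c'0] by metis
  have Rb: "norm (R *v z) \<le> norm z / c\<^sup>2" "norm (A *v (R *v z)) \<le> norm z / (2 * c)" "norm (A *v (A *v (R *v z))) \<le> norm z" for z
    using sym_matrix_resolvent_bounds[OF symA c(1), of "R *v z" z] R(1)[of z] c(2) by auto
  have R'b: "norm (R' *v z) \<le> norm z / c'\<^sup>2" "norm (T *v (R' *v z)) \<le> norm z / (2 * c')" "norm (T *v (T *v (R' *v z))) \<le> norm z" for z
    using sym_matrix_resolvent_bounds[OF symT c'0 R'(1)] by auto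
  have RH: "R *v (A *v (A *v y) + (2 * q^4) *\<^sub>R y) = y" for y
    using R(1)[of y] by (simp add: distribs R(2))
  have R'H: "R' *v (T *v (T *v y) + c'\<^sup>2 *\<^sub>R y) = y" for y
    using R'(1)[of y] by (simp add: distribs R'(2))
  \<comment> \<open>The bias is the resolvent of \<open>A\<close> applied to \<open>- c\<^sup>2 \<theta>\<^sub>0\<close>.\<close>
  have b_sizes: "norm b \<le> N" "norm (A *v b) \<le> c / 2 * N"
  proof -
    note bb = sym_matrix_resolvent_bounds[OF symA c(1), of b, unfolded c(2), OF b]
    show "norm b \<le> N" using bb(1) q by (simp add: N_def)
    have "norm (A *v b) \<le> c\<^sup>2 * N / (2 * c)" using bb(2) q unfolding c(2) by (simp add: N_def)
    also have "\<dots> = c / 2 * N" using c(1) by (simp add: power2_eq_square)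
    finally show "norm (A *v b) \<le> c / 2 * N" .
  qed
  have eb: "e * norm b \<le> e * N" using b_sizes e0 by (intro mult_left_mono)
  have TT\<Delta>: "T *v (T *v \<Delta>) = T *v \<xi> - c'\<^sup>2 *\<^sub>R \<theta>\<^sub>0 - c'\<^sup>2 *\<^sub>R \<Delta>"
    using \<Delta> unfolding c'2 by (metis add_diff_cancel_right')
  have AAb: "A *v (A *v b) = - (c\<^sup>2 *\<^sub>R \<theta>\<^sub>0) - c\<^sup>2 *\<^sub>R b"
    using b unfolding c(2) by (metis add_diff_cancel_right')
  have c'c: "c'\<^sup>2 = (1 + \<rho>) * c\<^sup>2" unfolding c'2 c(2) ..
  \<comment> \<open>First-order bounds on \<open>D\<close> and \<open>T D\<close>. The equation is inverted with the resolvent of \<open>T\<close> itself,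
     whose bounds are those of the resolvent of \<open>A\<close>. The term caused by \<open>\<rho>\<close> is rewritten through \<open>A (A b)\<close>, which makes
     it a multiple of the bias and not of \<open>\<theta>\<^sub>0\<close>.\<close>
  define z1 where "z1 = \<xi> - (1 + \<rho>) *\<^sub>R (E *v b)"
  define z2 where "z2 = (1 + \<rho>) *\<^sub>R (E *v (A *v b))"
  have D_eq: "D = T *v (R' *v z1) + \<rho> *\<^sub>R (T *v (T *v (R' *v b))) - R' *v z2"
  proof -
    have "T *v (T *v D) + c'\<^sup>2 *\<^sub>R D = T *v (z1 + \<rho> *\<^sub>R (T *v b)) - z2"
      by (simp add: D_def z1_def z2_def Ez distribs TT\<Delta> AAb c'c algebra_simps)
    hence "D = R' *v (T *v (z1 + \<rho> *\<^sub>R (T *v b)) - z2)" by (metis R'H)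
    thus ?thesis by (simp add: distribs R'(2))
  qed
  have z1: "norm z1 \<le> v + (101 / 100) * (e * N)"
  proof -
    have "norm z1 \<le> norm \<xi> + norm ((1 + \<rho>) *\<^sub>R (E *v b))" unfolding z1_def by (rule norm_triangle_ineq4)
    also have "norm ((1 + \<rho>) *\<^sub>R (E *v b)) \<le> (101 / 100) * (e * N)"
      using \<rho> En[of b] eb e0 unfolding norm_scaleR by (intro mult_mono) auto
    finally show ?thesis by (simp add: v_def)
  qed
  have z2: "norm z2 \<le> (1 + \<rho>) * (e * N * (c / 2))"
  proof -
    have "norm (E *v (A *v b)) \<le> e * (c / 2 * N)"
      using En[of "A *v b"] mult_left_mono[OF b_sizes(2) e0(1)] by linarith
    thus ?thesis using \<rho> by (simp add: z2_def mult_left_mono ac_simps)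
  qed
  have inv_c': "1 / (2 * c') \<le> (51 / 100) / c"
    using c' c c'0 by (simp add: field_simps)
  have inv_c: "1 / c \<le> (71 / 100) / q\<^sup>2" using c q by (simp add: field_simps)
  have tri3: "norm (a1 + a2 - a3) \<le> norm a1 + norm a2 + norm a3" for a1 a2 a3 :: "real^'n"
    by norm
  have normD: "norm D \<le> (3 / 20) * (\<psi> * N / q\<^sup>2) + x * norm b"
  proof -
    have "norm D \<le> norm (T *v (R' *v z1)) + norm (\<rho> *\<^sub>R (T *v (T *v (R' *v b)))) + norm (R' *v z2)"
      unfolding D_eq by (rule tri3)
    also have "norm (T *v (R' *v z1)) \<le> (v + (101 / 100) * (e * N)) * ((51 / 100) / c)"
    proof -
      have "norm (T *v (R' *v z1)) \<le> norm z1 * (1 / (2 * c'))" using R'b(2)[of z1] by simp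
      also have "\<dots> \<le> (v + (101 / 100) * (e * N)) * ((51 / 100) / c)"
        using e0 c'0 by (intro mult_mono z1 inv_c') auto
      finally show ?thesis .
    qed
    also have "norm (\<rho> *\<^sub>R (T *v (T *v (R' *v b)))) \<le> x * norm b"
      unfolding norm_scaleR using x x0 R'b(3)[of b] by (intro mult_mono) auto
    also have "norm (R' *v z2) \<le> e * N * ((1 / 2) / c)"
    proof -
      have "norm (R' *v z2) \<le> norm z2 / c'\<^sup>2" by (rule R'b)
      also have "\<dots> \<le> (1 + \<rho>) * (e * N * (c / 2)) / c'\<^sup>2" by (intro divide_right_mono z2) auto
      also have "\<dots> = e * N * ((1 / 2) / c)" 
      proof -
        have "1 + \<rho> \<noteq> 0" using \<rho> by simp
        hence "(1 + \<rho>) * (e * N * (c / 2)) / c'\<^sup>2 = e * N * (c / 2) / c\<^sup>2"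
          unfolding c'c by (rule mult_divide_mult_cancel_left)
        thus ?thesis using c(1) by (simp add: power2_eq_square)
      qed
      finally show ?thesis .
    qed
    finally have "norm D \<le> ((51 / 100) * v + ((51 / 100) * (101 / 100) + (1 / 2)) * (e * N)) * (1 / c) + x * norm b"
      by (simp add: algebra_simps)
    also have "((51 / 100) * v + ((51 / 100) * (101 / 100) + (1 / 2)) * (e * N)) * (1 / c) \<le> ((13 / 25) * (2/7 * \<psi> * N)) * ((71 / 100) / q\<^sup>2)"
    proof (rule mult_mono)
      have y: "0 \<le> e * N" using e0 by simp
      have "(51 / 100) * v + ((51 / 100) * (101 / 100) + (1 / 2)) * y \<le> (13 / 25) * (v + 2 * y)" if "0 \<le> y" for y
        using that e0(3) by simp
      from this[OF y] have "(51 / 100) * v + ((51 / 100) * (101 / 100) + (1 / 2)) * (e * N) \<le> (13 / 25) * (v + 2 * e * N)"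
        by (simp only: mult.assoc)
      also have "\<dots> \<le> (13 / 25) * (2/7 * \<psi> * N)" using veN by (intro mult_left_mono) auto
      finally show "(51 / 100) * v + ((51 / 100) * (101 / 100) + (1 / 2)) * (e * N) \<le> (13 / 25) * (2/7 * \<psi> * N)" .
    next
      show "1 / c \<le> (71 / 100) / q\<^sup>2" by (rule inv_c)
      show "0 \<le> (13 / 25) * (2/7 * \<psi> * N)" using e0(2) \<psi>(2) by simp
      show "0 \<le> 1 / c" using c(1) by simp
    qed
    also have "\<dots> \<le> (3 / 20) * (\<psi> * N / q\<^sup>2)"
      using \<psi>(2) e0 q by (simp add: field_simps)
    finally show ?thesis by simp
  qed
  have normTD: "norm (T *v D) \<le> 2/7 * \<psi> * N + x * ((71 / 100) * q\<^sup>2 * N)"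
  proof -
    have "T *v D = T *v (T *v (R' *v z1)) + \<rho> *\<^sub>R (T *v (T *v (R' *v (T *v b)))) - T *v (R' *v z2)"
      unfolding D_eq by (simp add: distribs R'(2))
    hence "norm (T *v D) \<le> norm (T *v (T *v (R' *v z1))) + norm (\<rho> *\<^sub>R (T *v (T *v (R' *v (T *v b))))) + norm (T *v (R' *v z2))"
      by (simp only: tri3)
    also have "norm (T *v (T *v (R' *v z1))) \<le> v + (101 / 100) * (e * N)"
      using R'b(3)[of z1] z1 by linarith
    also have "norm (\<rho> *\<^sub>R (T *v (T *v (R' *v (T *v b))))) \<le> x * (c / 2 * N + e * N)"
    proof -
      have "T *v b = A *v b + E *v b" by (simp add: Ez)
      hence "norm (T *v b) \<le> norm (A *v b) + norm (E *v b)" by (simp only: norm_triangle_ineq)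
      hence "norm (T *v b) \<le> c / 2 * N + e * N" using b_sizes En[of b] eb by linarith
      thus ?thesis unfolding norm_scaleR using x x0 R'b(3)[of "T *v b"] by (intro mult_mono) auto
    qed
    also have "norm (T *v (R' *v z2)) \<le> (13 / 50) * (e * N)"
    proof -
      have "norm (T *v (R' *v z2)) \<le> norm z2 * (1 / (2 * c'))" using R'b(2)[of z2] by simp
      also have "\<dots> \<le> ((1 + \<rho>) * (e * N * (c / 2))) * ((51 / 100) / c)"
        using e0 c'0 \<rho> c by (intro mult_mono z2 inv_c') auto
      also have "\<dots> = (1 + \<rho>) * ((51 / 200) * (e * N))" using c(1) by (simp add: field_simps)
      also have "\<dots> \<le> (101 / 100) * ((51 / 200) * (e * N))" using \<rho> e0 by (intro mult_right_mono) auto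
      also have "\<dots> \<le> (13 / 50) * (e * N)" using e0 mult_nonneg_nonneg[of e N] by simp
      finally show ?thesis .
    qed
    finally have "norm (T *v D) \<le> v + (127 / 100) * (e * N) + x * (c / 2 * N) + x * (e * N)"
      by (simp add: algebra_simps)
    moreover have "x * (e * N) \<le> 1/100 * (e * N)" using x e0 by (intro mult_right_mono) auto
    moreover have "x * (c / 2 * N) \<le> x * ((71 / 100) * q\<^sup>2 * N)" using c e0 x0 by (intro mult_left_mono mult_right_mono) auto
    ultimately show ?thesis using veN mult_nonneg_nonneg[OF e0(1,2)] by linarith
  qed
  \<comment> \<open>The square root \<open>S\<close> costs a geometric mean: \<open>|S y|\<^sup>2 \<le> |y| |A y|\<close>, and both factors are resolvent bounds.\<close>
  have S1: "norm (S *v (R *v z)) \<le> norm z / q^3" for z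
  proof (rule power2_le_imp_le)
    have "(norm (S *v (R *v z)))\<^sup>2 \<le> norm (R *v z) * norm (A *v (R *v z))" by (rule psd_sqrt_norm_le[OF S])
    also have "\<dots> \<le> norm z / c\<^sup>2 * (norm z / (2 * c))" using c(1) by (intro mult_mono Rb) auto
    also have "\<dots> = (norm z)\<^sup>2 / (4 * q^4 * c)" unfolding c(2) by (simp add: power2_eq_square)
    also have "\<dots> \<le> (norm z)\<^sup>2 / (q^4 * q\<^sup>2)"
    proof (rule divide_left_mono)
      have "q^4 * q\<^sup>2 \<le> q^4 * (4 * c)" using c q by (intro mult_left_mono) auto
      thus "q^4 * q\<^sup>2 \<le> 4 * q^4 * c" by (simp only: ac_simps)
    qed (use c(1) q in auto)
    also have "\<dots> = (norm z / q^3)\<^sup>2" by (simp add: power_divide power_mult[symmetric] power_add[symmetric])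
    finally show "(norm (S *v (R *v z)))\<^sup>2 \<le> (norm z / q^3)\<^sup>2" .
  qed (use q in simp)
  have S2: "norm (S *v (R *v (A *v z))) \<le> norm z / q" for z
  proof (rule power2_le_imp_le)
    have "(norm (S *v (R *v (A *v z))))\<^sup>2 \<le> norm (R *v (A *v z)) * norm (A *v (R *v (A *v z)))" by (rule psd_sqrt_norm_le[OF S])
    also have "\<dots> \<le> norm z / (2 * c) * norm z" unfolding R(2) using c(1) by (intro mult_mono Rb) auto
    also have "\<dots> = (norm z)\<^sup>2 / (2 * c)" by (simp add: power2_eq_square)
    also have "\<dots> \<le> (norm z)\<^sup>2 / q\<^sup>2" using c q by (intro divide_left_mono) auto
    finally show "(norm (S *v (R *v (A *v z))))\<^sup>2 \<le> (norm z / q)\<^sup>2" by (simp add: power_divide)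
  qed (use q in simp)
  have L0: "0 \<le> L" using L(2) zero_le_power2[of q] by linarith
  have S3: "norm (S *v (R *v (A *v (A *v b)))) \<le> sqrt L * norm b"
  proof (rule power2_le_imp_le)
    have "(norm (S *v (R *v (A *v (A *v b)))))\<^sup>2 \<le> norm (R *v (A *v (A *v b))) * norm (A *v (R *v (A *v (A *v b))))"
      by (rule psd_sqrt_norm_le[OF S])
    also have "\<dots> = norm (A *v (A *v (R *v b))) * norm (A *v (A *v (R *v (A *v b))))" by (simp only: R(2))
    also have "\<dots> \<le> norm b * norm (A *v b)" using c(1) by (intro mult_mono Rb) auto
    also have "\<dots> \<le> norm b * (L * norm b)" by (intro mult_left_mono L) auto
    also have "\<dots> = (sqrt L * norm b)\<^sup>2" using L0 by (simp add: power_mult_distrib power2_eq_square)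
    finally show "(norm (S *v (R *v (A *v (A *v b)))))\<^sup>2 \<le> (sqrt L * norm b)\<^sup>2" .
  qed (use L0 in simp)
  \<comment> \<open>Inverting with the resolvent of \<open>A\<close> isolates the three terms linear in \<open>\<xi>\<close> and \<open>E\<close>; every other term
     contains two small factors and is controlled by the first-order bounds.\<close>
  have D_exp: "D = R *v (A *v \<xi>) - R *v (A *v (E *v b)) - R *v (E *v (A *v b))
      + R *v (E *v \<xi>) - R *v (E *v (E *v b)) - R *v (A *v (E *v D)) - R *v (E *v (T *v D))
      + \<rho> *\<^sub>R (R *v (A *v (A *v b))) - (\<rho> * c\<^sup>2) *\<^sub>R (R *v D)"
  proof -
    have "A *v (A *v D) + c\<^sup>2 *\<^sub>R D = A *v \<xi> - A *v (E *v b) - E *v (A *v b)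
      + E *v \<xi> - E *v (E *v b) - A *v (E *v D) - E *v (T *v D) + \<rho> *\<^sub>R (A *v (A *v b)) - (\<rho> * c\<^sup>2) *\<^sub>R D"
      by (simp add: D_def Ez distribs TT\<Delta> AAb c'c algebra_simps)
    moreover have "R *v (A *v (A *v D) + c\<^sup>2 *\<^sub>R D) = D" unfolding c(2) by (rule RH)
    ultimately have "D = R *v (A *v \<xi> - A *v (E *v b) - E *v (A *v b)
      + E *v \<xi> - E *v (E *v b) - A *v (E *v D) - E *v (T *v D) + \<rho> *\<^sub>R (A *v (A *v b)) - (\<rho> * c\<^sup>2) *\<^sub>R D)"
      by simp
    thus ?thesis by (simp only: distribs)
  qed
  have tri: "norm (a0 + (a1 - a2 - a3 + a4 - a5 - a6 - a7 + a8 - a9)) \<le>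
     norm a0 + (norm a1 + norm a2 + norm a3 + norm a4 + norm a5 + norm a6 + norm a7 + norm a8 + norm a9)"
    for a0 a1 a2 a3 a4 a5 a6 a7 a8 a9 :: "real^'n"
    by (intro order_trans[OF norm_triangle_ineq] order_trans[OF norm_triangle_ineq4] add_mono order_refl)
  have "S *v \<Delta> = S *v b + S *v D" by (simp add: D_def distribs)
  also have "S *v D = S *v (R *v (A *v \<xi>)) - S *v (R *v (A *v (E *v b))) - S *v (R *v (E *v (A *v b)))
      + S *v (R *v (E *v \<xi>)) - S *v (R *v (E *v (E *v b))) - S *v (R *v (A *v (E *v D))) - S *v (R *v (E *v (T *v D)))
      + \<rho> *\<^sub>R (S *v (R *v (A *v (A *v b)))) - (\<rho> * c\<^sup>2) *\<^sub>R (S *v (R *v D))"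
    by (subst D_exp) (simp only: distribs)
  finally have "norm (S *v \<Delta>) \<le> norm (S *v b) + (norm (S *v (R *v (A *v \<xi>))) + norm (S *v (R *v (A *v (E *v b))))
      + norm (S *v (R *v (E *v (A *v b)))) + norm (S *v (R *v (E *v \<xi>))) + norm (S *v (R *v (E *v (E *v b))))
      + norm (S *v (R *v (A *v (E *v D)))) + norm (S *v (R *v (E *v (T *v D))))
      + norm (\<rho> *\<^sub>R (S *v (R *v (A *v (A *v b))))) + norm ((\<rho> * c\<^sup>2) *\<^sub>R (S *v (R *v D))))"
    by (simp only: tri)
  moreover define P2 where "P2 = \<psi>\<^sup>2 * N / q^3"
  moreover define P1 where "P1 = x * \<psi> * N / q"
  have eE: "e * (\<psi> * N) \<le> \<psi> / 7 * (\<psi> * N)"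
    using mult_right_mono[OF eN \<psi>(2)] by (simp add: ac_simps)
  moreover have "norm (S *v (R *v (E *v \<xi>))) \<le> (1 / 20) * P2"
  proof -
    have "e * v \<le> e * (2/7 * \<psi> * N)" by (intro mult_left_mono vN e0)
    also have "\<dots> \<le> (1 / 20) * (\<psi>\<^sup>2 * N)" using eE mult_nonneg_nonneg[OF zero_le_power2[of \<psi>] e0(2)]
      by (simp add: power2_eq_square)
    finally have "norm (E *v \<xi>) \<le> (1 / 20) * (\<psi>\<^sup>2 * N)" using En[of \<xi>] by (simp add: v_def)
    hence "norm (E *v \<xi>) / q^3 \<le> (1 / 20) * (\<psi>\<^sup>2 * N) / q^3" using q by (intro divide_right_mono) auto
    with S1[of "E *v \<xi>"] show ?thesis by (simp add: P2_def)
  qed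
  moreover have "norm (S *v (R *v (E *v (E *v b)))) \<le> (1 / 20) * P2"
  proof -
    have "norm (E *v (E *v b)) \<le> e * (e * N)"
      using En[of "E *v b"] mult_left_mono[OF order_trans[OF En[of b] eb] e0(1)] by linarith
    also have "\<dots> \<le> e * (\<psi> * N / 7)" by (intro mult_left_mono eN e0)
    also have "\<dots> \<le> (1 / 20) * (\<psi>\<^sup>2 * N)" using eE mult_nonneg_nonneg[OF zero_le_power2[of \<psi>] e0(2)]
      by (simp add: power2_eq_square)
    finally have "norm (E *v (E *v b)) / q^3 \<le> (1 / 20) * (\<psi>\<^sup>2 * N) / q^3" using q by (intro divide_right_mono) auto
    with S1[of "E *v (E *v b)"] show ?thesis by (simp add: P2_def)
  qed
  moreover have "norm (S *v (R *v (A *v (E *v D)))) \<le> (1 / 20) * P2 + (1 / 5) * P1"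
  proof -
    have "e * norm D \<le> e * ((3 / 20) * (\<psi> * N / q\<^sup>2) + x * N)"
      using normD mult_left_mono[OF b_sizes(1) x0] e0 by (intro mult_left_mono) linarith+
    also have "\<dots> = (3 / 20) / q\<^sup>2 * (e * (\<psi> * N)) + x * (e * N)" by (simp add: algebra_simps)
    also have "\<dots> \<le> (3 / 20) / q\<^sup>2 * (\<psi> / 7 * (\<psi> * N)) + x * (\<psi> * N / 7)"
      using x0 by (intro add_mono mult_left_mono eE eN) auto
    finally have "e * norm D / q \<le> ((3 / 20) / q\<^sup>2 * (\<psi> / 7 * (\<psi> * N)) + x * (\<psi> * N / 7)) / q"
      using q by (intro divide_right_mono) auto
    also have "\<dots> = (3 / 20) / 7 * P2 + 1 / 7 * P1" using q
      by (simp add: P1_def P2_def field_simps power2_eq_square power3_eq_cube)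
    finally have "e * norm D / q \<le> (3 / 20) / 7 * P2 + 1 / 7 * P1" .
    moreover have "0 \<le> P1" "0 \<le> P2" using x0 e0 q \<psi> by (auto simp: P1_def P2_def)
    moreover have "norm (E *v D) / q \<le> e * norm D / q" using En q by (intro divide_right_mono) auto
    ultimately show ?thesis using S2[of "E *v D"] by linarith
  qed
  moreover have "norm (S *v (R *v (E *v (T *v D)))) \<le> (1 / 20) * P2 + (1 / 5) * P1"
  proof -
    have "e * norm (T *v D) \<le> e * (2/7 * \<psi> * N + x * ((71 / 100) * q\<^sup>2 * N))"
      by (intro mult_left_mono normTD e0)
    also have "\<dots> = 2 / 7 * (e * (\<psi> * N)) + x * (71 / 100) * q\<^sup>2 * (e * N)" by (simp add: algebra_simps)
    also have "\<dots> \<le> 2 / 7 * (\<psi> / 7 * (\<psi> * N)) + x * (71 / 100) * q\<^sup>2 * (\<psi> * N / 7)"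
      using x0 by (intro add_mono mult_left_mono eE eN) auto
    finally have "e * norm (T *v D) / q^3 \<le> (2 / 7 * (\<psi> / 7 * (\<psi> * N)) + x * (71 / 100) * q\<^sup>2 * (\<psi> * N / 7)) / q^3"
      using q by (intro divide_right_mono) auto
    also have "\<dots> = 2 / 49 * P2 + (71 / 100) / 7 * P1" using q
      by (simp add: P1_def P2_def field_simps power2_eq_square power3_eq_cube)
    finally have "e * norm (T *v D) / q^3 \<le> 2 / 49 * P2 + (71 / 100) / 7 * P1" .
    moreover have "0 \<le> P1" "0 \<le> P2" using x0 e0 q \<psi> by (auto simp: P1_def P2_def)
    moreover have "norm (E *v (T *v D)) / q^3 \<le> e * norm (T *v D) / q^3" using En q by (intro divide_right_mono) auto
    ultimately show ?thesis using S1[of "E *v (T *v D)"] by linarith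
  qed
  moreover have "norm (\<rho> *\<^sub>R (S *v (R *v (A *v (A *v b))))) \<le> x * (sqrt L * norm b)"
    unfolding norm_scaleR using x x0 S3 by (intro mult_mono) auto
  moreover have "norm ((\<rho> * c\<^sup>2) *\<^sub>R (S *v (R *v D))) \<le> (3 / 10) * P1 + (1 / 50) * (x * (sqrt L * norm b))"
  proof -
    have qL: "q \<le> sqrt L" using L(2) q by (intro real_le_rsqrt) auto
    have "norm ((\<rho> * c\<^sup>2) *\<^sub>R (S *v (R *v D))) = \<bar>\<rho>\<bar> * (2 * q^4) * norm (S *v (R *v D))"
      unfolding norm_scaleR c(2) by (simp add: abs_mult)
    also have "\<dots> \<le> x * (2 * q^4) * (norm D / q^3)"
      using x x0 by (intro mult_mono S1) auto
    also have "\<dots> = 2 * x * q * norm D" using q by (simp add: field_simps power3_eq_cube power4_eq_xxxx)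
    also have "\<dots> \<le> 2 * x * q * ((3 / 20) * (\<psi> * N / q\<^sup>2) + x * norm b)"
      using x0 q by (intro mult_left_mono normD) auto
    also have "\<dots> = (3 / 10) * P1 + 2 * x * (x * (q * norm b))"
      using q by (simp add: P1_def field_simps power2_eq_square)
    also have "2 * x * (x * (q * norm b)) \<le> 2 * (1/100) * (x * (sqrt L * norm b))"
      using x x0 qL q L0 by (intro mult_mono) auto
    finally show ?thesis by simp
  qed
  moreover have "0 \<le> P1" "0 \<le> P2" using x0 e0 q \<psi> by (auto simp: P1_def P2_def)
  moreover have "0 \<le> x * (sqrt L * norm b)" using x0 L0 by simp
  ultimately show ?thesis
    unfolding E_def[symmetric] N_def[symmetric] by (simp add: P1_def[symmetric] P2_def[symmetric])
qed

text \<open>Term by term; \<open>(N0 / \<mu>)\<^sup>2 \<le> N0 / \<mu>\<close> serves the first one, and \<open>sqrt 3 \<le> 19\<close> the last one.\<close>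

lemma remainder_term_lower_bound:
  fixes \<Sigma> :: "real^'d^'d" and \<theta>\<^sub>0 :: "real^'d" and \<sigma> C \<mu> lam \<delta> :: real and n :: nat
  defines "N0 \<equiv> norm \<theta>\<^sub>0" and "M \<equiv> op_norm \<Sigma>" and "b \<equiv> bias_vec \<Sigma> lam \<theta>\<^sub>0"
    and "q \<equiv> lam powr (1/4)" and "\<psi> \<equiv> sqrt (Psi_term \<Sigma> \<theta>\<^sub>0 \<sigma> C n \<delta>)"
  assumes lam: "0 < lam" and \<mu>: "0 < \<mu>" "N0 \<le> \<mu>" and \<delta>: "0 < \<delta>" "\<delta> < 1"
  shows "2 * (N0 / \<mu>)\<^sup>2 * sqrt M * norm b + (N0 / \<mu>)\<^sup>2 * \<psi> * N0 / q + \<psi>\<^sup>2 * N0 / q^3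
    \<le> remainder_term \<Sigma> \<theta>\<^sub>0 \<sigma> C \<mu> lam n \<delta>"
proof -
  have N0: "0 \<le> N0" and Mpos: "0 \<le> M" and q: "0 < q"
    using lam by (simp_all add: N0_def M_def q_def onorm_pos_le[OF matrix_vector_mul_bounded_linear])
  have ln_pos: "0 < ln (4 / \<delta>)" using \<delta> by simp
  have \<psi>2: "Psi_term \<Sigma> \<theta>\<^sub>0 \<sigma> C n \<delta> = \<psi>\<^sup>2" and \<psi>0: "0 \<le> \<psi>"
    using ln_pos unfolding \<psi>_def Psi_term_def by (simp_all add: less_imp_le)
  have q3: "q ^ 3 = lam powr (3/4)"
    using lam powr_realpow[of q 3] q by (simp add: q_def powr_powr)
  define y where "y = N0 / \<mu>"
  have y: "0 \<le> y" "y \<le> 1" using N0 \<mu> by (auto simp: y_def)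
  have i1: "2 * y\<^sup>2 * sqrt M * norm b \<le> 210 * (y + M * norm b / (\<mu> * sqrt lam)) * sqrt M * norm b"
  proof (intro mult_right_mono)
    have "y\<^sup>2 \<le> y" using y by (simp add: power2_eq_square mult_left_le)
    moreover have "0 \<le> M * norm b / (\<mu> * sqrt lam)" using Mpos lam \<mu> by simp
    ultimately show "2 * y\<^sup>2 \<le> 210 * (y + M * norm b / (\<mu> * sqrt lam))" using y by simp
  qed (use Mpos in auto)
  have i2: "y\<^sup>2 * \<psi> * N0 / q \<le> N0 / q * ((17 * N0 / \<mu>)\<^sup>2 + norm b / (160 * \<mu>)) * \<psi>"
  proof -
    have "y\<^sup>2 \<le> (17 * N0 / \<mu>)\<^sup>2 + norm b / (160 * \<mu>)"
    proof -
      have "(17 * N0 / \<mu>)\<^sup>2 = 289 * y\<^sup>2" by (simp add: y_def power_divide power_mult_distrib)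
      moreover have "0 \<le> norm b / (160 * \<mu>)" using lam \<mu> by simp
      ultimately show ?thesis using zero_le_power2[of y] by linarith
    qed
    hence "N0 / q * (y\<^sup>2 * \<psi>) \<le> N0 / q * (((17 * N0 / \<mu>)\<^sup>2 + norm b / (160 * \<mu>)) * \<psi>)"
      using N0 q \<psi>0 by (intro mult_left_mono mult_right_mono) auto
    thus ?thesis by (simp add: ac_simps)
  qed
  have i3: "\<psi>\<^sup>2 * N0 / q^3 \<le> 19 * N0 / (sqrt 3 * q^3) * (1 + sqrt (\<psi>\<^sup>2 / lam)) * \<psi>\<^sup>2"
  proof -
    have "sqrt 3 \<le> 19" by (rule real_le_lsqrt) auto
    hence "1 * 1 \<le> (19 / sqrt 3) * (1 + sqrt (\<psi>\<^sup>2 / lam))"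
      using lam \<mu> by (intro mult_mono) auto
    hence "1 * (N0 * \<psi>\<^sup>2 / q^3) \<le> (19 / sqrt 3) * (1 + sqrt (\<psi>\<^sup>2 / lam)) * (N0 * \<psi>\<^sup>2 / q^3)"
      using N0 q by (intro mult_right_mono) auto
    thus ?thesis by (simp add: ac_simps)
  qed
  show ?thesis
    using i1 i2 i3
    unfolding remainder_term_def Let_def b_def[symmetric] \<psi>2 N0_def[symmetric] M_def[symmetric] q_def[symmetric] q3[symmetric] y_def
    using \<psi>0 by simp
qed

section \<open>Deviations of weighted norms\<close>

text \<open>The weights attached to coordinates; \<open>diag_map w\<close> is a self-adjoint map with squared Hilbert-Schmidt norm \<open>\<Sum>b\<in>Basis. (w b)\<^sup>2\<close>.\<close>

definition diag_map :: "('a \<Rightarrow> real) \<Rightarrow> 'a \<Rightarrow> 'a::euclidean_space" where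
  "diag_map w g = (\<Sum>b\<in>Basis. (w b * (g \<bullet> b)) *\<^sub>R b)"

lemma diag_map_inner_Basis: "b \<in> Basis \<Longrightarrow> diag_map w g \<bullet> b = w b * (g \<bullet> b)"
  by (simp add: diag_map_def inner_sum_left inner_Basis if_distrib[of "\<lambda>x. _ * x"] cong: if_cong)

lemma diag_map_inner: "diag_map w x \<bullet> y = x \<bullet> diag_map w y"
  by (simp add: diag_map_def inner_sum_left inner_sum_right inner_commute ac_simps)

lemma linear_diag_map: "linear (diag_map w)"
  by (rule linearI)
    (simp_all add: diag_map_def inner_add_left algebra_simps sum.distrib scaleR_sum_right)

lemma norm_diag_map_sq: "(norm (diag_map w g))\<^sup>2 = (\<Sum>b\<in>Basis. (w b)\<^sup>2 * (g \<bullet> b)\<^sup>2)"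
  unfolding power2_norm_eq_inner
  by (subst euclidean_inner) (simp add: diag_map_inner_Basis power2_eq_square ac_simps)

lemma norm_diag_map_le:
  assumes "\<And>b. b \<in> Basis \<Longrightarrow> \<bar>w b\<bar> \<le> 1"
  shows "norm (diag_map w g) \<le> norm g"
proof -
  have "(norm (diag_map w g))\<^sup>2 \<le> (\<Sum>b\<in>Basis. 1 * (g \<bullet> b)\<^sup>2)"
    unfolding norm_diag_map_sq
    by (intro sum_mono mult_right_mono) (auto simp: abs_square_le_1 assms)
  also have "\<dots> = (norm g)\<^sup>2"
    unfolding power2_norm_eq_inner by (subst euclidean_inner) (simp add: power2_eq_square)
  finally show ?thesis by (simp add: power2_le_iff_abs_le)
qed

lemma diag_map_measurable[measurable]: "diag_map w \<in> borel_measurable borel"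
  using linear_diag_map linear_continuous_on linear_conv_bounded_linear borel_measurable_continuous_onI by blast

definition gauss_density :: "'a::euclidean_space \<Rightarrow> real" where
  "gauss_density g = (\<Prod>b\<in>Basis. std_normal_density (g \<bullet> b))"

definition gauss :: "'a::euclidean_space measure" where
  "gauss = density lborel (\<lambda>g. ennreal (gauss_density g))"

lemma gauss_density_nonneg: "0 \<le> gauss_density g"
  unfolding gauss_density_def by (intro prod_nonneg) auto

lemma gauss_density_measurable[measurable]: "gauss_density \<in> borel_measurable borel"
  unfolding gauss_density_def[abs_def] by measurable

lemma sets_gauss[measurable_cong, simp]: "sets gauss = sets borel"
  by (simp add: gauss_def)

lemma space_gauss[simp]: "space gauss = UNIV"
  by (simp add: gauss_def)

text \<open>The Cameron-Martin density of a shift.\<close>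

lemma gauss_density_shift:
  "gauss_density (a + h) = gauss_density h * exp (- (a \<bullet> h) - (norm a)\<^sup>2 / 2)"
proof -
  have "- (a \<bullet> h) - (norm a)\<^sup>2 / 2 = (\<Sum>b\<in>Basis. - ((a \<bullet> b) * (h \<bullet> b)) - (a \<bullet> b)\<^sup>2 / 2)"
    unfolding power2_norm_eq_inner
    by (subst (1 2) euclidean_inner) (simp add: sum_subtractf sum_negf sum_divide_distrib power2_eq_square)
  also have "exp \<dots> = (\<Prod>b\<in>Basis. exp (- ((a \<bullet> b) * (h \<bullet> b)) - (a \<bullet> b)\<^sup>2 / 2))"
    by (simp add: exp_sum)
  finally have e: "exp (- (a \<bullet> h) - (norm a)\<^sup>2 / 2) = (\<Prod>b\<in>Basis. exp (- ((a \<bullet> b) * (h \<bullet> b)) - (a \<bullet> b)\<^sup>2 / 2))" .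
  show ?thesis unfolding e gauss_density_def prod.distrib[symmetric]
    by (intro prod.cong refl)
       (simp add: std_normal_density_def inner_add_left exp_add[symmetric] power2_eq_square field_simps)
qed

lemma gauss_density_uminus: "gauss_density (- h) = gauss_density h"
  by (simp add: gauss_density_def std_normal_density_def)

lemma nn_integral_gauss_shift:
  assumes [measurable]: "F \<in> borel_measurable borel"
  shows "(\<integral>\<^sup>+g. F g \<partial>gauss) = (\<integral>\<^sup>+h. F (a + h) * ennreal (exp (- (a \<bullet> h) - (norm a)\<^sup>2 / 2)) \<partial>gauss)"
proof -
  have "(\<integral>\<^sup>+g. F g \<partial>gauss) = (\<integral>\<^sup>+g. ennreal (gauss_density g) * F g \<partial>distr lborel borel ((+) a))"
    unfolding gauss_def lborel_distr_plus by (subst nn_integral_density) auto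
  also have "\<dots> = (\<integral>\<^sup>+h. ennreal (gauss_density (a + h)) * F (a + h) \<partial>lborel)"
    by (subst nn_integral_distr) auto
  also have "\<dots> = (\<integral>\<^sup>+h. ennreal (gauss_density h) * (F (a + h) * ennreal (exp (- (a \<bullet> h) - (norm a)\<^sup>2 / 2))) \<partial>lborel)"
    by (simp only: gauss_density_shift)
       (simp add: ennreal_mult gauss_density_nonneg mult.assoc mult.commute[of "F _"])
  also have "\<dots> = (\<integral>\<^sup>+h. F (a + h) * ennreal (exp (- (a \<bullet> h) - (norm a)\<^sup>2 / 2)) \<partial>gauss)"
    unfolding gauss_def by (subst nn_integral_density) auto
  finally show ?thesis .
qed

lemma nn_integral_gauss_uminus:
  fixes F :: "'a::euclidean_space \<Rightarrow> ennreal"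
  assumes [measurable]: "F \<in> borel_measurable borel"
  shows "(\<integral>\<^sup>+g. F (- g) \<partial>gauss) = (\<integral>\<^sup>+g. F g \<partial>gauss)"
proof -
  have um: "distr lborel borel uminus = (lborel :: 'a measure)"
    using lborel_affine[of "-1" "0::'a"] by (simp add: density_1)
  have "(\<integral>\<^sup>+g. F g \<partial>gauss) = (\<integral>\<^sup>+g. ennreal (gauss_density g) * F g \<partial>distr lborel borel uminus)"
    unfolding gauss_def um by (subst nn_integral_density) auto
  also have "\<dots> = (\<integral>\<^sup>+h. ennreal (gauss_density h) * F (- h) \<partial>lborel)"
    by (subst nn_integral_distr) (auto simp: gauss_density_uminus)
  also have "\<dots> = (\<integral>\<^sup>+g. F (- g) \<partial>gauss)"
    unfolding gauss_def by (subst nn_integral_density) auto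
  finally show ?thesis by simp
qed

lemma nn_integral_std_normal: "(\<integral>\<^sup>+x. ennreal (std_normal_density x) \<partial>lborel) = 1"
  using std_normal_moment_even[of 0]
  by (subst nn_integral_eq_integral) (auto simp: has_bochner_integral_iff)

lemma nn_integral_std_normal_sq: "(\<integral>\<^sup>+x. ennreal (std_normal_density x * x\<^sup>2) \<partial>lborel) = 1"
  using std_normal_moment_even[of 1]
  by (subst nn_integral_eq_integral) (auto simp: has_bochner_integral_iff)

lemma prob_space_gauss: "prob_space gauss"
proof
  have "emeasure gauss (UNIV :: 'a set) = (\<integral>\<^sup>+g. (\<Prod>b\<in>Basis. ennreal (std_normal_density (g \<bullet> b))) \<partial>(lborel :: 'a measure))"
    unfolding gauss_def by (subst emeasure_density) (auto simp: gauss_density_def prod_ennreal)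
  also have "\<dots> = 1"
    by (subst nn_integral_lborel_prod) (auto simp: nn_integral_std_normal)
  finally show "emeasure gauss (space gauss :: 'a set) = 1" by simp
qed

lemma nn_integral_gauss_coord_sq:
  fixes b :: "'a::euclidean_space"
  assumes b: "b \<in> Basis"
  shows "(\<integral>\<^sup>+g. ennreal ((g \<bullet> b)\<^sup>2) \<partial>gauss) = 1"
proof -
  let ?f = "\<lambda>c x. ennreal (std_normal_density x * (if c = b then x\<^sup>2 else 1))"
  have "(\<integral>\<^sup>+g. ennreal ((g \<bullet> b)\<^sup>2) \<partial>gauss) = (\<integral>\<^sup>+g. (\<Prod>c\<in>Basis. ?f c (g \<bullet> c)) \<partial>lborel)"
    unfolding gauss_def
  proof (subst nn_integral_density; (measurable)?)
    show "(\<integral>\<^sup>+ x. ennreal (gauss_density x) * ennreal ((x \<bullet> b)\<^sup>2) \<partial>lborel) = (\<integral>\<^sup>+g. (\<Prod>c\<in>Basis. ?f c (g \<bullet> c)) \<partial>lborel)"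
      by (intro nn_integral_cong)
         (simp add: prod_ennreal gauss_density_def prod.distrib b ennreal_mult[symmetric] prod_nonneg)
  qed
  also have "\<dots> = (\<Prod>c\<in>Basis. \<integral>\<^sup>+x. ?f c x \<partial>lborel)"
    by (subst nn_integral_lborel_prod) auto
  also have "\<dots> = 1"
  proof (intro prod.neutral ballI)
    fix c :: 'a
    show "(\<integral>\<^sup>+x. ?f c x \<partial>lborel) = 1"
      by (cases "c = b") (simp_all add: nn_integral_std_normal nn_integral_std_normal_sq)
  qed
  finally show ?thesis .
qed

text \<open>Markov inequality: the mean of the squared norm is at most \<open>p\<close>.\<close>

lemma gauss_diag_map_median:
  fixes w :: "'a::euclidean_space \<Rightarrow> real"
  assumes p: "(\<Sum>b\<in>Basis. (w b)\<^sup>2) \<le> p" "0 < p"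
  shows "ennreal (1/2) \<le> emeasure gauss {g. norm (diag_map w g) \<le> sqrt (2 * p)}"
proof -
  interpret G: prob_space "gauss :: 'a measure" by (rule prob_space_gauss)
  have 1: "(\<integral>\<^sup>+g. ennreal ((norm (diag_map w g))\<^sup>2) \<partial>gauss) \<le> ennreal p"
  proof -
    have "(\<integral>\<^sup>+g. ennreal ((norm (diag_map w g))\<^sup>2) \<partial>gauss)
        = (\<integral>\<^sup>+g. (\<Sum>b\<in>Basis. ennreal ((w b)\<^sup>2) * ennreal ((g \<bullet> b)\<^sup>2)) \<partial>gauss)"
      by (simp add: norm_diag_map_sq sum_ennreal[symmetric] ennreal_mult)
    also have "\<dots> = (\<Sum>b\<in>Basis. ennreal ((w b)\<^sup>2) * 1)"
      by (subst nn_integral_sum) (auto simp: nn_integral_cmult nn_integral_gauss_coord_sq)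
    also have "\<dots> \<le> ennreal p" using p by (simp add: ennreal_leI)
    finally show ?thesis .
  qed
  have "emeasure gauss {g. norm (diag_map w g) > sqrt (2 * p)}
      \<le> emeasure gauss {g. 1 \<le> ennreal (1 / (2*p)) * ennreal ((norm (diag_map w g))\<^sup>2)}"
  proof (rule emeasure_mono; (measurable)?)
    show "{g. sqrt (2 * p) < norm (diag_map w g)} \<subseteq> {g. 1 \<le> ennreal (1 / (2*p)) * ennreal ((norm (diag_map w g))\<^sup>2)}"
    proof safe
      fix g :: 'a assume "sqrt (2 * p) < norm (diag_map w g)"
      hence "2 * p \<le> (norm (diag_map w g))\<^sup>2"
        using p by (metis less_imp_le real_le_lsqrt real_less_rsqrt linorder_not_less norm_ge_zero)
      hence "1 \<le> 1 / (2*p) * (norm (diag_map w g))\<^sup>2" using p by (simp add: field_simps)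
      thus "1 \<le> ennreal (1 / (2*p)) * ennreal ((norm (diag_map w g))\<^sup>2)"
        using p by (simp add: ennreal_mult[symmetric])
    qed
  qed
  also have "\<dots> \<le> ennreal (1 / (2*p)) * (\<integral>\<^sup>+g. ennreal ((norm (diag_map w g))\<^sup>2) \<partial>gauss)"
    using nn_integral_Markov_inequality[of "\<lambda>g. ennreal ((norm (diag_map w g))\<^sup>2)" UNIV "gauss :: 'a measure" "ennreal (1/(2*p))"]
    by simp
  also have "\<dots> \<le> ennreal (1 / (2*p)) * ennreal p" by (intro mult_left_mono 1) auto
  also have "\<dots> = ennreal (1/2)" using p by (simp add: ennreal_mult[symmetric])
  finally have 2: "emeasure gauss {g. norm (diag_map w g) > sqrt (2 * p)} \<le> ennreal (1/2)" .
  have "measure gauss {g. norm (diag_map w g) \<le> sqrt (2 * p)}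
     = 1 - measure gauss {g. norm (diag_map w g) > sqrt (2 * p)}"
    using G.prob_compl[of "{g. norm (diag_map w g) > sqrt (2 * p)}"]
    by (simp add: Compl_eq_Diff_UNIV[symmetric] Collect_neg_eq[symmetric] not_less)
  moreover have "measure gauss {g. norm (diag_map w g) > sqrt (2 * p)} \<le> 1/2"
    using 2 unfolding G.emeasure_eq_measure by (subst (asm) ennreal_le_iff) auto
  ultimately show ?thesis unfolding G.emeasure_eq_measure by (intro ennreal_leI) linarith
qed

text \<open>The Laplace transform at \<open>x\<close> of a Gaussian vector, truncated so that its image under \<open>diag_map w\<close> stays in a ball, is still
exponentially large in \<open>|x|\<close>. Truncation matters because the Laplace transform of the data is only controlled for bounded
arguments; the radius \<open>m + \<rho>\<close> leaves room for a shift of length \<open>m\<close>.\<close>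

lemma truncated_gauss_mgf_lower:
  fixes x :: "'a::euclidean_space"
  assumes w: "\<And>b. b \<in> Basis \<Longrightarrow> \<bar>w b\<bar> \<le> 1"
    and med: "ennreal (1/2) \<le> emeasure gauss {g. norm (diag_map w g) \<le> \<rho>}"
    and m: "0 \<le> m"
  shows "ennreal (exp (t * m * norm x - m\<^sup>2 / 2) / 2)
    \<le> (\<integral>\<^sup>+g. ennreal (exp (t * (g \<bullet> x))) * indicator {g. norm (diag_map w g) \<le> m + \<rho>} g \<partial>gauss)"
proof -
  let ?I = "\<lambda>r. indicator {g. norm (diag_map w g) \<le> r} :: 'a \<Rightarrow> ennreal"
  \<comment> \<open>The Gaussian is recentred at a vector of length \<open>m\<close> in the direction of \<open>x\<close>.\<close>
  obtain a where a: "norm a = m" "a \<bullet> x = m * norm x"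
  proof (cases "x = 0")
    case True
    obtain b :: 'a where "b \<in> Basis" using nonempty_Basis by blast
    thus ?thesis using that[of "m *\<^sub>R b"] True m by simp
  next
    case False
    thus ?thesis using that[of "(m / norm x) *\<^sub>R x"] m by (simp add: power2_norm_eq_inner[symmetric] power2_eq_square)
  qed
  define y where "y = t *\<^sub>R x - a"
  \<comment> \<open>The remaining exponential is integrated over a symmetric set, where its average is at least 1 as \<open>cosh \<ge> 1\<close>.\<close>
  have sym: "ennreal (1/2) \<le> (\<integral>\<^sup>+h. ennreal (exp (h \<bullet> y)) * ?I \<rho> h \<partial>gauss)"
  proof -
    let ?J = "\<integral>\<^sup>+h. ennreal (exp (h \<bullet> y)) * ?I \<rho> h \<partial>gauss"
    have "?J = (\<integral>\<^sup>+h. ennreal (exp (- (h \<bullet> y))) * ?I \<rho> h \<partial>gauss)"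
      by (subst nn_integral_gauss_uminus[symmetric], measurable)
         (simp add: linear_neg[OF linear_diag_map] indicator_def)
    hence "?J + ?J = (\<integral>\<^sup>+h. ennreal (exp (h \<bullet> y)) * ?I \<rho> h + ennreal (exp (- (h \<bullet> y))) * ?I \<rho> h \<partial>gauss)"
      by (simp add: nn_integral_add)
    also have "\<dots> \<ge> (\<integral>\<^sup>+h. 2 * ?I \<rho> h \<partial>gauss)"
    proof (intro nn_integral_mono)
      fix h
      have "2 \<le> exp (h \<bullet> y) + exp (- (h \<bullet> y))"
        using exp_ge_add_one_self[of "h \<bullet> y"] exp_ge_add_one_self[of "- (h \<bullet> y)"] by linarith
      hence "2 \<le> ennreal (exp (h \<bullet> y)) + ennreal (exp (- (h \<bullet> y)))"
        by (metis ennreal_leI ennreal_numeral ennreal_plus exp_ge_zero zero_le_numeral)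
      thus "2 * ?I \<rho> h \<le> ennreal (exp (h \<bullet> y)) * ?I \<rho> h + ennreal (exp (- (h \<bullet> y))) * ?I \<rho> h"
        by (simp add: distrib_right[symmetric] mult_right_mono)
    qed
    also have "(\<integral>\<^sup>+h. 2 * ?I \<rho> h \<partial>gauss) = 2 * emeasure gauss {g. norm (diag_map w g) \<le> \<rho>}"
      by (subst nn_integral_cmult) auto
    finally have "2 * emeasure gauss {g. norm (diag_map w g) \<le> \<rho>} \<le> 2 * ?J" by (simp add: mult_2)
    hence "emeasure gauss {g. norm (diag_map w g) \<le> \<rho>} \<le> ?J"
      by (subst (asm) ennreal_mult_le_mult_iff) auto
    thus ?thesis using med by (rule order_trans[rotated])
  qed
  have "ennreal (exp (t * m * norm x - m\<^sup>2 / 2) / 2) = ennreal (exp (t * m * norm x - m\<^sup>2 / 2)) * ennreal (1/2)"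
    by (subst ennreal_mult[symmetric]) auto
  also have "\<dots> \<le> ennreal (exp (t * m * norm x - m\<^sup>2 / 2)) * (\<integral>\<^sup>+h. ennreal (exp (h \<bullet> y)) * ?I \<rho> h \<partial>gauss)"
    by (intro mult_left_mono sym) auto
  also have "\<dots> = (\<integral>\<^sup>+h. ennreal (exp (t * m * norm x - m\<^sup>2 / 2)) * (ennreal (exp (h \<bullet> y)) * ?I \<rho> h) \<partial>gauss)"
    by (subst nn_integral_cmult) auto
  also have "\<dots> \<le> (\<integral>\<^sup>+h. (ennreal (exp (t * ((a + h) \<bullet> x))) * ?I (m + \<rho>) (a + h)) * ennreal (exp (- (a \<bullet> h) - (norm a)\<^sup>2 / 2)) \<partial>gauss)"
  proof (intro nn_integral_mono)
    fix h
    have "norm (diag_map w a) \<le> m" unfolding a(1)[symmetric] by (rule norm_diag_map_le[OF w])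
    hence "norm (diag_map w (a + h)) \<le> m + norm (diag_map w h)"
      using norm_triangle_ineq[of "diag_map w a" "diag_map w h"] 
      by (simp add: linear_add[OF linear_diag_map])
    hence I: "?I \<rho> h \<le> ?I (m + \<rho>) (a + h)" by (auto simp: indicator_def)
    have "exp (t * m * norm x - m\<^sup>2 / 2) * exp (h \<bullet> y) = exp (t * ((a + h) \<bullet> x)) * exp (- (a \<bullet> h) - (norm a)\<^sup>2 / 2)"
      using a by (simp add: exp_add[symmetric] y_def inner_add_left inner_diff_right inner_commute algebra_simps)
    hence "ennreal (exp (t * m * norm x - m\<^sup>2 / 2)) * ennreal (exp (h \<bullet> y))
        = ennreal (exp (t * ((a + h) \<bullet> x))) * ennreal (exp (- (a \<bullet> h) - (norm a)\<^sup>2 / 2))"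
      by (simp add: ennreal_mult[symmetric])
    hence "ennreal (exp (t * m * norm x - m\<^sup>2 / 2)) * (ennreal (exp (h \<bullet> y)) * ?I \<rho> h)
        = ennreal (exp (t * ((a + h) \<bullet> x))) * ennreal (exp (- (a \<bullet> h) - (norm a)\<^sup>2 / 2)) * ?I \<rho> h"
      by (simp only: mult.assoc[symmetric])
    also have "\<dots> \<le> ennreal (exp (t * ((a + h) \<bullet> x))) * ennreal (exp (- (a \<bullet> h) - (norm a)\<^sup>2 / 2)) * ?I (m + \<rho>) (a + h)"
      by (intro mult_left_mono I) auto
    finally show "ennreal (exp (t * m * norm x - m\<^sup>2 / 2)) * (ennreal (exp (h \<bullet> y)) * ?I \<rho> h)
       \<le> (ennreal (exp (t * ((a + h) \<bullet> x))) * ?I (m + \<rho>) (a + h)) * ennreal (exp (- (a \<bullet> h) - (norm a)\<^sup>2 / 2))"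
      by (simp only: ac_simps)
  qed
  also have "\<dots> = (\<integral>\<^sup>+g. ennreal (exp (t * (g \<bullet> x))) * ?I (m + \<rho>) g \<partial>gauss)"
    by (rule nn_integral_gauss_shift[symmetric]) measurable
  finally show ?thesis .
qed

text \<open>Averaging \<open>exp (t g \<bullet> x)\<close> with \<open>x = diag_map w \<nu>\<close> over the truncated Gaussian \<open>g\<close> turns the bound on the Laplace transform of
\<open>\<nu>\<close> in every single direction into an exponential moment of \<open>|x|\<close>, with no union bound over directions: the dimension enters only through
the Hilbert-Schmidt norm of the weights. The free parameter \<open>m\<close> is the length of the shift.\<close>

lemma diag_map_tail_bound:
  fixes \<nu> :: "'w \<Rightarrow> 'a::euclidean_space"
  assumes "prob_space M" and [measurable]: "\<nu> \<in> borel_measurable M"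
    and w: "\<And>b. b \<in> Basis \<Longrightarrow> \<bar>w b\<bar> \<le> 1"
    and p: "(\<Sum>b\<in>Basis. (w b)\<^sup>2) \<le> p" "0 < p"
    and pos: "0 < \<tau>" "0 < N" "0 < \<delta>" "\<delta> < 1" "0 < m"
    and mgf: "\<And>u. \<tau> * norm u \<le> N \<Longrightarrow>
        (\<integral>\<^sup>+\<omega>. ennreal (exp (u \<bullet> \<nu> \<omega>)) \<partial>M) \<le> ennreal (exp (\<tau>\<^sup>2 * (norm u)\<^sup>2 / N))"
    and N: "ln (2 / \<delta>) + m\<^sup>2 / 2 \<le> N"
  shows "measure M {\<omega>\<in>space M. norm (diag_map w (\<nu> \<omega>)) >
      2 * \<tau> * (1 + sqrt (2 * p) / m) * sqrt ((ln (2 / \<delta>) + m\<^sup>2 / 2) / N)} \<le> \<delta>"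
proof -
  interpret M: prob_space M by fact
  interpret G: prob_space "gauss :: 'a measure" by (rule prob_space_gauss)
  interpret MG: pair_sigma_finite "gauss :: 'a measure" M ..
  define a where "a = ln (2 / \<delta>) + m\<^sup>2 / 2"
  define R where "R = m + sqrt (2 * p)"
  \<comment> \<open>\<open>t\<close> balances \<open>a / (t m)\<close> against \<open>\<tau>\<^sup>2 t R\<^sup>2 / (N m)\<close>; \<open>a \<le> N\<close> is what keeps \<open>\<tau> t R\<close> below \<open>N\<close>.\<close>
  define t where "t = sqrt (N * a) / (\<tau> * R)"
  define B where "B = 2 * \<tau> * (1 + sqrt (2 * p) / m) * sqrt (a / N)"
  have K: "ln (2 / \<delta>) > 0" using pos by (intro ln_gt_zero) (auto simp: field_simps)
  have a: "0 < a" "a \<le> N" using K pos N by (auto simp: a_def intro!: add_pos_pos)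
  have R: "0 < R" using pos p by (auto simp: R_def intro!: add_pos_nonneg)
  have t: "0 < t" using a R pos by (auto simp: t_def)
  have tR: "\<tau> * (t * R) = sqrt (N * a)" using pos R by (simp add: t_def)
  have tB: "t * m * B = 2 * a"
  proof -
    have "t * m * B = 2 * (sqrt (N * a) * sqrt (a / N)) * (m * (1 + sqrt (2 * p) / m) / R)"
      using pos R by (simp add: t_def B_def)
    also have "m * (1 + sqrt (2 * p) / m) = R" using pos by (simp add: R_def distrib_left)
    also have "R / R = 1" using R by simp
    also have "sqrt (N * a) * sqrt (a / N) = sqrt (a\<^sup>2)"
      using pos by (simp add: real_sqrt_mult[symmetric] power2_eq_square)
    finally show ?thesis using a by simp
  qed
  let ?I = "indicator {g. norm (diag_map w g) \<le> R} :: 'a \<Rightarrow> ennreal"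
  let ?x = "\<lambda>\<omega>. diag_map w (\<nu> \<omega>)"
  let ?f = "\<lambda>\<omega>. ennreal (exp (t * m * norm (?x \<omega>) - m\<^sup>2 / 2) / 2)"
  have lower: "?f \<omega>
      \<le> (\<integral>\<^sup>+g. ennreal (exp (t * (g \<bullet> ?x \<omega>))) * ?I g \<partial>gauss)" for \<omega>
    unfolding R_def using pos
    by (intro truncated_gauss_mgf_lower gauss_diag_map_median w p) auto
  have "(\<integral>\<^sup>+\<omega>. ?f \<omega> \<partial>M)
      \<le> (\<integral>\<^sup>+\<omega>. (\<integral>\<^sup>+g. ennreal (exp (t * (g \<bullet> ?x \<omega>))) * ?I g \<partial>gauss) \<partial>M)"
    by (intro nn_integral_mono lower)
  also have "\<dots> = (\<integral>\<^sup>+g. (\<integral>\<^sup>+\<omega>. ennreal (exp (t * (g \<bullet> ?x \<omega>))) * ?I g \<partial>M) \<partial>gauss)"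
    by (rule MG.Fubini') measurable
  also have "\<dots> \<le> (\<integral>\<^sup>+g. ennreal (exp a) \<partial>(gauss :: 'a measure))"
  proof (intro nn_integral_mono)
    fix g :: 'a
    show "(\<integral>\<^sup>+\<omega>. ennreal (exp (t * (g \<bullet> ?x \<omega>))) * ?I g \<partial>M) \<le> ennreal (exp a)"
    proof (cases "norm (diag_map w g) \<le> R")
      case True
      let ?u = "t *\<^sub>R diag_map w g"
      have le: "\<tau> * norm ?u \<le> sqrt (N * a)"
        unfolding tR[symmetric] using True t pos by (simp add: mult_left_mono)
      also have "sqrt (N * a) \<le> N"
        by (rule real_le_lsqrt) (use a pos in \<open>auto simp: power2_eq_square\<close>)
      finally have "\<tau> * norm ?u \<le> N" .
      note mgf[OF this]
      also have "\<tau>\<^sup>2 * (norm ?u)\<^sup>2 / N \<le> a"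
      proof -
        have "(\<tau> * norm ?u)\<^sup>2 \<le> (sqrt (N * a))\<^sup>2" using le pos by (intro power_mono) auto
        thus ?thesis using a pos by (simp add: power_mult_distrib field_simps)
      qed
      finally have "(\<integral>\<^sup>+\<omega>. ennreal (exp (?u \<bullet> \<nu> \<omega>)) \<partial>M) \<le> ennreal (exp a)"
        by (simp add: ennreal_leI)
      thus ?thesis using True by (simp add: diag_map_inner)
    qed simp
  qed
  also have "\<dots> = ennreal (exp a)" using G.emeasure_space_1 by simp
  finally have E: "(\<integral>\<^sup>+\<omega>. ?f \<omega> \<partial>M) \<le> ennreal (exp a)" .
  let ?c = "\<delta> / exp a"
  have "emeasure M {\<omega>\<in>space M. norm (?x \<omega>) > B}
      \<le> emeasure M {\<omega>\<in>space M. 1 \<le> ennreal ?c * ?f \<omega>}"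
  proof (rule emeasure_mono; (measurable)?)
    show "{\<omega>\<in>space M. norm (?x \<omega>) > B}
        \<subseteq> {\<omega>\<in>space M. 1 \<le> ennreal ?c * ?f \<omega>}"
    proof safe
      fix \<omega> assume "norm (?x \<omega>) > B"
      hence "t * m * B \<le> t * m * norm (?x \<omega>)" using t pos by (intro mult_left_mono) auto
      hence "a + ln (2 / \<delta>) \<le> t * m * norm (?x \<omega>) - m\<^sup>2 / 2" using tB by (simp add: a_def)
      hence "exp (a + ln (2 / \<delta>)) \<le> exp (t * m * norm (?x \<omega>) - m\<^sup>2 / 2)" by simp
      hence "exp a * (2 / \<delta>) \<le> exp (t * m * norm (?x \<omega>) - m\<^sup>2 / 2)" using pos by (simp add: exp_add)
      hence "1 \<le> ?c * (exp (t * m * norm (?x \<omega>) - m\<^sup>2 / 2) / 2)" using pos by (simp add: field_simps)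
      thus "1 \<le> ennreal ?c * ?f \<omega>"
        using pos by (simp add: ennreal_mult[symmetric])
    qed
  qed
  also have "\<dots> \<le> ennreal ?c * (\<integral>\<^sup>+\<omega>. ?f \<omega> \<partial>M)"
    using nn_integral_Markov_inequality[of ?f "space M" M "ennreal ?c"]
    by (simp add: Collect_conj_eq[symmetric] nn_integral_cong[of M "\<lambda>\<omega>. _ \<omega> * indicator (space M) \<omega>"] cong: nn_integral_cong)
  also have "\<dots> \<le> ennreal ?c * ennreal (exp a)" by (intro mult_left_mono E) auto
  also have "\<dots> = ennreal \<delta>" using pos by (simp add: ennreal_mult[symmetric])
  finally show ?thesis
    using pos unfolding M.emeasure_eq_measure B_def a_def by (simp add: ennreal_le_iff)
qed

text \<open>The constant 4 is the best that the optimal choice of \<open>m\<close> gives: with \<open>y\<^sup>2 = m\<^sup>2 / 2\<close>, the minimum over \<open>y\<close> of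
\<open>2 (1 + sqrt p / y) sqrt (K + y\<^sup>2)\<close> equals \<open>4 sqrt (p + K)\<close> when \<open>p = K\<close>, and is smaller otherwise.\<close>

lemma diag_map_deviation:
  fixes \<nu> :: "'w \<Rightarrow> 'a::euclidean_space"
  assumes M: "prob_space M" and meas: "\<nu> \<in> borel_measurable M"
    and w: "\<And>b. b \<in> Basis \<Longrightarrow> \<bar>w b\<bar> \<le> 1"
    and p: "(\<Sum>b\<in>Basis. (w b)\<^sup>2) \<le> p" "0 < p"
    and pos: "0 < \<tau>" "0 < N" "0 < \<delta>" "\<delta> < 1"
    and mgf: "\<And>u. \<tau> * norm u \<le> N \<Longrightarrow>
        (\<integral>\<^sup>+\<omega>. ennreal (exp (u \<bullet> \<nu> \<omega>)) \<partial>M) \<le> ennreal (exp (\<tau>\<^sup>2 * (norm u)\<^sup>2 / N))"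
    and N: "p \<le> 4 * N" "4096 * ln (2 / \<delta>) \<le> N"
  shows "measure M {\<omega>\<in>space M. norm (diag_map w (\<nu> \<omega>)) >
      4 * \<tau> * sqrt ((p + ln (2 / \<delta>)) / N)} \<le> \<delta>"
proof -
  interpret M: prob_space M by fact
  define K where "K = ln (2 / \<delta>)"
  have K: "K > 0" unfolding K_def using pos by (intro ln_gt_zero) (auto simp: field_simps)
  have main: ?thesis
    if m: "0 < m" and mN: "K + m\<^sup>2 / 2 \<le> N"
      and le: "(1 + sqrt (2 * p) / m) * sqrt (K + m\<^sup>2 / 2) \<le> 2 * sqrt (p + K)" for m
  proof -
    have "2 * \<tau> * (1 + sqrt (2 * p) / m) * sqrt ((K + m\<^sup>2 / 2) / N)
        = 2 * \<tau> * ((1 + sqrt (2 * p) / m) * sqrt (K + m\<^sup>2 / 2)) / sqrt N"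
      by (simp add: real_sqrt_divide)
    also have "\<dots> \<le> 2 * \<tau> * (2 * sqrt (p + K)) / sqrt N"
      using pos by (intro divide_right_mono mult_left_mono le) auto
    also have "\<dots> = 4 * \<tau> * sqrt ((p + K) / N)" by (simp add: real_sqrt_divide)
    finally have le': "2 * \<tau> * (1 + sqrt (2 * p) / m) * sqrt ((K + m\<^sup>2 / 2) / N) \<le> 4 * \<tau> * sqrt ((p + K) / N)" .
    note [measurable] = meas
    have "measure M {\<omega>\<in>space M. norm (diag_map w (\<nu> \<omega>)) > 4 * \<tau> * sqrt ((p + K) / N)}
       \<le> measure M {\<omega>\<in>space M. norm (diag_map w (\<nu> \<omega>)) > 2 * \<tau> * (1 + sqrt (2 * p) / m) * sqrt ((K + m\<^sup>2 / 2) / N)}"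
      by (rule M.finite_measure_mono) (use le' in auto)
    also have "\<dots> \<le> \<delta>"
      using diag_map_tail_bound[where \<nu>=\<nu> and w=w and p=p and \<tau>=\<tau> and N=N and \<delta>=\<delta> and m=m, OF M meas w p pos m mgf] mN
      unfolding K_def by simp
    finally show ?thesis unfolding K_def .
  qed
  show ?thesis
  proof (cases "(3 * K + p) / 2 \<le> N")
    \<comment> \<open>Here \<open>m\<^sup>2 = p + K\<close>; the worst case of the resulting inequality is \<open>p = K\<close>, where it is an equality.\<close>
    case True
    define A where "A = sqrt (p + K)"
    define B where "B = sqrt (2 * p)"
    have A: "0 < A" "0 \<le> B" using K p by (auto simp: A_def B_def)
    have A2: "A\<^sup>2 = p + K" "B\<^sup>2 = 2 * p" using K p by (auto simp: A_def B_def)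
    show ?thesis
    proof (rule main[OF A(1)])
      show "K + A\<^sup>2 / 2 \<le> N" using True A2 by (simp add: field_simps)
      have KA: "K + A\<^sup>2 / 2 = (3 * A\<^sup>2 - B\<^sup>2) / 2" using A2 by simp
      have "8 * A^4 - (A + B)\<^sup>2 * (3 * A\<^sup>2 - B\<^sup>2) = (A - B)\<^sup>2 * (5 * A\<^sup>2 + 4 * A * B + B\<^sup>2)"
        by (simp add: power2_eq_square power4_eq_xxxx algebra_simps)
      also have "\<dots> \<ge> 0" using A by (intro mult_nonneg_nonneg add_nonneg_nonneg) auto
      finally have q: "(A + B)\<^sup>2 * (K + A\<^sup>2 / 2) \<le> (2 * A\<^sup>2)\<^sup>2"
        unfolding KA by (simp add: power_mult_distrib)
      have "(A + B) * sqrt (K + A\<^sup>2 / 2) \<le> 2 * A\<^sup>2"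
      proof (rule power2_le_imp_le)
        show "((A + B) * sqrt (K + A\<^sup>2 / 2))\<^sup>2 \<le> (2 * A\<^sup>2)\<^sup>2"
          using q K by (simp add: power_mult_distrib add_nonneg_nonneg)
      qed simp
      hence "(A + B) * sqrt (K + A\<^sup>2 / 2) / A \<le> 2 * A"
        using A by (simp add: field_simps power2_eq_square)
      thus "(1 + sqrt (2 * p) / A) * sqrt (K + A\<^sup>2 / 2) \<le> 2 * sqrt (p + K)"
        using A unfolding A_def[symmetric] B_def[symmetric] by (simp add: field_simps)
    qed
  next
    \<comment> \<open>Now \<open>p\<close> dwarfs \<open>K\<close>, and the smaller shift \<open>m\<^sup>2 = p / 4\<close> keeps \<open>K + m\<^sup>2 / 2\<close> below \<open>N\<close>.\<close>
    case False
    hence pK: "8189 * K \<le> p" using N unfolding K_def by (simp add: field_simps)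
    show ?thesis
    proof (rule main[of "sqrt (p / 4)"])
      show "0 < sqrt (p / 4)" using p by simp
      show "K + (sqrt (p / 4))\<^sup>2 / 2 \<le> N" using p N pK K by (simp add: K_def)
      have "sqrt (2 * p) / sqrt (p / 4) = sqrt 8" using p by (simp add: real_sqrt_divide[symmetric])
      moreover have "sqrt 8 \<le> 2.83" by (rule real_le_lsqrt) (auto simp: power2_eq_square)
      moreover have "sqrt (K + (sqrt (p / 4))\<^sup>2 / 2) \<le> 0.36 * sqrt (p + K)"
      proof (rule real_le_lsqrt)
        show "K + (sqrt (p / 4))\<^sup>2 / 2 \<le> (0.36 * sqrt (p + K))\<^sup>2"
          using p K pK by (simp add: power_mult_distrib power2_eq_square)
      qed (use p K in auto)
      ultimately have "(1 + sqrt (2 * p) / sqrt (p / 4)) * sqrt (K + (sqrt (p / 4))\<^sup>2 / 2) \<le> (1 + 2.83) * (0.36 * sqrt (p + K))"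
        using K p by (intro mult_mono) auto
      also have "\<dots> \<le> 2 * sqrt (p + K)" using p K by simp
      finally show "(1 + sqrt (2 * p) / sqrt (p / 4)) * sqrt (K + (sqrt (p / 4))\<^sup>2 / 2) \<le> 2 * sqrt (p + K)" .
    qed
  qed
qed

text \<open>An Orlicz norm is an infimum that need not be usable at the infimum itself; hence the hypothesis for all
\<open>s > \<tau>\<close>. This form also covers \<open>\<tau> = 0\<close>.\<close>

lemma diag_map_deviation_limit:
  fixes \<nu> :: "'w \<Rightarrow> 'a::euclidean_space"
  assumes M: "prob_space M" and meas[measurable]: "\<nu> \<in> borel_measurable M"
    and w: "\<And>b. b \<in> Basis \<Longrightarrow> \<bar>w b\<bar> \<le> 1"
    and p: "(\<Sum>b\<in>Basis. (w b)\<^sup>2) \<le> p" "0 < p"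
    and pos: "0 \<le> \<tau>" "0 < N" "0 < \<delta>" "\<delta> < 1"
    and mgf: "\<And>u s. \<tau> < s \<Longrightarrow> s * norm u \<le> N \<Longrightarrow>
        (\<integral>\<^sup>+\<omega>. ennreal (exp (u \<bullet> \<nu> \<omega>)) \<partial>M) \<le> ennreal (exp (s\<^sup>2 * (norm u)\<^sup>2 / N))"
    and N: "p \<le> 4 * N" "4096 * ln (2 / \<delta>) \<le> N"
  shows "measure M {\<omega>\<in>space M. norm (diag_map w (\<nu> \<omega>)) >
      4 * \<tau> * sqrt ((p + ln (2 / \<delta>)) / N)} \<le> \<delta>"
proof -
  interpret M: prob_space M by fact
  define q where "q = sqrt ((p + ln (2 / \<delta>)) / N)"
  define S where "S j = {\<omega>\<in>space M. norm (diag_map w (\<nu> \<omega>)) > 4 * (\<tau> + inverse (real (Suc j))) * q}" for j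
  have "ln (2 / \<delta>) > 0" using pos by (intro ln_gt_zero) (auto simp: field_simps)
  hence q: "q > 0" unfolding q_def using p pos by (intro real_sqrt_gt_zero divide_pos_pos add_pos_pos)
  have S: "S j \<in> sets M" for j unfolding S_def by measurable
  have "measure M (S j) \<le> \<delta>" for j
    unfolding S_def q_def using pos
    by (intro diag_map_deviation M meas w p mgf N) (auto intro: add_nonneg_pos)
  moreover have "incseq S"
  proof (rule incseq_SucI, unfold S_def, safe)
    fix j \<omega> assume *: "4 * (\<tau> + inverse (real (Suc j))) * q < norm (diag_map w (\<nu> \<omega>))"
    have "4 * (\<tau> + inverse (real (Suc (Suc j)))) * q \<le> 4 * (\<tau> + inverse (real (Suc j))) * q"
      using q by (intro mult_right_mono mult_left_mono add_left_mono le_imp_inverse_le) auto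
    with * show "4 * (\<tau> + inverse (real (Suc (Suc j)))) * q < norm (diag_map w (\<nu> \<omega>))" by linarith
  qed
  hence "(\<lambda>j. measure M (S j)) \<longlonglongrightarrow> measure M (\<Union>j. S j)"
    using S by (intro M.finite_Lim_measure_incseq) auto
  ultimately have "measure M (\<Union>j. S j) \<le> \<delta>" by (intro LIMSEQ_le_const2) auto
  moreover have "{\<omega>\<in>space M. norm (diag_map w (\<nu> \<omega>)) > 4 * \<tau> * q} \<subseteq> (\<Union>j. S j)"
  proof safe
    fix \<omega> assume \<omega>: "\<omega> \<in> space M" "4 * \<tau> * q < norm (diag_map w (\<nu> \<omega>))"
    have "(\<lambda>j. 4 * (\<tau> + inverse (real (Suc j))) * q) \<longlonglongrightarrow> 4 * (\<tau> + 0) * q"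
      by (intro tendsto_intros LIMSEQ_inverse_real_of_nat)
    hence "\<forall>\<^sub>F j in sequentially. 4 * (\<tau> + inverse (real (Suc j))) * q < norm (diag_map w (\<nu> \<omega>))"
      using \<omega> by (intro order_tendstoD) auto
    then obtain j where "4 * (\<tau> + inverse (real (Suc j))) * q < norm (diag_map w (\<nu> \<omega>))"
      by (auto simp: eventually_sequentially)
    thus "\<omega> \<in> (\<Union>j. S j)" using \<omega> by (auto simp: S_def)
  qed
  ultimately show ?thesis unfolding q_def
    using S by (meson M.finite_measure_mono order_trans sets.countable_UN' sets.countable_UN subsetI image_subset_iff)
qed

text \<open>The same bound for vectors over an arbitrary finite index type, so that matrices can be treated as vectors
indexed by pairs.\<close>

lemma coordinate_deviation:
  fixes \<nu> :: "'w \<Rightarrow> real^'i" and f :: "'i \<Rightarrow> real"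
  assumes M: "prob_space M" and meas: "\<nu> \<in> borel_measurable M"
    and f: "\<And>i. \<bar>f i\<bar> \<le> 1" and p: "(\<Sum>i\<in>UNIV. (f i)\<^sup>2) \<le> p" "0 < p"
    and pos: "0 \<le> \<tau>" "0 < N" "0 < \<delta>" "\<delta> < 1"
    and mgf: "\<And>u s. \<tau> < s \<Longrightarrow> s * norm u \<le> N \<Longrightarrow>
        (\<integral>\<^sup>+\<omega>. ennreal (exp (u \<bullet> \<nu> \<omega>)) \<partial>M) \<le> ennreal (exp (s\<^sup>2 * (norm u)\<^sup>2 / N))"
    and N: "p \<le> 4 * N" "4096 * ln (2 / \<delta>) \<le> N"
  shows "{\<omega>\<in>space M. sqrt (\<Sum>i\<in>UNIV. (f i * \<nu> \<omega> $ i)\<^sup>2) > 4 * \<tau> * sqrt ((p + ln (2 / \<delta>)) / N)} \<in> sets M"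
    and "measure M {\<omega>\<in>space M. sqrt (\<Sum>i\<in>UNIV. (f i * \<nu> \<omega> $ i)\<^sup>2) > 4 * \<tau> * sqrt ((p + ln (2 / \<delta>)) / N)} \<le> \<delta>"
proof -
  define w where "w b = b \<bullet> (\<chi> i. f i)" for b :: "real^'i"
  have wax: "w (axis i 1) = f i" for i by (simp add: w_def inner_axis')
  have Bas: "(Basis :: (real^'i) set) = range (\<lambda>i. axis i 1)" by (auto simp: Basis_vec_def)
  have inj: "inj (\<lambda>i. axis i (1::real) :: real^'i)" by (auto simp: inj_on_def axis_eq_axis)
  have dm: "norm (diag_map w x) = sqrt (\<Sum>i\<in>UNIV. (f i * x $ i)\<^sup>2)" for x
  proof -
    have "(norm (diag_map w x))\<^sup>2 = (\<Sum>i\<in>UNIV. (f i * x $ i)\<^sup>2)"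
      unfolding norm_diag_map_sq Bas by (simp add: sum.reindex[OF inj] wax inner_axis power_mult_distrib)
    thus ?thesis by (metis norm_ge_zero real_sqrt_unique)
  qed
  note [measurable] = meas
  have "{\<omega>\<in>space M. norm (diag_map w (\<nu> \<omega>)) > 4 * \<tau> * sqrt ((p + ln (2 / \<delta>)) / N)} \<in> sets M"
    by measurable
  thus "{\<omega>\<in>space M. sqrt (\<Sum>i\<in>UNIV. (f i * \<nu> \<omega> $ i)\<^sup>2) > 4 * \<tau> * sqrt ((p + ln (2 / \<delta>)) / N)} \<in> sets M" unfolding dm .
  have "measure M {\<omega>\<in>space M. norm (diag_map w (\<nu> \<omega>)) > 4 * \<tau> * sqrt ((p + ln (2 / \<delta>)) / N)} \<le> \<delta>"
  proof (rule diag_map_deviation_limit[OF M meas _ _ p(2) pos mgf N])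
    show "\<bar>w b\<bar> \<le> 1" if "b \<in> Basis" for b using that f by (auto simp: Bas wax)
    show "(\<Sum>b\<in>Basis. (w b)\<^sup>2) \<le> p" unfolding Bas using p by (simp add: sum.reindex[OF inj] wax)
  qed
  thus "measure M {\<omega>\<in>space M. sqrt (\<Sum>i\<in>UNIV. (f i * \<nu> \<omega> $ i)\<^sup>2) > 4 * \<tau> * sqrt ((p + ln (2 / \<delta>)) / N)} \<le> \<delta>" unfolding dm .
qed

section \<open>Laplace transforms of the noise and of the covariance error\<close>

text \<open>The power \<open>(c z)^k\<close> in the exponential series is at most \<open>c\<^sup>2 z^k\<close> once \<open>k \<ge> 2\<close>. The proof compares derivatives, where the claim is the convexity of the exponential function.\<close>

lemma exp_remainder_scaling:
  fixes c z :: real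
  assumes "0 \<le> c" "c \<le> 1" "0 \<le> z"
  shows "exp (c * z) - 1 - c * z \<le> c\<^sup>2 * (exp z - 1 - z)"
proof -
  let ?g = "\<lambda>z. c\<^sup>2 * (exp z - 1 - z) - (exp (c * z) - 1 - c * z)"
  have "?g 0 \<le> ?g z"
  proof (rule DERIV_nonneg_imp_nondecreasing[OF assms(3)])
    fix y :: real assume y: "0 \<le> y" "y \<le> z"
    have "exp (c * y + (1 - c) * 0) \<le> c * exp y + (1 - c) * exp 0"
      using convex_onD[OF exp_convex, of "1 - c" y 0] assms by (simp add: add.commute)
    hence "c * (exp (c * y) - 1) \<le> c * (c * (exp y - 1))"
      using assms by (intro mult_left_mono) (auto simp: algebra_simps)
    moreover have "(?g has_real_derivative (c\<^sup>2 * (exp y - 1) - (exp (c * y) * c - c))) (at y)"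
      by (auto intro!: derivative_eq_intros)
    ultimately show "\<exists>d. (?g has_real_derivative d) (at y) \<and> 0 \<le> d"
      by (intro exI[of _ "c\<^sup>2 * (exp y - 1) - (exp (c * y) * c - c)"]) (auto simp: power2_eq_square algebra_simps)
  qed
  thus ?thesis by simp
qed

lemma exp_le_abs_remainder: "exp (y::real) \<le> 1 + y + (exp \<bar>y\<bar> - 1 - \<bar>y\<bar>)"
proof (cases "0 \<le> y")
  case False
  let ?f = "\<lambda>a::real. exp a - exp (- a) - 2 * a"
  have "?f 0 \<le> ?f (- y)"
  proof (rule DERIV_nonneg_imp_nondecreasing[where f="?f"])
    fix a :: real
    have "2 \<le> exp a + exp (- a)"
      using exp_ge_add_one_self[of a] exp_ge_add_one_self[of "- a"] by linarith
    moreover have "(?f has_real_derivative (exp a + exp (- a) - 2)) (at a)"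
      by (auto intro!: derivative_eq_intros)
    ultimately show "\<exists>d. (?f has_real_derivative d) (at a) \<and> 0 \<le> d"
      by (intro exI[of _ "exp a + exp (- a) - 2"]) auto
  qed (use False in simp)
  thus ?thesis using False by simp
qed simp

text \<open>Centring removes the linear term of the exponential, and scaling the remainder compares it with the defining moment
of the Orlicz norm; this gives the constant 1 in the exponent.\<close>

lemma centred_psi1_mgf:
  assumes "prob_space M" and int: "integrable M \<eta>" and mean: "(\<integral>\<omega>. \<eta> \<omega> \<partial>M) = 0"
    and t: "0 < t" "(\<integral>\<^sup>+\<omega>. ennreal (exp (\<bar>\<eta> \<omega>\<bar> / t)) \<partial>M) \<le> 2" and s: "\<bar>s\<bar> * t \<le> 1"
  shows "(\<integral>\<^sup>+\<omega>. ennreal (exp (s * \<eta> \<omega>)) \<partial>M) \<le> ennreal (exp ((s * t)\<^sup>2))"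
proof -
  interpret prob_space M by fact
  have [measurable]: "\<eta> \<in> borel_measurable M" using int by auto
  let ?e = "\<lambda>\<omega>. exp (\<bar>\<eta> \<omega>\<bar> / t)"
  have inte: "integrable M ?e"
    by (rule integrableI_nonneg) (use t(2) in \<open>auto intro: order_le_less_trans[of _ 2]\<close>)
  have e2: "(\<integral>\<omega>. ?e \<omega> \<partial>M) \<le> 2"
  proof -
    have "ennreal (\<integral>\<omega>. ?e \<omega> \<partial>M) \<le> ennreal 2"
      using t(2) by (subst nn_integral_eq_integral[symmetric]) (use inte in auto)
    thus ?thesis by (subst (asm) ennreal_le_iff) auto
  qed
  let ?h = "\<lambda>\<omega>. 1 + s * \<eta> \<omega> + (s * t)\<^sup>2 * (?e \<omega> - 1)"
  have le: "exp (s * \<eta> \<omega>) \<le> ?h \<omega>" for \<omega>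
  proof -
    have "exp (s * \<eta> \<omega>) \<le> 1 + s * \<eta> \<omega> + (exp \<bar>s * \<eta> \<omega>\<bar> - 1 - \<bar>s * \<eta> \<omega>\<bar>)" by (rule exp_le_abs_remainder)
    also have "\<bar>s * \<eta> \<omega>\<bar> = (\<bar>s\<bar> * t) * (\<bar>\<eta> \<omega>\<bar> / t)" using t by (simp add: abs_mult)
    also have "exp ((\<bar>s\<bar> * t) * (\<bar>\<eta> \<omega>\<bar> / t)) - 1 - (\<bar>s\<bar> * t) * (\<bar>\<eta> \<omega>\<bar> / t) \<le> (\<bar>s\<bar> * t)\<^sup>2 * (?e \<omega> - 1 - \<bar>\<eta> \<omega>\<bar> / t)"
      using s t by (intro exp_remainder_scaling) auto
    also have "(\<bar>s\<bar> * t)\<^sup>2 * (?e \<omega> - 1 - \<bar>\<eta> \<omega>\<bar> / t) \<le> (s * t)\<^sup>2 * (?e \<omega> - 1)"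
    proof (rule mult_mono)
      show "0 \<le> ?e \<omega> - 1 - \<bar>\<eta> \<omega>\<bar> / t" using exp_ge_add_one_self[of "\<bar>\<eta> \<omega>\<bar> / t"] by linarith
    qed (use t in \<open>auto simp: power_mult_distrib\<close>)
    finally show ?thesis by simp
  qed
  have inth: "integrable M ?h" using int inte by auto
  have "(\<integral>\<^sup>+\<omega>. ennreal (exp (s * \<eta> \<omega>)) \<partial>M) \<le> (\<integral>\<^sup>+\<omega>. ennreal (?h \<omega>) \<partial>M)"
    by (intro nn_integral_mono ennreal_leI le)
  also have "\<dots> = ennreal (\<integral>\<omega>. ?h \<omega> \<partial>M)"
    by (intro nn_integral_eq_integral inth AE_I2 order_trans[OF exp_ge_zero le])
  also have "(\<integral>\<omega>. ?h \<omega> \<partial>M) = 1 + (s * t)\<^sup>2 * ((\<integral>\<omega>. ?e \<omega> \<partial>M) - 1)"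
    using int inte mean by (simp add: prob_space)
  also have "\<dots> \<le> 1 + (s * t)\<^sup>2" using e2 by (intro add_left_mono mult_left_le) auto
  also have "\<dots> \<le> exp ((s * t)\<^sup>2)" by (rule exp_ge_add_one_self)
  finally show ?thesis by (simp add: ennreal_leI)
qed

lemma psi1_norm_bound:
  assumes "psi1_norm M \<xi> \<le> ennreal \<sigma>" "\<sigma> < t" "0 \<le> \<sigma>"
  shows "(\<integral>\<^sup>+\<omega>. ennreal (exp (\<bar>\<xi> \<omega>\<bar> / t)) \<partial>M) \<le> 2"
proof -
  have "psi1_norm M \<xi> < ennreal t" using assms by (meson ennreal_lessI le_less_trans order_le_less_trans)
  then obtain t' where t': "0 < t'" "t' < t" "(\<integral>\<^sup>+\<omega>. ennreal (exp (\<bar>\<xi> \<omega>\<bar> / t')) \<partial>M) \<le> 2"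
    unfolding psi1_norm_def Inf_less_iff by (auto simp: ennreal_less_iff)
  have "(\<integral>\<^sup>+\<omega>. ennreal (exp (\<bar>\<xi> \<omega>\<bar> / t)) \<partial>M) \<le> (\<integral>\<^sup>+\<omega>. ennreal (exp (\<bar>\<xi> \<omega>\<bar> / t')) \<partial>M)"
    using t' by (intro nn_integral_mono ennreal_leI) (auto intro!: divide_left_mono)
  with t'(3) show ?thesis by (rule order_trans[rotated])
qed

lemma psi1_norm_vec_direction:
  assumes "norm u = 1" shows "psi1_norm M (\<lambda>\<omega>. u \<bullet> \<nu> \<omega>) \<le> psi1_norm_vec M \<nu>"
  unfolding psi1_norm_vec_def by (rule SUP_upper) (use assms in simp)

lemma iid_pairs_measurable:
  fixes X :: "nat \<Rightarrow> 'w \<Rightarrow> real^'d"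
  assumes "prob_space P" "iid_pairs P n X \<epsilon>" "i \<in> {1..n}"
  shows "X i \<in> borel_measurable P" "\<epsilon> i \<in> borel_measurable P"
proof -
  interpret prob_space P by fact
  have Z: "(\<lambda>\<omega>. (X i \<omega>, \<epsilon> i \<omega>)) \<in> borel_measurable P"
    using conjunct1[OF assms(2)[unfolded iid_pairs_def]] assms(3) by (simp add: indep_vars_def)
  have "fst \<in> borel_measurable (borel :: ((real^'d) \<times> real) measure)" "snd \<in> borel_measurable (borel :: ((real^'d) \<times> real) measure)"
    by (intro borel_measurable_continuous_onI continuous_intros)+
  from this[THEN measurable_compose[OF Z]] show "X i \<in> borel_measurable P" "\<epsilon> i \<in> borel_measurable P"
    by simp_all
qed

lemma iid_pairs_exp_sum:
  fixes F :: "(real^'d) \<times> real \<Rightarrow> real"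
  assumes "prob_space P" and iid: "iid_pairs P n X \<epsilon>" and F[measurable]: "F \<in> borel_measurable borel" and n: "0 < n"
    and one: "(\<integral>\<^sup>+\<omega>. ennreal (exp (F (X 1 \<omega>, \<epsilon> 1 \<omega>))) \<partial>P) \<le> ennreal (exp a)"
  shows "(\<integral>\<^sup>+\<omega>. ennreal (exp (\<Sum>i=1..n. F (X i \<omega>, \<epsilon> i \<omega>))) \<partial>P) \<le> ennreal (exp (real n * a))"
proof -
  interpret prob_space P by fact
  let ?Z = "\<lambda>i \<omega>. (X i \<omega>, \<epsilon> i \<omega>)"
  let ?G = "\<lambda>z. ennreal (exp (F z))"
  have ind: "indep_vars (\<lambda>_. borel) ?Z {1..n}"
    and dist: "\<And>i. i \<in> {1..n} \<Longrightarrow> distr P borel (?Z i) = distr P borel (?Z 1)"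
    using iid unfolding iid_pairs_def by blast+
  have G: "?G \<in> borel_measurable borel" by measurable
  have Z: "\<And>i. i \<in> {1..n} \<Longrightarrow> ?Z i \<in> borel_measurable P"
    using ind by (simp add: indep_vars_def)
  have eq: "(\<integral>\<^sup>+\<omega>. ?G (?Z i \<omega>) \<partial>P) = (\<integral>\<^sup>+\<omega>. ?G (?Z 1 \<omega>) \<partial>P)" if "i \<in> {1..n}" for i
  proof -
    have "(\<integral>\<^sup>+\<omega>. ?G (?Z i \<omega>) \<partial>P) = (\<integral>\<^sup>+z. ?G z \<partial>distr P borel (?Z i))"
      by (rule nn_integral_distr[OF Z[OF that], symmetric]) (simp add: G)
    also have "\<dots> = (\<integral>\<^sup>+\<omega>. ?G (?Z 1 \<omega>) \<partial>P)"
      unfolding dist[OF that] by (rule nn_integral_distr) (use n in \<open>simp_all add: G Z\<close>)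
    finally show ?thesis .
  qed
  have "(\<integral>\<^sup>+\<omega>. ennreal (exp (\<Sum>i=1..n. F (?Z i \<omega>))) \<partial>P) = (\<integral>\<^sup>+\<omega>. (\<Prod>i=1..n. ?G (?Z i \<omega>)) \<partial>P)"
    by (simp add: exp_sum prod_ennreal)
  also have "\<dots> = (\<Prod>i=1..n. \<integral>\<^sup>+\<omega>. ?G (?Z i \<omega>) \<partial>P)"
    by (intro indep_vars_nn_integral indep_vars_compose2[OF ind] G) simp_all
  also have "\<dots> \<le> (\<Prod>i=1..n. ennreal (exp a))"
  proof (rule prod_mono_ennreal)
    fix i assume "i \<in> {1..n}"
    from eq[OF this] one show "(\<integral>\<^sup>+\<omega>. ?G (?Z i \<omega>) \<partial>P) \<le> ennreal (exp a)" by (rule ord_eq_le_trans)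
  qed
  also have "\<dots> = ennreal (exp (real n * a))"
    by (simp add: ennreal_power exp_of_nat_mult)
  finally show ?thesis .
qed

text \<open>The noise and the covariance error in isotropic coordinates: \<open>W\<close> stands for the inverse square root of the second moment matrix.\<close>

definition whitened_noise :: "real^'d^'d \<Rightarrow> nat \<Rightarrow> (nat \<Rightarrow> 'w \<Rightarrow> real^'d) \<Rightarrow> (nat \<Rightarrow> 'w \<Rightarrow> real) \<Rightarrow> 'w \<Rightarrow> real^'d" where
  "whitened_noise W n X \<epsilon> \<omega> = (1 / real n) *\<^sub>R (\<Sum>i=1..n. \<epsilon> i \<omega> *\<^sub>R (W *v X i \<omega>))"

definition whitened_error :: "real^'d^'d \<Rightarrow> nat \<Rightarrow> (nat \<Rightarrow> 'w \<Rightarrow> real^'d) \<Rightarrow> 'w \<Rightarrow> real^'d^'d" where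
  "whitened_error W n X \<omega> = Sigma_hat n (\<lambda>i. W *v X i \<omega>) - mat 1"

lemma Z_vec_whitened:
  fixes S W :: "real^'d^'d"
  assumes SW: "\<And>z. S *v (W *v z) = z" and Y: "\<And>i. i \<in> {1..n} \<Longrightarrow> Y i \<omega> = X i \<omega> \<bullet> \<theta>\<^sub>0 + \<epsilon> i \<omega>"
  shows "Z_vec n (\<lambda>i. X i \<omega>) (\<lambda>i. Y i \<omega>) = Sigma_hat n (\<lambda>i. X i \<omega>) *v \<theta>\<^sub>0 + S *v whitened_noise W n X \<epsilon> \<omega>"
proof -
  have xi: "S *v whitened_noise W n X \<epsilon> \<omega> = (1 / real n) *\<^sub>R (\<Sum>i=1..n. \<epsilon> i \<omega> *\<^sub>R X i \<omega>)"
    by (simp add: whitened_noise_def matrix_vector_mult_scaleR matrix_vector_mult_sum SW)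
  have "Sigma_hat n (\<lambda>i. X i \<omega>) *v \<theta>\<^sub>0 = (1 / real n) *\<^sub>R (\<Sum>i=1..n. outer (X i \<omega>) *v \<theta>\<^sub>0)"
    by (simp add: Sigma_hat_def scaleR_matrix_vector_assoc[symmetric] sum_matrix_vector_mult)
  thus ?thesis unfolding xi Z_vec_def
    by (simp add: scaleR_right_distrib[symmetric] sum.distrib[symmetric] outer_mult_vec scaleR_left_distrib Y)
qed

lemma Sigma_hat_error_whitened:
  fixes S W :: "real^'d^'d"
  assumes SW: "\<And>z. S *v (W *v z) = z" and S: "transpose S = S" "S ** S = \<Sigma>"
  shows "(Sigma_hat n (\<lambda>i. X i \<omega>) - \<Sigma>) *v z = S *v (whitened_error W n X \<omega> *v (S *v z))"
proof -
  have SS: "S *v (S *v z) = \<Sigma> *v z" by (simp add: matrix_vector_mul_assoc S)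
  have o: "S *v (outer (W *v x) *v (S *v z)) = outer x *v z" for x
    using symmetric_inner_mult[OF S(1), of "W *v x" z] by (simp add: outer_mult_vec matrix_vector_mult_scaleR SW)
  show ?thesis
    by (simp add: whitened_error_def Sigma_hat_def matrix_vector_mult_diff_rdistrib matrix_vector_mult_diff_distrib
        scaleR_matrix_vector_assoc[symmetric] sum_matrix_vector_mult matrix_vector_mult_scaleR matrix_vector_mult_sum o SS)
qed

lemma matrix_vector_mult_measurable[measurable (raw)]:
  fixes W :: "real^'n^'m"
  assumes [measurable]: "f \<in> borel_measurable M"
  shows "(\<lambda>x. W *v f x) \<in> borel_measurable M"
  by (rule measurable_compose[OF assms]) (intro borel_measurable_continuous_onI linear_continuous_on
     matrix_vector_mul_bounded_linear)

lemma measurable_vec_lambda: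
  fixes f :: "'i::finite \<Rightarrow> 'w \<Rightarrow> real"
  assumes "\<And>i. f i \<in> borel_measurable M"
  shows "(\<lambda>\<omega>. \<chi> i. f i \<omega>) \<in> borel_measurable M"
  by (subst borel_measurable_euclidean_space) (use assms in \<open>auto simp: Basis_vec_def inner_axis\<close>)

lemma whitened_error_measurable:
  fixes X :: "nat \<Rightarrow> 'w \<Rightarrow> real^'d"
  assumes X: "\<And>i. i \<in> {1..n} \<Longrightarrow> X i \<in> borel_measurable P"
  shows "whitened_error W n X \<in> borel_measurable P"
proof -
  have "(\<lambda>\<omega>. outer (W *v X i \<omega>)) \<in> borel_measurable P" if "i \<in> {1..n}" for i
  proof -
    have [measurable]: "X i \<in> borel_measurable P" using X that .
    have "continuous_on UNIV (outer :: real^'d \<Rightarrow> _)"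
      unfolding outer_def by (intro continuous_intros)
    hence [measurable]: "(outer :: real^'d \<Rightarrow> _) \<in> borel_measurable borel" by (rule borel_measurable_continuous_onI)
    show ?thesis by measurable
  qed
  thus ?thesis unfolding whitened_error_def[abs_def] Sigma_hat_def
    by (intro borel_measurable_diff borel_measurable_scaleR borel_measurable_sum borel_measurable_const) auto
qed

text \<open>The entries are integrable because \<open>|x x\<^sup>T| = |x|\<^sup>2\<close> in the Frobenius norm.\<close>

lemma second_moment_inner:
  fixes X :: "'w \<Rightarrow> real^'d"
  assumes X: "X \<in> borel_measurable P" and moment: "integrable P (\<lambda>\<omega>. (norm (X \<omega>))\<^sup>2)"
  shows "x \<bullet> (second_moment P X *v y) = (\<integral>\<omega>. (x \<bullet> X \<omega>) * (X \<omega> \<bullet> y) \<partial>P)"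
proof -
  have int_outer: "integrable P (\<lambda>\<omega>. outer (X \<omega>))"
  proof (rule Bochner_Integration.integrable_bound[OF moment])
    have "continuous_on UNIV (outer :: real^'d \<Rightarrow> _)" unfolding outer_def by (intro continuous_intros)
    thus "(\<lambda>\<omega>. outer (X \<omega>)) \<in> borel_measurable P"
      by (intro measurable_compose[OF X] borel_measurable_continuous_onI)
    show "AE \<omega> in P. norm (outer (X \<omega>)) \<le> norm ((norm (X \<omega>))\<^sup>2)"
      by (simp add: outer_eq_tensor norm_tensor power2_eq_square)
  qed
  have "x \<bullet> (second_moment P X *v y) = (\<integral>\<omega>. outer (X \<omega>) \<partial>P) \<bullet> tensor x y"
    by (simp only: inner_tensor second_moment_def)
  also have "\<dots> = (\<integral>\<omega>. outer (X \<omega>) \<bullet> tensor x y \<partial>P)"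
    by (rule integral_inner_left[symmetric]) (rule int_outer)
  also have "\<dots> = (\<integral>\<omega>. (x \<bullet> X \<omega>) * (X \<omega> \<bullet> y) \<partial>P)"
    by (simp only: inner_tensor outer_mult_vec inner_scaleR_right mult.commute)
  finally show ?thesis .
qed

lemma second_moment_symmetric:
  fixes X :: "'w \<Rightarrow> real^'d"
  assumes "X \<in> borel_measurable P" "integrable P (\<lambda>\<omega>. (norm (X \<omega>))\<^sup>2)"
  shows "transpose (second_moment P X) = second_moment P X"
proof -
  note quad = second_moment_inner[OF assms]
  have "second_moment P X $ i $ j = second_moment P X $ j $ i" for i j
    using quad[of "axis i 1" "axis j 1"] quad[of "axis j 1" "axis i 1"]
    by (simp add: inner_axis' inner_axis matrix_vector_mult_basis column_def mult.commute)
  thus ?thesis unfolding vec_eq_iff transpose_def vec_lambda_beta by blast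
qed

text \<open>The quadratic hypothesis is used at \<open>s = 1 / n\<close>; the trace term cancels against the identity that is subtracted in
\<^const>\<open>whitened_error\<close>.\<close>

lemma whitened_error_mgf:
  fixes X :: "nat \<Rightarrow> 'w \<Rightarrow> real^'d"
  assumes P: "prob_space P" and iid: "iid_pairs P n X \<epsilon>" and n: "0 < n"
    and Q: "assumption_Q P (X 1) \<Sigma> C" and M: "C * norm M \<le> real n"
  shows "(\<integral>\<^sup>+\<omega>. ennreal (exp (M \<bullet> whitened_error (matrix_inv (mat_sqrt \<Sigma>)) n X \<omega>)) \<partial>P)
      \<le> ennreal (exp (C\<^sup>2 * (norm M)\<^sup>2 / real n))"
proof (cases "M = 0")
  case True
  interpret prob_space P by fact
  show ?thesis using True by (simp add: emeasure_space_1)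
next
  case False
  interpret prob_space P by fact
  let ?W = "matrix_inv (mat_sqrt \<Sigma>)"
  let ?s = "1 / real n"
  define q where "q \<omega> = (?W *v X 1 \<omega>) \<bullet> (M *v (?W *v X 1 \<omega>))" for \<omega>
  have C: "0 < C" using Q by (simp add: assumption_Q_def)
  have "C * \<bar>?s\<bar> \<le> 1 / frob_norm M"
    using M False n by (simp add: frob_norm_eq_norm field_simps)
  hence int: "integrable P (\<lambda>\<omega>. exp (?s * q \<omega>))"
    and le: "ln (\<integral>\<omega>. exp (?s * q \<omega>) \<partial>P) \<le> ?s * trace M + C\<^sup>2 * ?s\<^sup>2 * (norm M)\<^sup>2"
    using Q False unfolding assumption_Q_def Let_def q_def frob_norm_eq_norm by blast+
  let ?I = "\<integral>\<omega>. exp (?s * q \<omega>) \<partial>P" and ?b = "C\<^sup>2 * (norm M)\<^sup>2 / (real n)\<^sup>2"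
  have Ib: "?I \<le> exp (?s * trace M + ?b)"
  proof (cases "0 < ?I")
    case True
    have "?I = exp (ln ?I)" using True by simp
    also have "\<dots> \<le> exp (?s * trace M + ?b)" using le by (simp add: power_divide)
    finally show ?thesis .
  next
    case False thus ?thesis by (meson exp_ge_zero not_less order_trans)
  qed
  define F where "F = (\<lambda>z::(real^'d) \<times> real. ?s * ((?W *v fst z) \<bullet> (M *v (?W *v fst z)) - trace M))"
  have F1: "F (X i \<omega>, \<epsilon> i \<omega>) = ?s * (M \<bullet> outer (?W *v X i \<omega>) - trace M)" for i \<omega>
    by (simp add: F_def inner_outer)
  have "(\<integral>\<^sup>+\<omega>. ennreal (exp (\<Sum>i=1..n. F (X i \<omega>, \<epsilon> i \<omega>))) \<partial>P) \<le> ennreal (exp (real n * ?b))"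
  proof (rule iid_pairs_exp_sum[OF P iid _ n])
    show "F \<in> borel_measurable borel" unfolding F_def
      by (intro borel_measurable_continuous_onI continuous_intros
          linear_continuous_on_compose[OF _ matrix_vector_mul_linear])
    have "(\<integral>\<^sup>+\<omega>. ennreal (exp (F (X 1 \<omega>, \<epsilon> 1 \<omega>))) \<partial>P)
        = (\<integral>\<^sup>+\<omega>. ennreal (exp (- (?s * trace M)) * exp (?s * q \<omega>)) \<partial>P)"
      unfolding F_def q_def by (simp add: exp_add[symmetric] right_diff_distrib)
    also have "\<dots> = ennreal (exp (- (?s * trace M)) * ?I)"
      using int by (subst nn_integral_eq_integral) auto
    also have "\<dots> \<le> ennreal (exp (- (?s * trace M)) * exp (?s * trace M + ?b))"
      by (intro ennreal_leI mult_left_mono Ib) auto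
    also have "\<dots> = ennreal (exp ?b)" by (simp add: exp_add[symmetric])
    finally show "(\<integral>\<^sup>+\<omega>. ennreal (exp (F (X 1 \<omega>, \<epsilon> 1 \<omega>))) \<partial>P) \<le> ennreal (exp ?b)" .
  qed
  moreover have "(\<Sum>i=1..n. F (X i \<omega>, \<epsilon> i \<omega>)) = M \<bullet> whitened_error ?W n X \<omega>" for \<omega>
  proof -
    let ?o = "\<Sum>i=1..n. M \<bullet> outer (?W *v X i \<omega>)"
    have "(\<Sum>i=1..n. F (X i \<omega>, \<epsilon> i \<omega>)) = ?s * (?o - real n * trace M)"
      unfolding F1 sum_distrib_left[symmetric] sum_subtractf by simp
    also have "\<dots> = ?s * ?o - trace M" using n by (simp add: field_simps)
    also have "\<dots> = M \<bullet> whitened_error ?W n X \<omega>"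
      unfolding whitened_error_def Sigma_hat_def inner_diff_right inner_mat_1 inner_scaleR_right inner_sum_right ..
    finally show ?thesis .
  qed
  moreover have "real n * ?b = C\<^sup>2 * (norm M)\<^sup>2 / real n" using n by (simp add: power2_eq_square)
  ultimately show ?thesis by (simp only:)
qed

text \<open>The conditional mean zero hypothesis enters here: the linear statistic of \<open>X\<close> is measurable with respect to the conditioning
\<open>\<sigma>\<close>-algebra, so its product with the noise is centred.\<close>

lemma whitened_noise_mgf:
  fixes X :: "nat \<Rightarrow> 'w \<Rightarrow> real^'d"
  assumes P: "prob_space P" and iid: "iid_pairs P n X \<epsilon>" and n: "0 < n"
    and N: "assumption_N P (X 1) (\<epsilon> 1) \<Sigma> \<sigma>" and s: "\<sigma> < s" "s * norm u \<le> real n"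
  shows "(\<integral>\<^sup>+\<omega>. ennreal (exp (u \<bullet> whitened_noise (matrix_inv (mat_sqrt \<Sigma>)) n X \<epsilon> \<omega>)) \<partial>P)
      \<le> ennreal (exp (s\<^sup>2 * (norm u)\<^sup>2 / real n))"
proof (cases "u = 0")
  case True
  interpret prob_space P by fact
  show ?thesis using True by (simp add: emeasure_space_1)
next
  case False
  interpret prob_space P by fact
  let ?W = "matrix_inv (mat_sqrt \<Sigma>)"
  have meas[measurable]: "X 1 \<in> borel_measurable P" "\<epsilon> 1 \<in> borel_measurable P"
    using iid_pairs_measurable[OF P iid, of 1] n by auto
  have \<sigma>: "0 \<le> \<sigma>" and int\<epsilon>: "integrable P (\<epsilon> 1)"
    and ce: "AE \<omega> in P. real_cond_exp P (vimage_algebra (space P) (X 1) borel) (\<epsilon> 1) \<omega> = 0"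
    and psi: "psi1_norm_vec P (\<lambda>\<omega>. \<epsilon> 1 \<omega> *\<^sub>R (?W *v X 1 \<omega>)) = ennreal \<sigma>"
    using N by (auto simp: assumption_N_def)
  define e where "e = u /\<^sub>R norm u"
  have e: "norm e = 1" using False by (simp add: e_def)
  define \<eta> where "\<eta> \<omega> = e \<bullet> (\<epsilon> 1 \<omega> *\<^sub>R (?W *v X 1 \<omega>))" for \<omega>
  have [measurable]: "\<eta> \<in> borel_measurable P" unfolding \<eta>_def by measurable
  have t: "(\<integral>\<^sup>+\<omega>. ennreal (exp (\<bar>\<eta> \<omega>\<bar> / s)) \<partial>P) \<le> 2"
    unfolding \<eta>_def
    by (rule psi1_norm_bound[OF _ s(1) \<sigma>]) (use psi1_norm_vec_direction[OF e] psi in metis)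
  have s0: "0 < s" using s \<sigma> by simp
  have int: "integrable P \<eta>"
  proof (rule Bochner_Integration.integrable_bound)
    show "integrable P (\<lambda>\<omega>. s * exp (\<bar>\<eta> \<omega>\<bar> / s))"
      by (intro integrable_mult_right integrableI_nonneg) (use t in \<open>auto intro: order_le_less_trans[of _ 2]\<close>)
    show "AE \<omega> in P. norm (\<eta> \<omega>) \<le> norm (s * exp (\<bar>\<eta> \<omega>\<bar> / s))"
    proof (rule AE_I2)
      fix \<omega>
      have "\<bar>\<eta> \<omega>\<bar> / s \<le> exp (\<bar>\<eta> \<omega>\<bar> / s)" using exp_ge_add_one_self[of "\<bar>\<eta> \<omega>\<bar> / s"] by linarith
      thus "norm (\<eta> \<omega>) \<le> norm (s * exp (\<bar>\<eta> \<omega>\<bar> / s))" using s0 by (simp add: field_simps abs_mult)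
    qed
  qed simp
  have mean: "(\<integral>\<omega>. \<eta> \<omega> \<partial>P) = 0"
  proof -
    let ?F = "vimage_algebra (space P) (X 1) borel"
    have sub: "subalgebra P ?F"
      using measurable_sets[OF meas(1)] by (auto simp: subalgebra_def sets_vimage_algebra2 simp del: One_nat_def)
    interpret finite_measure_subalgebra P ?F by unfold_locales (rule sub)
    define g where "g \<omega> = e \<bullet> (?W *v X 1 \<omega>)" for \<omega>
    have X1: "X 1 \<in> measurable ?F borel" by (rule measurable_vimage_algebra1) auto
    have g: "g \<in> borel_measurable ?F" unfolding g_def using X1 by measurable
    have \<eta>g: "\<eta> = (\<lambda>\<omega>. g \<omega> * \<epsilon> 1 \<omega>)" by (auto simp: \<eta>_def g_def)
    have "(\<integral>\<omega>. g \<omega> * \<epsilon> 1 \<omega> \<partial>P) = (\<integral>\<omega>. g \<omega> * real_cond_exp P ?F (\<epsilon> 1) \<omega> \<partial>P)"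
      using real_cond_exp_intg(2)[OF _ g meas(2)] int unfolding \<eta>g by simp
    also have "\<dots> = (\<integral>\<omega>. 0 \<partial>P)"
    proof (rule integral_cong_AE)
      show "(\<lambda>\<omega>. g \<omega> * real_cond_exp P ?F (\<epsilon> 1) \<omega>) \<in> borel_measurable P"
        by (intro borel_measurable_times measurable_from_subalg[OF sub g] borel_measurable_cond_exp2)
      show "AE \<omega> in P. g \<omega> * real_cond_exp P ?F (\<epsilon> 1) \<omega> = 0" using ce by eventually_elim simp
    qed simp
    finally show ?thesis unfolding \<eta>g by simp
  qed
  define F where "F = (\<lambda>z::(real^'d) \<times> real. (1 / real n) * (u \<bullet> (snd z *\<^sub>R (?W *v fst z))))"
  let ?b = "s\<^sup>2 * (norm u)\<^sup>2 / (real n)\<^sup>2"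
  have "(\<integral>\<^sup>+\<omega>. ennreal (exp (\<Sum>i=1..n. F (X i \<omega>, \<epsilon> i \<omega>))) \<partial>P) \<le> ennreal (exp (real n * ?b))"
  proof (rule iid_pairs_exp_sum[OF P iid _ n])
    show "F \<in> borel_measurable borel" unfolding F_def
      by (intro borel_measurable_continuous_onI continuous_intros
          linear_continuous_on_compose[OF _ matrix_vector_mul_linear])
    have "F (X 1 \<omega>, \<epsilon> 1 \<omega>) = (norm u / real n) * \<eta> \<omega>" for \<omega>
      using False by (simp add: F_def \<eta>_def e_def)
    moreover have "(\<integral>\<^sup>+\<omega>. ennreal (exp ((norm u / real n) * \<eta> \<omega>)) \<partial>P) \<le> ennreal (exp ((norm u / real n * s)\<^sup>2))"
      by (rule centred_psi1_mgf[OF P int mean s0 t]) (use s n in \<open>simp add: field_simps\<close>)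
    ultimately show "(\<integral>\<^sup>+\<omega>. ennreal (exp (F (X 1 \<omega>, \<epsilon> 1 \<omega>))) \<partial>P) \<le> ennreal (exp ?b)"
      by (simp add: power_mult_distrib power_divide ac_simps)
  qed
  moreover have "(\<Sum>i=1..n. F (X i \<omega>, \<epsilon> i \<omega>)) = u \<bullet> whitened_noise ?W n X \<epsilon> \<omega>" for \<omega>
    by (simp add: F_def whitened_noise_def inner_sum_right sum_divide_distrib)
  moreover have "real n * ?b = s\<^sup>2 * (norm u)\<^sup>2 / real n" using n by (simp add: power2_eq_square)
  ultimately show ?thesis by (simp only:)
qed

section \<open>Deviations along an eigenbasis\<close>

context orthonormal_eigenbasis
begin

lemma noise_deviation:
  fixes X :: "nat \<Rightarrow> 'w \<Rightarrow> real^'n"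
  assumes P: "prob_space P" and iid: "iid_pairs P n X \<epsilon>" and n: "0 < n"
    and N: "assumption_N P (X 1) (\<epsilon> 1) \<Sigma> \<sigma>"
    and f: "\<And>i. \<bar>f i\<bar> \<le> 1" and p: "(\<Sum>i\<in>UNIV. (f i)\<^sup>2) \<le> p" "0 < p" and \<delta>: "0 < \<delta>" "\<delta> < 1"
    and big: "p \<le> 4 * real n" "4096 * ln (2 / \<delta>) \<le> real n"
  obtains B where "B \<in> sets P" "measure P B \<le> \<delta>"
    "\<And>\<omega>. \<omega> \<in> space P - B \<Longrightarrow> sqrt (\<Sum>i\<in>UNIV. (f i * (whitened_noise (matrix_inv (mat_sqrt \<Sigma>)) n X \<epsilon> \<omega> \<bullet> e i))\<^sup>2)
        \<le> 4 * \<sigma> * sqrt ((p + ln (2 / \<delta>)) / real n)"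
proof -
  let ?y = "whitened_noise (matrix_inv (mat_sqrt \<Sigma>)) n X \<epsilon>"
  define \<nu> where "\<nu> \<omega> = (\<chi> i. ?y \<omega> \<bullet> e i)" for \<omega>
  have [measurable]: "?y \<in> borel_measurable P"
    using iid_pairs_measurable[OF P iid] unfolding whitened_noise_def[abs_def]
    by (intro borel_measurable_scaleR borel_measurable_sum matrix_vector_mult_measurable) auto
  have \<nu>: "\<nu> \<in> borel_measurable P"
    unfolding \<nu>_def[abs_def] by (intro measurable_vec_lambda) measurable
  have \<sigma>: "0 \<le> \<sigma>" using N by (simp add: assumption_N_def)
  note dev = coordinate_deviation[where \<nu>=\<nu> and f=f and p=p and \<tau>=\<sigma> and N="real n" and \<delta>=\<delta>, OF P \<nu> f p \<sigma> _ \<delta> _ big]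
  have mgf: "(\<integral>\<^sup>+\<omega>. ennreal (exp (u \<bullet> \<nu> \<omega>)) \<partial>P) \<le> ennreal (exp (s\<^sup>2 * (norm u)\<^sup>2 / real n))"
    if "\<sigma> < s" "s * norm u \<le> real n" for u s
  proof -
    let ?u = "\<Sum>i\<in>UNIV. (u $ i) *\<^sub>R e i"
    have nu: "norm ?u = norm u" unfolding norm_combination by (simp add: norm_vec_def L2_set_def)
    have "u \<bullet> \<nu> \<omega> = ?u \<bullet> ?y \<omega>" for \<omega>
      by (simp add: \<nu>_def inner_vec_def[of u] inner_sum_left inner_commute[of "e _" "?y \<omega>"])
    thus ?thesis using whitened_noise_mgf[OF P iid n N that(1), of ?u] that(2) by (simp add: nu)
  qed
  show ?thesis
    by (rule that[OF dev(1) dev(2)]) (use n mgf in \<open>auto simp: \<nu>_def not_less\<close>)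
qed

text \<open>\<open>u \<bullet> (E v) = E \<bullet> u v\<^sup>T\<close>, and \<open>u v\<^sup>T\<close> has Frobenius norm \<open>|u| |v|\<close>.\<close>

lemma error_vector_deviation:
  fixes X :: "nat \<Rightarrow> 'w \<Rightarrow> real^'n"
  assumes P: "prob_space P" and iid: "iid_pairs P n X \<epsilon>" and n: "0 < n"
    and Q: "assumption_Q P (X 1) \<Sigma> C"
    and f: "\<And>i. \<bar>f i\<bar> \<le> 1" and p: "(\<Sum>i\<in>UNIV. (f i)\<^sup>2) \<le> p" "0 < p" and \<delta>: "0 < \<delta>" "\<delta> < 1"
    and big: "p \<le> 4 * real n" "4096 * ln (2 / \<delta>) \<le> real n"
  obtains B where "B \<in> sets P" "measure P B \<le> \<delta>"
    "\<And>\<omega>. \<omega> \<in> space P - B \<Longrightarrow> sqrt (\<Sum>i\<in>UNIV. (f i * ((whitened_error (matrix_inv (mat_sqrt \<Sigma>)) n X \<omega> *v v) \<bullet> e i))\<^sup>2)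
        \<le> 4 * (C * norm v) * sqrt ((p + ln (2 / \<delta>)) / real n)"
proof -
  let ?y = "whitened_error (matrix_inv (mat_sqrt \<Sigma>)) n X"
  define \<nu> where "\<nu> \<omega> = (\<chi> i. (?y \<omega> *v v) \<bullet> e i)" for \<omega>
  have in_tensor: "(M *v v) \<bullet> w = M \<bullet> tensor w v" for M :: "real^'n^'n" and w
    by (simp add: inner_tensor inner_commute)
  have [measurable]: "?y \<in> borel_measurable P"
    by (rule whitened_error_measurable[OF iid_pairs_measurable(1)[OF P iid]])
  have \<nu>: "\<nu> \<in> borel_measurable P"
    unfolding \<nu>_def[abs_def] in_tensor by (intro measurable_vec_lambda) measurable
  have C: "0 < C" using Q by (simp add: assumption_Q_def)
  hence C0: "0 \<le> C * norm v" by simp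
  note dev = coordinate_deviation[where \<nu>=\<nu> and f=f and p=p and \<tau>="C * norm v" and N="real n" and \<delta>=\<delta>, OF P \<nu> f p C0 _ \<delta> _ big]
  have mgf: "(\<integral>\<^sup>+\<omega>. ennreal (exp (u \<bullet> \<nu> \<omega>)) \<partial>P) \<le> ennreal (exp (s\<^sup>2 * (norm u)\<^sup>2 / real n))"
    if s: "C * norm v < s" "s * norm u \<le> real n" for u s
  proof -
    let ?u = "\<Sum>i\<in>UNIV. (u $ i) *\<^sub>R e i"
    have nu: "norm ?u = norm u" unfolding norm_combination by (simp add: norm_vec_def L2_set_def)
    have uv: "u \<bullet> \<nu> \<omega> = tensor ?u v \<bullet> ?y \<omega>" for \<omega>
    proof -
      have "u \<bullet> \<nu> \<omega> = ?u \<bullet> (?y \<omega> *v v)"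
        by (simp add: \<nu>_def inner_vec_def[of u] inner_sum_left inner_commute[of "e _" "?y \<omega> *v v"])
      thus ?thesis by (simp only: inner_commute[of "tensor ?u v"] inner_tensor)
    qed
    have nt: "C * norm (tensor ?u v) = (C * norm v) * norm u" by (simp add: norm_tensor nu)
    have le: "(C * norm v) * norm u \<le> s * norm u" using s by (intro mult_right_mono) auto
    have "(\<integral>\<^sup>+\<omega>. ennreal (exp (tensor ?u v \<bullet> ?y \<omega>)) \<partial>P) \<le> ennreal (exp (C\<^sup>2 * (norm (tensor ?u v))\<^sup>2 / real n))"
      by (rule whitened_error_mgf[OF P iid n Q]) (use nt le s in linarith)
    also have "C\<^sup>2 * (norm (tensor ?u v))\<^sup>2 = ((C * norm v) * norm u)\<^sup>2"
      unfolding nt[symmetric] by (simp add: power_mult_distrib)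
    also have "ennreal (exp (((C * norm v) * norm u)\<^sup>2 / real n)) \<le> ennreal (exp (s\<^sup>2 * (norm u)\<^sup>2 / real n))"
    proof -
      have "((C * norm v) * norm u)\<^sup>2 \<le> (s * norm u)\<^sup>2" using le C0 by (intro power_mono) auto
      hence "((C * norm v) * norm u)\<^sup>2 / real n \<le> (s * norm u)\<^sup>2 / real n" by (rule divide_right_mono) simp
      thus ?thesis by (intro ennreal_leI) (simp add: power_mult_distrib)
    qed
    finally show ?thesis unfolding uv .
  qed
  show ?thesis
    by (rule that[OF dev(1) dev(2)]) (use n mgf in \<open>auto simp: \<nu>_def not_less\<close>)
qed

text \<open>For the two-sided weights \<open>f i * f j\<close> the Hilbert-Schmidt norm is squared; this is the source of the squared effective rank in the
remainder.\<close>

lemma error_matrix_deviation: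
  fixes X :: "nat \<Rightarrow> 'w \<Rightarrow> real^'n"
  assumes P: "prob_space P" and iid: "iid_pairs P n X \<epsilon>" and n: "0 < n"
    and Q: "assumption_Q P (X 1) \<Sigma> C"
    and f: "\<And>i. \<bar>f i\<bar> \<le> 1" and p: "(\<Sum>i\<in>UNIV. (f i)\<^sup>2) = p" "0 < p" and \<delta>: "0 < \<delta>" "\<delta> < 1"
    and big: "p\<^sup>2 \<le> 4 * real n" "4096 * ln (2 / \<delta>) \<le> real n"
  obtains B where "B \<in> sets P" "measure P B \<le> \<delta>"
    "\<And>\<omega>. \<omega> \<in> space P - B \<Longrightarrow> sqrt (\<Sum>q\<in>UNIV. ((f (fst q) * f (snd q)) *
          (e (fst q) \<bullet> (whitened_error (matrix_inv (mat_sqrt \<Sigma>)) n X \<omega> *v e (snd q))))\<^sup>2)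
        \<le> 4 * C * sqrt ((p\<^sup>2 + ln (2 / \<delta>)) / real n)"
proof -
  let ?y = "whitened_error (matrix_inv (mat_sqrt \<Sigma>)) n X"
  define F where "F q = f (fst q) * f (snd q)" for q :: "'n \<times> 'n"
  define \<nu> where "\<nu> \<omega> = (\<chi> q :: 'n \<times> 'n. e (fst q) \<bullet> (?y \<omega> *v e (snd q)))" for \<omega>
  have F: "\<bar>F q\<bar> \<le> 1" for q
    using mult_mono[OF f[of "fst q"] f[of "snd q"]] by (simp add: F_def abs_mult)
  have Fp: "(\<Sum>q\<in>UNIV. (F q)\<^sup>2) \<le> p\<^sup>2"
    unfolding p(1)[symmetric] power2_eq_square[of "sum _ _"] sum_product
    by (simp add: F_def power_mult_distrib sum.cartesian_product case_prod_beta UNIV_Times_UNIV[symmetric] del: UNIV_Times_UNIV)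
  have p2: "0 < p\<^sup>2" using p by simp
  have [measurable]: "?y \<in> borel_measurable P"
    by (rule whitened_error_measurable[OF iid_pairs_measurable(1)[OF P iid]])
  have \<nu>: "\<nu> \<in> borel_measurable P"
    unfolding \<nu>_def[abs_def] inner_tensor[symmetric] by (intro measurable_vec_lambda) measurable
  have C: "0 < C" using Q by (simp add: assumption_Q_def)
  hence C0: "0 \<le> C" by simp
  note dev = coordinate_deviation[where \<nu>=\<nu> and f=F and p="p\<^sup>2" and \<tau>=C and N="real n" and \<delta>=\<delta>, OF P \<nu> F Fp p2 C0 _ \<delta> _ big]
  have mgf: "(\<integral>\<^sup>+\<omega>. ennreal (exp (u \<bullet> \<nu> \<omega>)) \<partial>P) \<le> ennreal (exp (s\<^sup>2 * (norm u)\<^sup>2 / real n))"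
    if s: "C < s" "s * norm u \<le> real n" for u s
  proof -
    let ?M = "\<Sum>q\<in>UNIV. (u $ q) *\<^sub>R tensor (e (fst q)) (e (snd q))"
    have coef: "e (fst p) \<bullet> (?M *v e (snd p)) = u $ p" for p
    proof -
      have "e (fst p) \<bullet> (?M *v e (snd p)) = ?M \<bullet> tensor (e (fst p)) (e (snd p))" by (simp add: inner_tensor)
      also have "\<dots> = (\<Sum>q\<in>UNIV. u $ q * (if fst q = fst p \<and> snd q = snd p then 1 else 0))"
        unfolding inner_sum_left inner_scaleR_left unfolding inner_tensor tensor_mult_vec
        by (intro sum.cong refl) (auto simp: orthonormal)
      also have "\<dots> = u $ p" by (simp add: prod_eq_iff[symmetric] if_distrib[of "\<lambda>x. _ * x"] cong: if_cong)
      finally show ?thesis .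
    qed
    have nM: "norm ?M = norm u"
    proof -
      have "(norm ?M)\<^sup>2 = (norm u)\<^sup>2" unfolding matrix_norm_sq coef norm_vec_sq[of u] ..
      thus ?thesis by simp
    qed
    have uv: "u \<bullet> \<nu> \<omega> = ?M \<bullet> ?y \<omega>" for \<omega>
      unfolding inner_commute[of ?M]
      by (simp add: \<nu>_def inner_vec_def[of u] inner_sum_right inner_tensor)
    have le: "C * norm u \<le> s * norm u" using s by (intro mult_right_mono) auto
    have "(\<integral>\<^sup>+\<omega>. ennreal (exp (?M \<bullet> ?y \<omega>)) \<partial>P) \<le> ennreal (exp (C\<^sup>2 * (norm ?M)\<^sup>2 / real n))"
      by (rule whitened_error_mgf[OF P iid n Q]) (unfold nM, use le s in linarith)
    also have "C\<^sup>2 * (norm ?M)\<^sup>2 / real n \<le> s\<^sup>2 * (norm u)\<^sup>2 / real n"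
      unfolding nM using s C0 by (intro divide_right_mono mult_right_mono power_mono) auto
    finally show ?thesis unfolding uv by (simp add: ennreal_leI)
  qed
  show ?thesis
    by (rule that[OF dev(1) dev(2)]) (use n mgf in \<open>auto simp: \<nu>_def F_def not_less\<close>)
qed

end

section \<open>The bound on the estimation error\<close>

theorem corollary2p7:
  fixes P :: "'w measure"
    and X :: "nat \<Rightarrow> 'w \<Rightarrow> real^'d"
    and \<epsilon> Y :: "nat \<Rightarrow> 'w \<Rightarrow> real"
    and \<Sigma> :: "real^'d^'d"
    and \<theta>\<^sub>0 :: "real^'d"
    and \<theta>hat :: "'w \<Rightarrow> real^'d"
    and eig :: "nat \<Rightarrow> real"
    and C \<sigma> \<delta> \<mu> lam :: real
    and n k :: nat
  assumes P: "prob_space P"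
    and iid: "iid_pairs P n X \<epsilon>"
    and moment: "integrable P (\<lambda>\<omega>. (norm (X 1 \<omega>))\<^sup>2)"
    and Sigma: "\<Sigma> = second_moment P (X 1)"
    and inv: "invertible \<Sigma>"
    and Q: "assumption_Q P (X 1) \<Sigma> C"
    and N: "assumption_N P (X 1) (\<epsilon> 1) \<Sigma> \<sigma>"
    and theta0: "\<theta>\<^sub>0 \<noteq> 0"
    and Y: "\<And>i \<omega>. i \<in> {1..n} \<Longrightarrow> \<omega> \<in> space P \<Longrightarrow> Y i \<omega> = X i \<omega> \<bullet> \<theta>\<^sub>0 + \<epsilon> i \<omega>"
    and eig: "eigenvalues_desc \<Sigma> eig"
    and params: "0 < \<delta>" "\<delta> < 1" "0 < \<mu>" "0 < lam"
    and a: "norm \<theta>\<^sub>0 \<le> \<mu> / 420"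
           "norm \<theta>\<^sub>0 * op_norm \<Sigma> \<le> \<mu> * sqrt lam / 168"
    and b: "4 * (eff_rank \<Sigma>)\<^sup>2 + ln (4 / \<delta>) \<le> real n"
           "2 ^ 12 * (1 + C)\<^sup>2 * (eff_rank \<Sigma> + ln (2 / \<delta>)) \<le> real n"
    and c: "\<mu> \<ge> 112 * norm \<theta>\<^sub>0"
           "op_norm \<Sigma> * norm \<theta>\<^sub>0 \<le> \<mu> * sqrt lam / (8 * 18 * 56)"
           "5 * \<sigma> * sqrt (op_norm \<Sigma>) * sqrt ((eff_rank \<Sigma> + ln (4 / \<delta>)) / real n)
              \<le> norm \<theta>\<^sub>0 * min (sqrt lam) (op_norm \<Sigma>)"
    and d: "17 * (1 + C) * op_norm \<Sigma> * sqrt ((4 * eff_rank \<Sigma> + ln (2 / \<delta>)) / real n) \<le> sqrt lam"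
    and e: "\<mu> * sqrt lam
              \<ge> 395 * 8 * \<sigma> * op_norm \<Sigma> * sqrt ((eff_rank \<Sigma> + ln (4 / \<delta>)) / real n)"
           "sqrt lam
              \<ge> 395 * 8 * C * op_norm \<Sigma> * sqrt ((eff_rank \<Sigma> + ln (4 / \<delta>)) / real n)"
    and f: "{k\<in>{1..CARD('d)}. (eig k)\<^sup>2 \<ge> 2 * lam} \<noteq> {}"
           "k = k_star CARD('d) eig lam"
           "(1 + 2 * lam / (op_norm \<Sigma>)\<^sup>2)\<^sup>2 * (real k + tail_rank CARD('d) eig 4 k) + ln (4 / \<delta>)
              \<le> real n"
           "real k + tail_rank CARD('d) eig 2 k + 0.25 * ln (4 / \<delta>) \<le> real n"
    and minimizer: "\<And>\<omega>. \<omega> \<in> space P \<Longrightarrow>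
           is_theta_minimizer n (\<lambda>i. X i \<omega>) (\<lambda>i. Y i \<omega>) \<mu> lam (\<theta>hat \<omega>)"
  shows "\<exists>E\<in>sets P. measure P E \<ge> 1 - 8 * \<delta> \<and> (\<forall>\<omega>\<in>E.
           norm (mat_sqrt \<Sigma> *v (\<theta>hat \<omega> - \<theta>\<^sub>0))
           \<le> norm (mat_sqrt \<Sigma> *v bias_vec \<Sigma> lam \<theta>\<^sub>0)
             + 4 * (2 * \<sigma> + C * norm (mat_sqrt \<Sigma> *v bias_vec \<Sigma> lam \<theta>\<^sub>0))
                 * sqrt ((real k + tail_rank CARD('d) eig 4 k + ln (4 / \<delta>)) / real n)
             + 2 * C * norm ((\<Sigma> ** mat_sqrt \<Sigma>) *v bias_vec \<Sigma> lam \<theta>\<^sub>0) / sqrt (2 * lam)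
                 * sqrt ((4 * real k + 4 * tail_rank CARD('d) eig 2 k + ln (4 / \<delta>)) / real n)
             + remainder_term \<Sigma> \<theta>\<^sub>0 \<sigma> C \<mu> lam n \<delta>)"
proof -
  interpret prob_space P by (rule P)
  define K where "K = ln (2 / \<delta>)"
  define L where "L = ln (4 / \<delta>)"
  have KL: "0 < K" "K \<le> L" "0 < L"
  proof -
    have "1 < 2 / \<delta>" using params(1,2) by simp
    thus K: "0 < K" unfolding K_def by (rule ln_gt_zero)
    show "K \<le> L" unfolding K_def L_def using params(1) by (intro ln_mono divide_right_mono) auto
    with K show "0 < L" by simp
  qed
  have Cpos: "0 < C" using Q by (simp add: assumption_Q_def)
  have \<sigma>: "0 \<le> \<sigma>" using N by (simp add: assumption_N_def)

  have n: "0 < n"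
  proof (rule ccontr)
    assume "\<not> 0 < n"
    hence "real n = 0" by simp
    thus False using b(1) KL(3) zero_le_power2[of "eff_rank \<Sigma>"] unfolding L_def[symmetric] by linarith
  qed
  have measX: "X i \<in> borel_measurable P" if "i \<in> {1..n}" for i
    using iid_pairs_measurable(1)[OF P iid that] .
  have mX1: "X 1 \<in> borel_measurable P" by (rule measX) (use n in simp)
  have quad: "x \<bullet> (\<Sigma> *v y) = (\<integral>\<omega>. (x \<bullet> X 1 \<omega>) * (X 1 \<omega> \<bullet> y) \<partial>P)" for x y
    unfolding Sigma by (rule second_moment_inner[OF mX1 moment])
  have symS: "transpose \<Sigma> = \<Sigma>"
    unfolding Sigma by (rule second_moment_symmetric[OF mX1 moment])
  \<comment> \<open>\<open>\<Sigma>\<close> is diagonalised; invertibility makes all eigenvalues \<open>l i\<close> positive, and \<open>M\<close> is the largest of them.\<close>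
  obtain e l where "orthonormal_eigenbasis \<Sigma> e l" by (rule symmetric_has_orthonormal_eigenbasis[OF symS])
  then interpret B: orthonormal_eigenbasis \<Sigma> e l .
  note el = B.orthonormal B.eigen
  have l: "0 < l i" for i
  proof -
    have "l i = e i \<bullet> (\<Sigma> *v e i)" by (simp add: el)
    also have "\<dots> \<ge> 0" unfolding quad by (intro integral_nonneg_AE AE_I2) (simp add: inner_commute)
    finally have "0 \<le> l i" .
    moreover have "l i \<noteq> 0"
    proof
      assume "l i = 0"
      hence "\<Sigma> *v e i = 0" by (simp add: el)
      hence "e i = 0" using inv by (metis invertible_def matrix_vector_mul_assoc matrix_vector_mul_lid matrix_vector_mult_0_right)
      thus False using el(1)[of i i] by simp
    qed
    ultimately show ?thesis by simp
  qed
  define S where "S = mat_sqrt \<Sigma>"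
  define W where "W = matrix_inv S"
  have psdS: "psd S" and SS: "S ** S = \<Sigma>" and Se: "\<And>i. S *v e i = sqrt (l i) *\<^sub>R e i"
    unfolding S_def by (rule B.mat_sqrt_eigen[OF less_imp_le[OF l]])+
  have symSq: "transpose S = S" using psdS by (simp add: psd_def)
  have invS: "invertible S"
    using inv unfolding SS[symmetric] invertible_det_nz det_mul by simp
  have SW: "S *v (W *v z) = z" for z
  proof -
    have "S ** W = mat 1" unfolding W_def matrix_inv_def
      using someI_ex[OF invS[unfolded invertible_def]] by blast
    thus ?thesis by (simp add: matrix_vector_mul_assoc)
  qed
  define M where "M = op_norm \<Sigma>"
  have M: "M = Max (range l)" unfolding M_def by (rule B.op_norm_eigen) (rule less_imp_le[OF l])
  have lM: "l i \<le> M" for i unfolding M by simp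
  have Mpos: "0 < M" using l[of undefined] lM[of undefined] by linarith
  define r where "r = eff_rank \<Sigma>"
  have r: "r = (\<Sum>i\<in>UNIV. l i / M)" by (simp add: r_def eff_rank_def B.trace_eigen M_def sum_divide_distrib)
  have r1: "1 \<le> r"
  proof -
    have "M \<in> range l" unfolding M by (rule Max_in) auto
    then obtain i where "l i = M" by auto
    hence "1 = l i / M" using Mpos by simp
    also have "\<dots> \<le> r" unfolding r by (rule member_le_sum) (use l Mpos in \<open>auto intro: less_imp_le divide_nonneg_pos\<close>)
    finally show ?thesis .
  qed
  have rr: "r \<le> r\<^sup>2" using r1 by (simp add: power2_eq_square)

  define N0 where "N0 = norm \<theta>\<^sub>0"
  have N0: "0 < N0" using theta0 by (simp add: N0_def)
  define q where "q = lam powr (1/4)"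
  have q: "0 < q" using params by (simp add: q_def)
  have q_power: "q ^ m = lam powr (real m / 4)" for m
    using q powr_realpow[of q m] by (simp add: q_def powr_powr)
  have q4: "q ^ 4 = lam" and q2: "q\<^sup>2 = sqrt lam"
    using params(4) by (simp_all add: q_power powr_half_sqrt)
  define cc where "cc = sqrt (2 * lam)"
  have cc: "0 < cc" "cc\<^sup>2 = 2 * lam" using params by (auto simp: cc_def)
  have two_lam: "2 * lam \<le> M\<^sup>2" unfolding M_def by (rule B.large_eigenvalue[OF eig l params(4) f(1)])
  have qM: "q\<^sup>2 \<le> M" unfolding q2 using two_lam params Mpos by (intro real_le_lsqrt) auto
  obtain R where R: "\<And>z. \<Sigma> *v (\<Sigma> *v (R *v z)) + cc\<^sup>2 *\<^sub>R (R *v z) = z" "\<And>z. R *v (\<Sigma> *v z) = \<Sigma> *v (R *v z)"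
    using sym_matrix_resolvent_exists[OF symS cc(1)] by metis
  define b where "b = bias_vec \<Sigma> lam \<theta>\<^sub>0"
  have b_eq: "\<Sigma> *v (\<Sigma> *v b) + (2 * lam) *\<^sub>R b = - ((2 * lam) *\<^sub>R \<theta>\<^sub>0)"
    unfolding b_def by (rule bias_vec_equation[OF symS params(4)])

  \<comment> \<open>\<open>S\<close>, \<open>\<Sigma>\<close> and the resolvent \<open>R\<close> are simultaneously diagonal.\<close>
  have Sc: "(S *v y) \<bullet> e i = sqrt (l i) * (y \<bullet> e i)" for y i
    using symmetric_inner_mult[OF symSq, of y "e i"] by (simp add: Se)
  have Ac: "(\<Sigma> *v y) \<bullet> e i = l i * (y \<bullet> e i)" for y i
    using symmetric_inner_mult[OF symS, of y "e i"] by (simp add: el)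
  have Rc: "(R *v y) \<bullet> e i = (y \<bullet> e i) / ((l i)\<^sup>2 + 2 * lam)" for y i
  proof -
    have "y \<bullet> e i = (\<Sigma> *v (\<Sigma> *v (R *v y)) + cc\<^sup>2 *\<^sub>R (R *v y)) \<bullet> e i" by (simp only: R(1))
    also have "\<dots> = ((l i)\<^sup>2 + 2 * lam) * ((R *v y) \<bullet> e i)"
      unfolding inner_add_left inner_scaleR_left Ac cc(2) by (simp add: power2_eq_square algebra_simps)
    finally have "((l i)\<^sup>2 + 2 * lam) * ((R *v y) \<bullet> e i) = y \<bullet> e i" by (rule sym)
    moreover have "(l i)\<^sup>2 + 2 * lam \<noteq> 0" using params(4) by (metis add_nonneg_pos less_irrefl mult_pos_pos zero_le_power2 zero_less_numeral)
    ultimately show ?thesis by (metis nonzero_mult_div_cancel_left)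
  qed

  \<comment> \<open>\<open>g1\<close> is the symbol of \<open>S R \<Sigma> S\<close>, and \<open>g2\<close> that of \<open>2 cc S R S\<close>; the factor \<open>2 cc\<close> makes \<open>g2 \<le> 1\<close> sharp.\<close>
  define g1 where "g1 x = x\<^sup>2 / (x\<^sup>2 + 2 * lam)" for x :: real
  define g2 where "g2 x = 2 * cc * x / (x\<^sup>2 + 2 * lam)" for x :: real
  define p1 where "p1 = real k + tail_rank CARD('d) eig 4 k"
  define p2 where "p2 = 4 * (real k + tail_rank CARD('d) eig 2 k)"
  have g1: "\<bar>g1 x\<bar> \<le> 1" "(g1 x)\<^sup>2 \<le> 1" "(g1 x)\<^sup>2 \<le> (x\<^sup>2 / (2 * lam))\<^sup>2" for x
  proof -
    have "0 \<le> g1 x" using params(4) by (simp add: g1_def)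
    moreover have "g1 x \<le> 1" using params(4) by (simp add: g1_def add_nonneg_pos divide_le_eq)
    ultimately show 1: "\<bar>g1 x\<bar> \<le> 1" by simp
    thus "(g1 x)\<^sup>2 \<le> 1" by (simp add: abs_square_le_1)
    have "g1 x \<le> x\<^sup>2 / (2 * lam)" unfolding g1_def using params(4) by (intro divide_left_mono) (auto intro!: mult_pos_pos add_nonneg_pos)
    thus "(g1 x)\<^sup>2 \<le> (x\<^sup>2 / (2 * lam))\<^sup>2" using \<open>0 \<le> g1 x\<close> by (intro power_mono)
  qed
  have g1_coord: "sqrt (l i) * (l i * (sqrt (l i) * y) / ((l i)\<^sup>2 + 2 * lam)) = g1 (l i) * y" for i y
  proof -
    have "sqrt (l i) * (l i * (sqrt (l i) * y) / ((l i)\<^sup>2 + 2 * lam)) = (sqrt (l i) * sqrt (l i)) * l i * y / ((l i)\<^sup>2 + 2 * lam)"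
      by (simp only: times_divide_eq_right ac_simps)
    also have "sqrt (l i) * sqrt (l i) = l i" using l[of i] by simp
    finally show ?thesis by (simp add: g1_def power2_eq_square)
  qed
  have g2: "\<bar>g2 x\<bar> \<le> 1" "(g2 x)\<^sup>2 \<le> 4" "(g2 x)\<^sup>2 \<le> 4 * (x\<^sup>2 / (2 * lam))" if x: "0 < x" for x
  proof -
    have den: "0 < x\<^sup>2 + 2 * lam" using params(4) by (intro add_nonneg_pos) auto
    have "2 * cc * x \<le> x\<^sup>2 + 2 * lam"
      using sum_squares_bound[of x cc] cc(2) by (simp add: ac_simps)
    moreover have "0 \<le> g2 x" using x cc den by (simp add: g2_def)
    moreover have "g2 x \<le> 1" unfolding g2_def using den calculation(1) by (simp only: divide_le_eq_1_pos)
    ultimately show 1: "\<bar>g2 x\<bar> \<le> 1" by simp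
    hence "(g2 x)\<^sup>2 \<le> 1" by (simp add: abs_square_le_1)
    thus "(g2 x)\<^sup>2 \<le> 4" by simp
    have "g2 x \<le> 2 * cc * x / (2 * lam)" unfolding g2_def using params(4) x cc den by (intro divide_left_mono) auto
    hence "(g2 x)\<^sup>2 \<le> (2 * cc * x / (2 * lam))\<^sup>2" using \<open>0 \<le> g2 x\<close> by (intro power_mono)
    also have "\<dots> = 4 * cc\<^sup>2 * x\<^sup>2 / (2 * lam)\<^sup>2" by (simp add: power_mult_distrib power_divide)
    also have "\<dots> = 4 * (x\<^sup>2 / (2 * lam))" unfolding cc(2) using params(4) by (simp add: power2_eq_square)
    finally show "(g2 x)\<^sup>2 \<le> 4 * (x\<^sup>2 / (2 * lam))" .
  qed
  have s1: "(\<Sum>i\<in>UNIV. (g1 (l i))\<^sup>2) \<le> p1" and k1: "1 \<le> k"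
    using B.sum_by_effective_rank[OF eig l params(4) f(1) f(2), of "\<lambda>x. (g1 x)\<^sup>2" 1 2] g1 by (auto simp: p1_def)
  have s2: "(\<Sum>i\<in>UNIV. (g2 (l i))\<^sup>2) \<le> p2"
    using B.sum_by_effective_rank(1)[OF eig l params(4) f(1) f(2), of "\<lambda>x. (g2 x)\<^sup>2" 4 1] g2 by (auto simp: p2_def)
  have tail0: "0 \<le> tail_rank CARD('d) eig a k" for a by (simp add: tail_rank_def sum_nonneg)
  have p1: "0 < p1" using k1 tail0[of 4] by (simp add: p1_def add_pos_nonneg)
  have p2: "0 < p2" using k1 tail0[of 2] by (simp add: p2_def add_pos_nonneg)
  have p1n: "p1 \<le> 4 * real n"
  proof -
    have "1 \<le> 1 + 2 * lam / M\<^sup>2" using params(4) Mpos by simp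
    hence "1 * p1 \<le> (1 + 2 * lam / M\<^sup>2)\<^sup>2 * p1" using p1 by (intro mult_right_mono) (auto intro: one_le_power)
    thus ?thesis using f(3) KL unfolding p1_def[symmetric] M_def[symmetric] L_def[symmetric] by linarith
  qed
  have p2n: "p2 \<le> 4 * real n" using f(4) KL unfolding p2_def L_def[symmetric] by simp
  have Kn: "4096 * K \<le> real n"
  proof -
    have "1 * (0 + K) \<le> (1 + C)\<^sup>2 * (r + K)"
      using Cpos KL r1 by (intro mult_mono) (auto intro: one_le_power)
    thus ?thesis using b(2) unfolding r_def[symmetric] K_def[symmetric] by simp
  qed
  have rn: "r\<^sup>2 \<le> 4 * real n" "r \<le> 4 * real n"
    using b(1) KL rr r1 unfolding r_def[symmetric] L_def[symmetric] by auto

  \<comment> \<open>Five exceptional events, each of probability at most \<open>\<delta>\<close>: the three linear terms, the noise and the covariance error.\<close>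
  let ?\<xi> = "whitened_noise W n X \<epsilon>" and ?E = "whitened_error W n X"
  define v1 where "v1 = S *v b"
  define v2 where "v2 = (\<Sigma> ** S) *v b"
  define w where "w i = sqrt (l i / M)" for i
  have w: "\<bar>w i\<bar> \<le> 1" "(w i)\<^sup>2 = l i / M" for i
    using l[of i] lM[of i] Mpos by (auto simp: w_def)
  have sw: "(\<Sum>i\<in>UNIV. (w i)\<^sup>2) = r" unfolding w(2) r ..
  obtain B1 where B1: "B1 \<in> sets P" "prob B1 \<le> \<delta>"
    "\<And>\<omega>. \<omega> \<in> space P - B1 \<Longrightarrow> sqrt (\<Sum>i\<in>UNIV. (g1 (l i) * (?\<xi> \<omega> \<bullet> e i))\<^sup>2) \<le> 4 * \<sigma> * sqrt ((p1 + K) / real n)"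
    by (rule B.noise_deviation[OF P iid n N g1(1) s1 p1 params(1,2) p1n Kn[unfolded K_def], folded S_def K_def, folded W_def], rule that)
  obtain B2 where B2: "B2 \<in> sets P" "prob B2 \<le> \<delta>"
    "\<And>\<omega>. \<omega> \<in> space P - B2 \<Longrightarrow> sqrt (\<Sum>i\<in>UNIV. (g1 (l i) * ((?E \<omega> *v v1) \<bullet> e i))\<^sup>2) \<le> 4 * (C * norm v1) * sqrt ((p1 + K) / real n)"
    by (rule B.error_vector_deviation[OF P iid n Q g1(1) s1 p1 params(1,2) p1n Kn[unfolded K_def], where v=v1, folded S_def K_def, folded W_def], rule that)
  obtain B3 where B3: "B3 \<in> sets P" "prob B3 \<le> \<delta>"
    "\<And>\<omega>. \<omega> \<in> space P - B3 \<Longrightarrow> sqrt (\<Sum>i\<in>UNIV. (g2 (l i) * ((?E \<omega> *v v2) \<bullet> e i))\<^sup>2) \<le> 4 * (C * norm v2) * sqrt ((p2 + K) / real n)"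
    by (rule B.error_vector_deviation[OF P iid n Q g2(1)[OF l] s2 p2 params(1,2) p2n Kn[unfolded K_def], where v=v2, folded S_def K_def, folded W_def], rule that)
  have r0: "0 < r" using r1 by linarith
  obtain B4 where B4: "B4 \<in> sets P" "prob B4 \<le> \<delta>"
    "\<And>\<omega>. \<omega> \<in> space P - B4 \<Longrightarrow> sqrt (\<Sum>i\<in>UNIV. (w i * (?\<xi> \<omega> \<bullet> e i))\<^sup>2) \<le> 4 * \<sigma> * sqrt ((r + K) / real n)"
    by (rule B.noise_deviation[OF P iid n N w(1) eq_refl[OF sw] r0 params(1,2) rn(2) Kn[unfolded K_def], folded S_def K_def, folded W_def], rule that)
  obtain B5 where B5: "B5 \<in> sets P" "prob B5 \<le> \<delta>"
    "\<And>\<omega>. \<omega> \<in> space P - B5 \<Longrightarrow> sqrt (\<Sum>q\<in>UNIV. ((w (fst q) * w (snd q)) * (e (fst q) \<bullet> (?E \<omega> *v e (snd q))))\<^sup>2) \<le> 4 * C * sqrt ((r\<^sup>2 + K) / real n)"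
    by (rule B.error_matrix_deviation[OF P iid n Q w(1) sw r0 params(1,2) rn(1) Kn[unfolded K_def], folded S_def K_def, folded W_def], rule that)
  define G where "G = space P - (B1 \<union> B2 \<union> B3 \<union> B4 \<union> B5)"
  have GP: "G \<in> sets P" using B1 B2 B3 B4 B5 by (auto simp: G_def)
  have measG: "1 - 8 * \<delta> \<le> prob G"
  proof -
    have "prob (B1 \<union> B2 \<union> B3 \<union> B4 \<union> B5) \<le> prob B1 + prob B2 + prob B3 + prob B4 + prob B5"
      using B1(1) B2(1) B3(1) B4(1) B5(1)
      by (intro order_trans[OF measure_Un_le] add_mono order_refl sets.Un)
    also have "\<dots> \<le> 5 * \<delta>" using B1(2) B2(2) B3(2) B4(2) B5(2) by simp
    also have "\<dots> \<le> 8 * \<delta>" using params by simp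
    finally show ?thesis unfolding G_def using B1(1) B2(1) B3(1) B4(1) B5(1) by (subst prob_compl) auto
  qed

  show ?thesis
  proof (intro bexI[OF _ GP] conjI measG ballI)
    fix \<omega> assume \<omega>G: "\<omega> \<in> G"
    hence \<omega>: "\<omega> \<in> space P" and \<omega>s: "\<omega> \<in> space P - B1" "\<omega> \<in> space P - B2" "\<omega> \<in> space P - B3" "\<omega> \<in> space P - B4" "\<omega> \<in> space P - B5"
      by (auto simp: G_def)
    define T where "T = Sigma_hat n (\<lambda>i. X i \<omega>)"
    define \<xi> where "\<xi> = S *v ?\<xi> \<omega>"
    define \<theta> where "\<theta> = \<theta>hat \<omega>"
    define \<Delta> where "\<Delta> = \<theta> - \<theta>\<^sub>0"
    have Zeq: "Z_vec n (\<lambda>i. X i \<omega>) (\<lambda>i. Y i \<omega>) = T *v \<theta>\<^sub>0 + \<xi>"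
      unfolding T_def \<xi>_def by (rule Z_vec_whitened[where \<omega>=\<omega> and X=X and Y=Y and \<epsilon>=\<epsilon>, OF SW Y[OF _ \<omega>]])
    have Eeq: "(T - \<Sigma>) *v z = S *v (?E \<omega> *v (S *v z))" for z
      unfolding T_def by (rule Sigma_hat_error_whitened[where \<omega>=\<omega> and X=X, OF SW symSq SS])
    have symT: "transpose T = T" unfolding T_def by (rule Sigma_hat_symmetric)
    define Qn where "Qn = sqrt ((r\<^sup>2 + L) / real n)"
    have \<xi>norm: "norm \<xi> \<le> 4 * \<sigma> * sqrt M * sqrt ((r + K) / real n)"
    proof -
      have "norm \<xi> = sqrt M * sqrt (\<Sum>i\<in>UNIV. (w i * (?\<xi> \<omega> \<bullet> e i))\<^sup>2)"
      proof -
        have "sqrt (l i) = sqrt M * w i" for i using Mpos by (simp add: w_def real_sqrt_mult[symmetric])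
        hence "norm \<xi> = sqrt (\<Sum>i\<in>UNIV. M * (w i * (?\<xi> \<omega> \<bullet> e i))\<^sup>2)"
          unfolding B.norm_coords \<xi>_def Sc using Mpos by (simp add: power_mult_distrib mult.assoc)
        thus ?thesis by (simp add: sum_distrib_left[symmetric] real_sqrt_mult)
      qed
      also have "\<dots> \<le> sqrt M * (4 * \<sigma> * sqrt ((r + K) / real n))" using B4(3)[OF \<omega>s(4)] Mpos by (intro mult_left_mono) auto
      finally show ?thesis by (simp add: ac_simps)
    qed
    let ?H = "\<Sum>q\<in>UNIV. ((w (fst q) * w (snd q)) * (e (fst q) \<bullet> (?E \<omega> *v e (snd q))))\<^sup>2"
    have Enorm: "norm (T - \<Sigma>) \<le> 4 * C * M * Qn"
    proof -
      have "norm (T - \<Sigma>) = M * sqrt ?H"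
      proof -
        have "e i \<bullet> ((T - \<Sigma>) *v e j) = M * ((w i * w j) * (e i \<bullet> (?E \<omega> *v e j)))" for i j
        proof -
          have "e i \<bullet> ((T - \<Sigma>) *v e j) = sqrt (l i) * sqrt (l j) * (e i \<bullet> (?E \<omega> *v e j))"
            unfolding Eeq Se matrix_vector_mult_scaleR inner_scaleR_right inner_commute[of "e i"] Sc by simp
          also have "sqrt (l i) * sqrt (l j) = M * (w i * w j)" using Mpos by (simp add: w_def real_sqrt_divide)
          finally show ?thesis by simp
        qed
        hence "(norm (T - \<Sigma>))\<^sup>2 = M\<^sup>2 * ?H"
          unfolding B.matrix_norm_sq by (simp add: power_mult_distrib sum_distrib_left)
        hence "sqrt ((norm (T - \<Sigma>))\<^sup>2) = sqrt (M\<^sup>2 * ?H)"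
          by simp
        thus ?thesis using Mpos by (simp add: real_sqrt_mult)
      qed
      also have "\<dots> \<le> M * (4 * C * Qn)"
      proof (rule mult_left_mono)
        have "sqrt ((r\<^sup>2 + K) / real n) \<le> Qn" unfolding Qn_def using KL by (simp add: divide_right_mono)
        hence "4 * C * sqrt ((r\<^sup>2 + K) / real n) \<le> 4 * C * Qn" using Cpos by simp
        thus "sqrt ?H \<le> 4 * C * Qn"
          using B5(3)[OF \<omega>s(5)] by linarith
      qed (use Mpos in simp)
      finally show ?thesis by (simp add: ac_simps)
    qed
    \<comment> \<open>As \<open>196 = 14\<^sup>2\<close>, the bounds \<open>4 a N0 Qn\<close> for the noise and \<open>4 C M Qn\<close> for the covariance error add up to \<open>2/7 \<psi> N0\<close>.\<close>
    define \<psi> where "\<psi> = sqrt (Psi_term \<Sigma> \<theta>\<^sub>0 \<sigma> C n \<delta>)"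
    define a where "a = \<sigma> * sqrt M / N0"
    have a_nonneg: "0 \<le> a" "a * N0 = \<sigma> * sqrt M" using \<sigma> Mpos N0 by (auto simp: a_def)
    have \<psi>eq: "\<psi> = 14 * (a + 2 * C * M) * Qn"
    proof -
      have "\<psi> = sqrt (14\<^sup>2 * (a + 2 * C * M)\<^sup>2 * ((r\<^sup>2 + L) / real n))"
        unfolding \<psi>_def Psi_term_def r_def[symmetric] L_def[symmetric] M_def[symmetric] N0_def[symmetric] a_def[symmetric] by simp
      also have "\<dots> = 14 * (a + 2 * C * M) * Qn"
        unfolding real_sqrt_mult Qn_def using a_nonneg Cpos Mpos by (simp add: add_nonneg_nonneg)
      finally show ?thesis .
    qed
    have Qn0: "0 \<le> Qn" using KL by (simp add: Qn_def)
    have \<psi>0: "0 \<le> \<psi>" unfolding \<psi>eq using a_nonneg Cpos Mpos Qn0 by (simp add: add_nonneg_nonneg)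
    have \<xi>E: "norm \<xi> + 2 * norm (T - \<Sigma>) * norm \<theta>\<^sub>0 \<le> 2 / 7 * \<psi> * norm \<theta>\<^sub>0"
    proof -
      have "sqrt ((r + K) / real n) \<le> Qn" unfolding Qn_def using KL rr by (simp add: divide_right_mono)
      hence "4 * \<sigma> * sqrt M * sqrt ((r + K) / real n) \<le> 4 * \<sigma> * sqrt M * Qn" using \<sigma> Mpos by (intro mult_left_mono) auto
      hence "norm \<xi> \<le> 4 * (a * N0) * Qn" using \<xi>norm unfolding a_nonneg(2) by (simp add: mult.assoc)
      moreover have "2 * norm (T - \<Sigma>) * N0 \<le> 2 * (4 * C * M * Qn) * N0"
        using Enorm N0 by (intro mult_right_mono mult_left_mono) auto
      ultimately show ?thesis unfolding \<psi>eq N0_def[symmetric] by (simp add: algebra_simps)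
    qed
    have \<xi>small: "norm \<xi> \<le> 4 / 5 * (N0 * sqrt lam)"
    proof -
      have "sqrt ((r + K) / real n) \<le> sqrt ((r + L) / real n)" using KL by (simp add: divide_right_mono)
      hence "4 * \<sigma> * sqrt M * sqrt ((r + K) / real n) \<le> 4 * \<sigma> * sqrt M * sqrt ((r + L) / real n)"
        using \<sigma> Mpos by (intro mult_left_mono) auto
      moreover have "5 * \<sigma> * sqrt M * sqrt ((r + L) / real n) \<le> N0 * sqrt lam"
      proof -
        have "N0 * min (sqrt lam) M \<le> N0 * sqrt lam" using N0 by (intro mult_left_mono) auto
        thus ?thesis using c(3) unfolding M_def[symmetric] r_def[symmetric] L_def[symmetric] N0_def[symmetric] by linarith
      qed
      ultimately show ?thesis using \<xi>norm by linarith
    qed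
    obtain g where g: "(T *v \<theta>\<^sub>0 + \<xi>) - T *v \<theta> = (2 + (norm \<theta>)\<^sup>2 / \<mu>\<^sup>2) *\<^sub>R g"
      "T *v g = (lam - (norm g)\<^sup>2 / \<mu>\<^sup>2) *\<^sub>R \<theta>"
      "\<And>\<theta>'. (norm g)\<^sup>2 + lam / 2 * (norm \<theta>)\<^sup>2 \<le> (norm ((T *v \<theta>\<^sub>0 + \<xi>) - T *v \<theta>'))\<^sup>2 / 4 + lam / 2 * (norm \<theta>')\<^sup>2"
      using minimizer_stationarity[OF minimizer[OF \<omega>] params(3)] unfolding Zeq T_def[symmetric] \<theta>_def[symmetric] by blast
    have gle: "(norm g)\<^sup>2 + lam / 2 * (norm \<theta>)\<^sup>2 \<le> (norm \<xi>)\<^sup>2 / 4 + lam / 2 * N0\<^sup>2"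
      using g(3)[of \<theta>\<^sub>0] by (simp add: N0_def)
    have aN: "N0 \<le> \<mu> / 420" using a(1) by (simp add: N0_def)
    obtain \<rho> where \<rho>: "(2 + (norm \<theta>)\<^sup>2 / \<mu>\<^sup>2) * (lam - (norm g)\<^sup>2 / \<mu>\<^sup>2) = (1 + \<rho>) * (2 * lam)"
      "\<bar>\<rho>\<bar> \<le> (N0 / \<mu>)\<^sup>2" "(N0 / \<mu>)\<^sup>2 \<le> 1 / 100"
      by (rule effective_regularisation[OF params(4) params(3) norm_ge_zero norm_ge_zero aN less_imp_le[OF N0] norm_ge_zero \<xi>small gle])
    have \<Delta>eq: "T *v (T *v \<Delta>) + ((1 + \<rho>) * (2 * q^4)) *\<^sub>R \<Delta> = T *v \<xi> - ((1 + \<rho>) * (2 * q^4)) *\<^sub>R \<theta>\<^sub>0"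
    proof -
      have "\<xi> - T *v \<Delta> = (2 + (norm \<theta>)\<^sup>2 / \<mu>\<^sup>2) *\<^sub>R g"
        unfolding g(1)[symmetric] by (simp add: \<Delta>_def matrix_vector_mult_diff_distrib)
      hence "T *v (\<xi> - T *v \<Delta>) = (2 + (norm \<theta>)\<^sup>2 / \<mu>\<^sup>2) *\<^sub>R (T *v g)" by (simp only: matrix_vector_mult_scaleR)
      also have "\<dots> = ((1 + \<rho>) * (2 * lam)) *\<^sub>R \<theta>" unfolding g(2) scaleR_scaleR \<rho>(1) ..
      also have "\<theta> = \<Delta> + \<theta>\<^sub>0" by (simp add: \<Delta>_def)
      finally have "T *v \<xi> - T *v (T *v \<Delta>) = ((1 + \<rho>) * (2 * lam)) *\<^sub>R \<Delta> + ((1 + \<rho>) * (2 * lam)) *\<^sub>R \<theta>\<^sub>0"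
        by (simp only: matrix_vector_mult_diff_distrib scaleR_right_distrib)
      thus ?thesis unfolding q4 by (simp add: algebra_simps)
    qed
    have onM: "norm (\<Sigma> *v z) \<le> M * norm z" for z
      unfolding M_def by (rule onorm[OF matrix_vector_mul_bounded_linear])
    have main: "norm (S *v \<Delta>) \<le> norm (S *v b) + norm (S *v (R *v (\<Sigma> *v \<xi>)))
      + norm (S *v (R *v (\<Sigma> *v ((T - \<Sigma>) *v b)))) + norm (S *v (R *v ((T - \<Sigma>) *v (\<Sigma> *v b))))
      + 2 * (N0 / \<mu>)\<^sup>2 * sqrt M * norm b + (N0 / \<mu>)\<^sup>2 * \<psi> * norm \<theta>\<^sub>0 / q + \<psi>\<^sup>2 * norm \<theta>\<^sub>0 / q^3"
      by (rule perturbation_bound[OF symS symT symSq SS q \<rho>(2,3) \<Delta>eq b_eq[folded q4] R(1)[unfolded cc(2), folded q4] R(2) onM qM \<xi>E \<psi>0])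
    \<comment> \<open>The linear terms are the diagonal statistics controlled on the first three events.\<close>
    have t1: "norm (S *v (R *v (\<Sigma> *v \<xi>))) \<le> 4 * (2 * \<sigma>) * sqrt ((p1 + L) / real n)"
    proof -
      have "norm (S *v (R *v (\<Sigma> *v \<xi>))) = sqrt (\<Sum>i\<in>UNIV. (g1 (l i) * (?\<xi> \<omega> \<bullet> e i))\<^sup>2)"
        unfolding B.norm_coords Sc Rc Ac \<xi>_def g1_coord ..
      also have "\<dots> \<le> 4 * \<sigma> * sqrt ((p1 + K) / real n)" by (rule B1(3)[OF \<omega>s(1)])
      also have "\<dots> \<le> 4 * (2 * \<sigma>) * sqrt ((p1 + L) / real n)"
        using KL \<sigma> p1 by (intro mult_mono real_sqrt_le_mono divide_right_mono) auto
      finally show ?thesis .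
    qed
    have t2: "norm (S *v (R *v (\<Sigma> *v ((T - \<Sigma>) *v b)))) \<le> 4 * (C * norm v1) * sqrt ((p1 + L) / real n)"
    proof -
      have "norm (S *v (R *v (\<Sigma> *v ((T - \<Sigma>) *v b)))) = sqrt (\<Sum>i\<in>UNIV. (g1 (l i) * ((?E \<omega> *v v1) \<bullet> e i))\<^sup>2)"
        unfolding B.norm_coords Eeq Sc Rc Ac v1_def g1_coord ..
      also have "\<dots> \<le> 4 * (C * norm v1) * sqrt ((p1 + K) / real n)" by (rule B2(3)[OF \<omega>s(2)])
      also have "\<dots> \<le> 4 * (C * norm v1) * sqrt ((p1 + L) / real n)"
        using KL Cpos p1 by (intro mult_left_mono real_sqrt_le_mono divide_right_mono) auto
      finally show ?thesis .
    qed
    have t3: "norm (S *v (R *v ((T - \<Sigma>) *v (\<Sigma> *v b)))) \<le> 2 * C * norm v2 / sqrt (2 * lam) * sqrt ((p2 + L) / real n)"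
    proof -
      have SA: "S *v (\<Sigma> *v b) = v2"
        unfolding v2_def SS[symmetric] by (simp add: matrix_vector_mul_assoc matrix_mul_assoc)
      have "norm (S *v (R *v ((T - \<Sigma>) *v (\<Sigma> *v b)))) = sqrt (\<Sum>i\<in>UNIV. (1 / (2 * cc))\<^sup>2 * (g2 (l i) * ((?E \<omega> *v v2) \<bullet> e i))\<^sup>2)"
        unfolding B.norm_coords Eeq Sc Rc SA power_mult_distrib[symmetric]
      proof (intro arg_cong[where f=sqrt] sum.cong refl arg_cong[where f="\<lambda>x. x\<^sup>2"])
        fix i
        let ?z = "(?E \<omega> *v v2) \<bullet> e i"
        have "sqrt (l i) * (sqrt (l i) * ?z / ((l i)\<^sup>2 + 2 * lam)) = l i * ?z / ((l i)\<^sup>2 + 2 * lam)"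
          using l[of i] by (simp add: mult.assoc[symmetric])
        also have "\<dots> = 1 / (2 * cc) * (g2 (l i) * ?z)" using cc(1) by (simp add: g2_def)
        finally show "sqrt (l i) * (sqrt (l i) * ?z / ((l i)\<^sup>2 + 2 * lam)) = 1 / (2 * cc) * (g2 (l i) * ?z)" .
      qed
      also have "\<dots> = 1 / (2 * cc) * sqrt (\<Sum>i\<in>UNIV. (g2 (l i) * ((?E \<omega> *v v2) \<bullet> e i))\<^sup>2)"
        unfolding sum_distrib_left[symmetric] real_sqrt_mult using cc(1) by simp
      also have "\<dots> \<le> 1 / (2 * cc) * (4 * (C * norm v2) * sqrt ((p2 + L) / real n))"
      proof (rule mult_left_mono)
        have "4 * (C * norm v2) * sqrt ((p2 + K) / real n) \<le> 4 * (C * norm v2) * sqrt ((p2 + L) / real n)"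
          using KL Cpos p2 by (intro mult_left_mono real_sqrt_le_mono divide_right_mono) auto
        thus "sqrt (\<Sum>i\<in>UNIV. (g2 (l i) * ((?E \<omega> *v v2) \<bullet> e i))\<^sup>2) \<le> 4 * (C * norm v2) * sqrt ((p2 + L) / real n)"
          using B3(3)[OF \<omega>s(3)] by linarith
      qed (use cc in simp)
      also have "\<dots> = 2 * C * norm v2 / cc * sqrt ((p2 + L) / real n)" by simp
      finally show ?thesis unfolding cc_def .
    qed
    have rem: "2 * (N0 / \<mu>)\<^sup>2 * sqrt M * norm b + (N0 / \<mu>)\<^sup>2 * \<psi> * norm \<theta>\<^sub>0 / q + \<psi>\<^sup>2 * norm \<theta>\<^sub>0 / q^3
        \<le> remainder_term \<Sigma> \<theta>\<^sub>0 \<sigma> C \<mu> lam n \<delta>"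
      unfolding N0_def M_def b_def q_def \<psi>_def
      by (rule remainder_term_lower_bound) (use params aN N0_def in auto)
    show "norm (mat_sqrt \<Sigma> *v (\<theta>hat \<omega> - \<theta>\<^sub>0))
           \<le> norm (mat_sqrt \<Sigma> *v bias_vec \<Sigma> lam \<theta>\<^sub>0)
             + 4 * (2 * \<sigma> + C * norm (mat_sqrt \<Sigma> *v bias_vec \<Sigma> lam \<theta>\<^sub>0))
                 * sqrt ((real k + tail_rank CARD('d) eig 4 k + ln (4 / \<delta>)) / real n)
             + 2 * C * norm ((\<Sigma> ** mat_sqrt \<Sigma>) *v bias_vec \<Sigma> lam \<theta>\<^sub>0) / sqrt (2 * lam)
                 * sqrt ((4 * real k + 4 * tail_rank CARD('d) eig 2 k + ln (4 / \<delta>)) / real n)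
             + remainder_term \<Sigma> \<theta>\<^sub>0 \<sigma> C \<mu> lam n \<delta>"
    proof -
      have p2': "4 * real k + 4 * tail_rank CARD('d) eig 2 k + L = p2 + L" by (simp add: p2_def)
      have "4 * (2 * \<sigma> + C * norm v1) * sqrt ((p1 + L) / real n)
         = 4 * (2 * \<sigma>) * sqrt ((p1 + L) / real n) + 4 * (C * norm v1) * sqrt ((p1 + L) / real n)"
        by (simp add: algebra_simps)
      thus ?thesis
        using main t1 t2 t3 rem
        unfolding b_def[symmetric] S_def[symmetric] v1_def[symmetric] v2_def[symmetric] p1_def[symmetric]
          L_def[symmetric] p2' \<theta>_def[symmetric] \<Delta>_def[symmetric] by linarith
    qed
  qed
qed

end
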